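(* Let $R=\bigoplus_{n\ge 0}R_n$ be a finitely generated standard graded algebra over a Noetherian commutative ring $R_0$, let $M$ be a finitely generated graded $R$-module, and let $t\ge0$ be an integer. Let $z_1,\ldots,z_{t+1}$ be an $M$-filter-regular sequence of linear forms (elements of $R_1$). Then (a) $\operatorname{reg}_t(M)=a(z_1,\ldots,z_{t+1};M)$; (b) $a^*_t(M)=s(z_1,\ldots,z_{t+1};M)$.
   Context: Standard graded means $R$ is generated over $R_0$ by $R_1$; $R_+=\bigoplus_{n\ge1}R_n$. For a graded $R$-module $H$, $a(H)=\sup\{r\mid H_r\ne0\}$, with $a(0)=-\infty$. $H^i_{R_+}(M)$ is the $i$-th (graded) local cohomology module of $M$ with respect to $R_+$, and $a_i(M)=a(H^i_{R_+}(M))$. The partial regularities are $\operatorname{reg}_t(M)=\max\{a_i(M)+i\mid 0\le i\le t\}$ and $a^*_t(M)=\max\{a_i(M)\mid 0\le i\le t\}$. A homogeneous element $z\in R$ is $M$-filter-regular if $(0_M:z)_r=0$ for $r\gg0$, where $0_M:z=\{e\in M\mid ze=0\}$. Put $Q_0=0$, $Q_i=(z_1,\ldots,z_i)$. A sequence $z_1,\ldots,z_m$ of homogeneous elements is an $M$-filter-regular sequence if $z_{i+1}$ is $M/Q_iM$-filter-regular for $i=0,\ldots,m-1$. With $Q_iM:z=\{e\in M\mid ze\in Q_iM\}$, one sets $$a(z_1,\ldots,z_m;M)=\max\{a((Q_iM:z_{i+1})/Q_iM)\mid i=0,\ldots,m-1\},$$ $$s(z_1,\ldots,z_m;M)=\max\{a((Q_iM:z_{i+1})/Q_iM)-i\mid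 i=0,\ldots,m-1\}.$$ *)

theory Defs
  imports "HOL-Library.Extended_Real" "HOL-Computational_Algebra.Polynomial"
begin

text \<open>
  The ring \<open>R\<close> is a whole type \<open>'r\<close>; its grading is a family \<open>Rg\<close> of subsets. An \<open>R\<close>-module is a
  type \<open>'m\<close> with a scalar multiplication satisfying the locale \<open>module\<close>. A graded module is given by
  a family \<open>G\<close> of homogeneous components inside such a type; its underlying set is \<open>internal_sum G\<close>,
  which need not be the whole type.
\<close>

definition internal_sum :: "('i \<Rightarrow> 'm::ab_group_add set) \<Rightarrow> 'm set" where
  "internal_sum G = {\<Sum>i\<in>I. f i | I f. finite I \<and> (\<forall>i\<in>I. f i \<in> G i)}"

definition add_subgroup :: "'m::ab_group_add set \<Rightarrow> bool" where
  "add_subgroup A \<longleftrightarrow> 0 \<in> A \<and> (\<forall>x\<in>A. \<forall>y\<in>A. x - y \<in> A)"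

definition direct_family :: "('i \<Rightarrow> 'm::ab_group_add set) \<Rightarrow> bool" where
  "direct_family G \<longleftrightarrow> (\<forall>i. add_subgroup (G i)) \<and>
     (\<forall>I f. finite I \<and> (\<forall>i\<in>I. f i \<in> G i) \<and> (\<Sum>i\<in>I. f i) = 0 \<longrightarrow> (\<forall>i\<in>I. f i = 0))"

subsection \<open>Graded rings\<close>

definition graded_ring :: "(nat \<Rightarrow> 'r::comm_ring_1 set) \<Rightarrow> bool" where
  "graded_ring Rg \<longleftrightarrow> direct_family Rg \<and> internal_sum Rg = UNIV \<and> 1 \<in> Rg 0 \<and>
     (\<forall>m n. \<forall>a\<in>Rg m. \<forall>b\<in>Rg n. a * b \<in> Rg (m + n))"

definition is_subring :: "'r::comm_ring_1 set \<Rightarrow> bool" where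
  "is_subring S \<longleftrightarrow> 1 \<in> S \<and> (\<forall>x\<in>S. \<forall>y\<in>S. x - y \<in> S \<and> x * y \<in> S)"

definition standard_graded :: "(nat \<Rightarrow> 'r::comm_ring_1 set) \<Rightarrow> bool" where
  "standard_graded Rg \<longleftrightarrow> graded_ring Rg \<and> is_subring hull (Rg 0 \<union> Rg 1) = UNIV"

definition finitely_generated_algebra :: "'r::comm_ring_1 set \<Rightarrow> bool" where
  "finitely_generated_algebra S \<longleftrightarrow> (\<exists>F. finite F \<and> is_subring hull (S \<union> F) = UNIV)"

definition ideal_of_subring :: "'r::comm_ring_1 set \<Rightarrow> 'r set \<Rightarrow> bool" where
  "ideal_of_subring S J \<longleftrightarrow> J \<subseteq> S \<and> add_subgroup J \<and> (\<forall>a\<in>S. \<forall>x\<in>J. a * x \<in> J)"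

definition noetherian_subring :: "'r::comm_ring_1 set \<Rightarrow> bool" where
  "noetherian_subring S \<longleftrightarrow> is_subring S \<and>
     (\<forall>J. ideal_of_subring S J \<longrightarrow>
        (\<exists>F. finite F \<and> F \<subseteq> J \<and> J = {\<Sum>x\<in>F. c x * x | c. \<forall>x\<in>F. c x \<in> S}))"

definition irrelevant_ideal :: "(nat \<Rightarrow> 'r::comm_ring_1 set) \<Rightarrow> 'r set" where
  "irrelevant_ideal Rg = internal_sum (\<lambda>n. Rg (Suc n))"

subsection \<open>Graded modules\<close>

definition graded_module ::
  "(nat \<Rightarrow> 'r::comm_ring_1 set) \<Rightarrow> ('r \<Rightarrow> 'm \<Rightarrow> 'm::ab_group_add) \<Rightarrow> (int \<Rightarrow> 'm set) \<Rightarrow> bool" where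
  "graded_module Rg sc G \<longleftrightarrow> module sc \<and> direct_family G \<and>
     (\<forall>n r. \<forall>a\<in>Rg n. \<forall>x\<in>G r. sc a x \<in> G (int n + r))"

definition finitely_generated_module :: "('r::comm_ring_1 \<Rightarrow> 'm \<Rightarrow> 'm::ab_group_add) \<Rightarrow> bool" where
  "finitely_generated_module sc \<longleftrightarrow> (\<exists>F. finite F \<and> module.span sc F = UNIV)"

text \<open>Homogeneous homomorphisms of degree 0; only the values on \<open>internal_sum G\<close> matter.\<close>

definition graded_hom ::
  "('r \<Rightarrow> 'm \<Rightarrow> 'm::ab_group_add) \<Rightarrow> (int \<Rightarrow> 'm set) \<Rightarrow>
   ('r \<Rightarrow> 'n \<Rightarrow> 'n::ab_group_add) \<Rightarrow> (int \<Rightarrow> 'n set) \<Rightarrow> ('m \<Rightarrow> 'n) \<Rightarrow> bool" where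
  "graded_hom sc G sc' G' f \<longleftrightarrow>
     (\<forall>x\<in>internal_sum G. \<forall>y\<in>internal_sum G. f (x + y) = f x + f y) \<and>
     (\<forall>a. \<forall>x\<in>internal_sum G. f (sc a x) = sc' a (f x)) \<and>
     (\<forall>r. f ` G r \<subseteq> G' r)"

text \<open>
  For graded submodules \<open>B \<subseteq> Z\<close> of the graded module \<open>G\<close>, the component of degree \<open>r\<close> of \<open>Z / B\<close> is
  \<open>(Z \<inter> G r) / (B \<inter> G r)\<close>; \<open>end_degree G Z B\<close> is \<open>a (Z / B)\<close>, with value \<open>-\<infinity>\<close> if \<open>Z / B = 0\<close>.
\<close>

definition end_degree :: "(int \<Rightarrow> 'm set) \<Rightarrow> 'm set \<Rightarrow> 'm set \<Rightarrow> ereal" where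
  "end_degree G Z B = Sup {ereal (real_of_int r) | r. Z \<inter> G r \<noteq> B \<inter> G r}"

subsection \<open>Filter-regular sequences\<close>

definition ideal_times :: "('r::comm_ring_1 \<Rightarrow> 'm \<Rightarrow> 'm::ab_group_add) \<Rightarrow> 'r set \<Rightarrow> 'm set" where
  "ideal_times sc J = module.span sc {sc a x | a x. a \<in> J}"

definition Q_ideal :: "'r::comm_ring_1 list \<Rightarrow> nat \<Rightarrow> 'r set" where
  "Q_ideal zs i = module.span (*) (set (take i zs))"

definition colon :: "('r \<Rightarrow> 'm \<Rightarrow> 'm) \<Rightarrow> 'm set \<Rightarrow> 'r \<Rightarrow> 'm set" where
  "colon sc N z = {x. sc z x \<in> N}"

text \<open>\<open>z\<close> is \<open>M/N\<close>-filter-regular: \<open>0 : z\<close> in \<open>M/N\<close> is \<open>colon sc N z / N\<close>.\<close>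

definition filter_regular_mod ::
  "('r \<Rightarrow> 'm \<Rightarrow> 'm) \<Rightarrow> (int \<Rightarrow> 'm set) \<Rightarrow> 'm set \<Rightarrow> 'r \<Rightarrow> bool" where
  "filter_regular_mod sc G N z \<longleftrightarrow> (\<exists>r0. \<forall>r\<ge>r0. colon sc N z \<inter> G r = N \<inter> G r)"

definition filter_regular_seq ::
  "(nat \<Rightarrow> 'r::comm_ring_1 set) \<Rightarrow> ('r \<Rightarrow> 'm \<Rightarrow> 'm::ab_group_add) \<Rightarrow> (int \<Rightarrow> 'm set) \<Rightarrow> 'r list \<Rightarrow> bool"
  where
  "filter_regular_seq Rg sc G zs \<longleftrightarrow> (\<forall>z\<in>set zs. \<exists>n. z \<in> Rg n) \<and>
     (\<forall>i<length zs. filter_regular_mod sc G (ideal_times sc (Q_ideal zs i)) (zs ! i))"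

definition a_quot ::
  "('r::comm_ring_1 \<Rightarrow> 'm \<Rightarrow> 'm::ab_group_add) \<Rightarrow> (int \<Rightarrow> 'm set) \<Rightarrow> 'r list \<Rightarrow> nat \<Rightarrow> ereal" where
  "a_quot sc G zs i =
     end_degree G (colon sc (ideal_times sc (Q_ideal zs i)) (zs ! i)) (ideal_times sc (Q_ideal zs i))"

definition a_seq ::
  "('r::comm_ring_1 \<Rightarrow> 'm \<Rightarrow> 'm::ab_group_add) \<Rightarrow> (int \<Rightarrow> 'm set) \<Rightarrow> 'r list \<Rightarrow> ereal" where
  "a_seq sc G zs = Max ((\<lambda>i. a_quot sc G zs i) ` {..<length zs})"

definition s_seq ::
  "('r::comm_ring_1 \<Rightarrow> 'm \<Rightarrow> 'm::ab_group_add) \<Rightarrow> (int \<Rightarrow> 'm set) \<Rightarrow> 'r list \<Rightarrow> ereal" where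
  "s_seq sc G zs = Max ((\<lambda>i. a_quot sc G zs i - ereal (real i)) ` {..<length zs})"

subsection \<open>Graded local cohomology\<close>

text \<open>
  Injective objects of the category of graded \<open>R\<close>-modules. HOL cannot quantify over all types inside
  a definition, so the type \<open>'t\<close> in which the test modules \<open>B \<subseteq> A\<close> live is a parameter.
  If \<open>'t\<close> has room for the shifted free modules \<open>R(n)\<close>, as is the case for the free module
  \<open>'r poly\<close> of countable rank, then by Baer's criterion the notion coincides
  with injectivity with respect to all graded modules.
\<close>

definition graded_injective ::
  "'t::ab_group_add itself \<Rightarrow> (nat \<Rightarrow> 'r::comm_ring_1 set) \<Rightarrow>
   ('r \<Rightarrow> 'e \<Rightarrow> 'e::ab_group_add) \<Rightarrow> (int \<Rightarrow> 'e set) \<Rightarrow> bool" where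
  "graded_injective T Rg sE E \<longleftrightarrow> graded_module Rg sE E \<and>
     (\<forall>(sA :: 'r \<Rightarrow> 't \<Rightarrow> 't) A B f.
        graded_module Rg sA A \<and> graded_module Rg sA B \<and> (\<forall>r. B r \<subseteq> A r) \<and>
        graded_hom sA B sE E f \<longrightarrow>
        (\<exists>g. graded_hom sA A sE E g \<and> (\<forall>x\<in>internal_sum B. g x = f x)))"

text \<open>
  \<open>0 \<rightarrow> M \<rightarrow> E 0 \<rightarrow> E 1 \<rightarrow> \<dots>\<close> with augmentation \<open>\<epsilon>\<close> and differentials \<open>d j : E j \<rightarrow> E (j + 1)\<close>;
  \<open>E j r\<close> is the component of internal degree \<open>r\<close> of the \<open>j\<close>-th term. All terms are submodules of one
  ambient module on \<open>'e\<close>, which is no restriction, since one may take the direct sum of all terms.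
\<close>

definition graded_injective_resolution ::
  "(nat \<Rightarrow> 'r::comm_ring_1 set) \<Rightarrow> ('r \<Rightarrow> 'm \<Rightarrow> 'm::ab_group_add) \<Rightarrow> (int \<Rightarrow> 'm set) \<Rightarrow>
   ('r \<Rightarrow> 'e \<Rightarrow> 'e::ab_group_add) \<Rightarrow> (nat \<Rightarrow> int \<Rightarrow> 'e set) \<Rightarrow>
   ('m \<Rightarrow> 'e) \<Rightarrow> (nat \<Rightarrow> 'e \<Rightarrow> 'e) \<Rightarrow> bool" where
  "graded_injective_resolution Rg sM Mg sE E \<epsilon> d \<longleftrightarrow>
     (\<forall>j. graded_injective TYPE('r poly) Rg sE (E j)) \<and>
     graded_hom sM Mg sE (E 0) \<epsilon> \<and>
     (\<forall>j. graded_hom sE (E j) sE (E (Suc j)) (d j)) \<and>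
     inj_on \<epsilon> (internal_sum Mg) \<and>
     {x \<in> internal_sum (E 0). d 0 x = 0} = \<epsilon> ` internal_sum Mg \<and>
     (\<forall>j. {x \<in> internal_sum (E (Suc j)). d (Suc j) x = 0} = d j ` internal_sum (E j))"

text \<open>
  The \<open>R\<^sub>+\<close>-torsion submodule: elements annihilated by a power of \<open>R\<^sub>+\<close>, the \<open>n\<close>-th power being generated
  by the \<open>n\<close>-fold products of elements of \<open>R\<^sub>+\<close>.
\<close>

definition torsion ::
  "(nat \<Rightarrow> 'r::comm_ring_1 set) \<Rightarrow> ('r \<Rightarrow> 'e \<Rightarrow> 'e::ab_group_add) \<Rightarrow> (int \<Rightarrow> 'e set) \<Rightarrow> 'e set" where
  "torsion Rg sE G = {x \<in> internal_sum G. \<exists>n. \<forall>as. length as = n \<and> set as \<subseteq> irrelevant_ideal Rg \<longrightarrow>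
     sE (prod_list as) x = 0}"

text \<open>
  The local cohomology modules are the right derived functors of the torsion functor:
  the \<open>i\<close>-th one is \<open>lc_cocycles i / lc_coboundaries i\<close>, the cohomology of the complex
  obtained from an injective resolution by applying \<open>torsion\<close>.
\<close>

definition lc_cocycles ::
  "(nat \<Rightarrow> 'r::comm_ring_1 set) \<Rightarrow> ('r \<Rightarrow> 'e \<Rightarrow> 'e::ab_group_add) \<Rightarrow> (nat \<Rightarrow> int \<Rightarrow> 'e set) \<Rightarrow>
   (nat \<Rightarrow> 'e \<Rightarrow> 'e) \<Rightarrow> nat \<Rightarrow> 'e set" where
  "lc_cocycles Rg sE E d i = {x \<in> torsion Rg sE (E i). d i x = 0}"

definition lc_coboundaries ::
  "(nat \<Rightarrow> 'r::comm_ring_1 set) \<Rightarrow> ('r \<Rightarrow> 'e \<Rightarrow> 'e::ab_group_add) \<Rightarrow> (nat \<Rightarrow> int \<Rightarrow> 'e set) \<Rightarrow>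
   (nat \<Rightarrow> 'e \<Rightarrow> 'e) \<Rightarrow> nat \<Rightarrow> 'e set" where
  "lc_coboundaries Rg sE E d i =
     (case i of 0 \<Rightarrow> {0} | Suc j \<Rightarrow> d j ` torsion Rg sE (E j))"

definition a_lc ::
  "(nat \<Rightarrow> 'r::comm_ring_1 set) \<Rightarrow> ('r \<Rightarrow> 'e \<Rightarrow> 'e::ab_group_add) \<Rightarrow> (nat \<Rightarrow> int \<Rightarrow> 'e set) \<Rightarrow>
   (nat \<Rightarrow> 'e \<Rightarrow> 'e) \<Rightarrow> nat \<Rightarrow> ereal" where
  "a_lc Rg sE E d i = end_degree (E i) (lc_cocycles Rg sE E d i) (lc_coboundaries Rg sE E d i)"

definition partial_reg ::
  "(nat \<Rightarrow> 'r::comm_ring_1 set) \<Rightarrow> ('r \<Rightarrow> 'e \<Rightarrow> 'e::ab_group_add) \<Rightarrow> (nat \<Rightarrow> int \<Rightarrow> 'e set) \<Rightarrow>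
   (nat \<Rightarrow> 'e \<Rightarrow> 'e) \<Rightarrow> nat \<Rightarrow> ereal" where
  "partial_reg Rg sE E d t = Max ((\<lambda>i. a_lc Rg sE E d i + ereal (real i)) ` {..t})"

definition partial_a_star ::
  "(nat \<Rightarrow> 'r::comm_ring_1 set) \<Rightarrow> ('r \<Rightarrow> 'e \<Rightarrow> 'e::ab_group_add) \<Rightarrow> (nat \<Rightarrow> int \<Rightarrow> 'e set) \<Rightarrow>
   (nat \<Rightarrow> 'e \<Rightarrow> 'e) \<Rightarrow> nat \<Rightarrow> ereal" where
  "partial_a_star Rg sE E d t = Max ((\<lambda>i. a_lc Rg sE E d i) ` {..t})"

end

theory Submission
  imports Defs "HOL-Library.Function_Algebras"
begin

text \<open>
  Let \<open>C 0\<close> be the injective resolution \<open>E\<close> and \<open>C (i + 1)\<close> the mapping cone of multiplication by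
  \<open>z\<^sub>i\<^sub>+\<^sub>1\<close> on \<open>C i\<close>. Inductively \<open>C i\<close> has cohomology \<open>M / Q\<^sub>i M\<close> in degree \<open>0\<close>, none in positive
  degrees, and, by filter-regularity, cohomology bounded above in negative degrees. The last
  point makes \<open>C i\<close> split exact below degree \<open>0\<close> in large internal degrees, and therefore
  \<open>H\<^sup>0 (\<Gamma> (C i))\<close> is the torsion of \<open>M / Q\<^sub>i M\<close>, whose end degree is read off from the kernel of
  \<open>z\<^sub>i\<^sub>+\<^sub>1\<close>. The long exact sequences of the cones,
  \<open>H\<^sup>j (\<Gamma> (C i))\<^sub>r \<rightarrow> H\<^sup>j (\<Gamma> (C (i + 1)))\<^sub>r \<rightarrow> H\<^sup>j\<^sup>+\<^sup>1 (\<Gamma> (C i))\<^sub>r\<^sub>-\<^sub>1 \<rightarrow> H\<^sup>j\<^sup>+\<^sup>1 (\<Gamma> (C i))\<^sub>r\<close>,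
  together with the fact that every torsion class is killed by a power of \<open>z\<^sub>i\<^sub>+\<^sub>1\<close>, trade one
  cohomological degree for one cone; both equalities follow by comparing degrees.
\<close>

section \<open>Direct families\<close>

text \<open>Only \<open>M\<close> comes with an injective resolution; the cones are Koszul complexes
  on \<open>E\<close> and take the place of resolutions of the quotients M/Q_i M. A filter-regular
  element may be a zero divisor, so the cones can have cohomology in negative degrees, and passing
  between torsion cocycles and arbitrary cocycles in degree 0 is the obstacle. One device settles
  it: if all high-degree multiples of a cochain \<open>x\<close> are boundaries, then
  \<open>a \<mapsto> \<sigma> (a x)\<close>, with \<open>\<sigma>\<close> a section of the
  differential in large degrees, is a linear map on a homogeneous ideal; Baer's criterion makes it
  multiplication by some \<open>w\<close>, and \<open>x - d w\<close> is torsion. Injectivity is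
  therefore used as Baer's criterion for families of homogeneous components, a form that passes to
  cones coordinate by coordinate. Each cone twists its first summand by one internal degree. Trading
  a cohomological degree for a cone thus preserves the sum of the two degrees, up to the powers of
  the linear form used; this gives (a), and losing at most one internal degree per cone gives
  (b).\<close>

lemma add_subgroup_0: "add_subgroup A \<Longrightarrow> 0 \<in> A"
  by (simp add: add_subgroup_def)

lemma add_subgroup_diff: "add_subgroup A \<Longrightarrow> x \<in> A \<Longrightarrow> y \<in> A \<Longrightarrow> x - y \<in> A"
  by (simp add: add_subgroup_def)

lemma add_subgroup_uminus: "add_subgroup A \<Longrightarrow> x \<in> A \<Longrightarrow> - x \<in> A"
  using add_subgroup_diff[of A 0 x] add_subgroup_0[of A] by simp

lemma add_subgroup_add: "add_subgroup A \<Longrightarrow> x \<in> A \<Longrightarrow> y \<in> A \<Longrightarrow> x + y \<in> A"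
  using add_subgroup_diff[of A x "- y"] add_subgroup_uminus[of A y] by simp

lemma internal_sumI: "finite I \<Longrightarrow> (\<And>i. i \<in> I \<Longrightarrow> f i \<in> G i) \<Longrightarrow> (\<Sum>i\<in>I. f i) \<in> internal_sum G"
  unfolding internal_sum_def by blast

lemma internal_sumE:
  assumes "x \<in> internal_sum G"
  obtains I f where "finite I" "\<forall>i\<in>I. f i \<in> G i" "x = (\<Sum>i\<in>I. f i)"
  using assms unfolding internal_sum_def by blast

lemma internal_sum_homogeneous: "x \<in> G i \<Longrightarrow> x \<in> internal_sum G"
  using internal_sumI[of "{i}" "\<lambda>_. x" G] by simp

lemma internal_sum_add:
  assumes G: "\<And>i. add_subgroup (G i)" and x: "x \<in> internal_sum G" and y: "y \<in> internal_sum G"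
  shows "x + y \<in> internal_sum G"
proof -
  from x obtain I f where I: "finite I" "\<forall>i\<in>I. f i \<in> G i" "x = (\<Sum>i\<in>I. f i)"
    by (rule internal_sumE)
  from y obtain J g where J: "finite J" "\<forall>i\<in>J. g i \<in> G i" "y = (\<Sum>i\<in>J. g i)"
    by (rule internal_sumE)
  let ?h = "\<lambda>i. (if i \<in> I then f i else 0) + (if i \<in> J then g i else 0)"
  have "(\<Sum>i\<in>I \<union> J. ?h i) = x + y"
    using I(1,3) J(1,3) by (simp add: sum.distrib sum.If_cases Int_Un_distrib2 Int_absorb1 Int_absorb2)
  moreover have "(\<Sum>i\<in>I \<union> J. ?h i) \<in> internal_sum G"
    by (rule internal_sumI) (auto simp: I J G intro!: add_subgroup_add add_subgroup_0)
  ultimately show ?thesis by simp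
qed

lemma internal_sum_0: "0 \<in> internal_sum G"
  using internal_sumI[of "{}" undefined G] by simp

lemma internal_sum_induct [consumes 2, case_names hom add]:
  assumes "x \<in> internal_sum G" and G: "\<And>i. add_subgroup (G i)"
    and hom: "\<And>i x. x \<in> G i \<Longrightarrow> P x"
    and add: "\<And>x y. x \<in> internal_sum G \<Longrightarrow> y \<in> internal_sum G \<Longrightarrow> P x \<Longrightarrow> P y \<Longrightarrow> P (x + y)"
  shows "P x"
proof -
  obtain I f where I: "finite I" "\<forall>i\<in>I. f i \<in> G i" "x = (\<Sum>i\<in>I. f i)"
    using assms(1) by (rule internal_sumE)
  have "P (\<Sum>i\<in>I. f i)" using I(1,2)
  proof (induction I rule: finite_induct)
    case empty
    have "P 0" by (rule hom[OF add_subgroup_0[OF G]])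
    then show ?case by simp
  next
    case (insert j I)
    have "(\<Sum>i\<in>I. f i) \<in> internal_sum G" using insert by (intro internal_sumI) auto
    moreover have "f j \<in> internal_sum G" using insert by (intro internal_sum_homogeneous[of _ _ j]) auto
    ultimately have "P (f j + (\<Sum>i\<in>I. f i))" using insert hom[of "f j" j] by (intro add) auto
    then show ?case using insert by simp
  qed
  then show ?thesis using I(3) by simp
qed

lemma direct_family_add_subgroup: "direct_family G \<Longrightarrow> add_subgroup (G i)"
  by (simp add: direct_family_def)

lemma direct_familyD:
  "direct_family G \<Longrightarrow> finite I \<Longrightarrow> (\<And>i. i \<in> I \<Longrightarrow> f i \<in> G i) \<Longrightarrow> (\<Sum>i\<in>I. f i) = 0 \<Longrightarrow> i \<in> I \<Longrightarrow> f i = 0"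
  unfolding direct_family_def by blast

lemma direct_family_unique:
  assumes G: "direct_family G" and I: "finite I" "\<And>i. i \<in> I \<Longrightarrow> f i \<in> G i"
    and J: "finite J" "\<And>i. i \<in> J \<Longrightarrow> g i \<in> G i" and eq: "(\<Sum>i\<in>I. f i) = (\<Sum>i\<in>J. g i)"
  shows "(if i \<in> I then f i else 0) = (if i \<in> J then g i else 0)"
proof (cases "i \<in> I \<union> J")
  case True
  let ?h = "\<lambda>i. (if i \<in> I then f i else 0) - (if i \<in> J then g i else 0)"
  have "(\<Sum>i\<in>I \<union> J. ?h i) = 0"
    using I(1) J(1) eq by (simp add: sum_subtractf sum.If_cases Int_absorb1 Int_absorb2)
  then have "?h i = 0"
    using True I(1) J(1) by (intro direct_familyD[OF G, of "I \<union> J" ?h])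
      (auto simp: I J direct_family_add_subgroup[OF G] intro!: add_subgroup_diff add_subgroup_uminus add_subgroup_0)
  then show ?thesis by simp
qed auto

text \<open>Two decompositions of an element into homogeneous parts agree after padding with zeros,
  so maps given degree by degree glue to one function. This yields the projections
  \<open>component\<close> and the single function that \<open>graded_hom\<close> asks for.\<close>

lemma direct_family_extend:
  fixes G :: "'i \<Rightarrow> 'm::ab_group_add set" and \<phi> :: "'i \<Rightarrow> 'm \<Rightarrow> 'n::ab_group_add"
  assumes G: "direct_family G"
    and add: "\<And>i x y. x \<in> G i \<Longrightarrow> y \<in> G i \<Longrightarrow> \<phi> i (x + y) = \<phi> i x + \<phi> i y"
  obtains f where "\<And>i x. x \<in> G i \<Longrightarrow> f x = \<phi> i x"
    "\<And>x y. x \<in> internal_sum G \<Longrightarrow> y \<in> internal_sum G \<Longrightarrow> f (x + y) = f x + f y"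
proof -
  have sub: "add_subgroup (G i)" for i by (rule direct_family_add_subgroup[OF G])
  have zero: "\<phi> i 0 = 0" for i using add[of 0 i 0] add_subgroup_0[OF sub] by simp
  define dec where "dec x I c \<longleftrightarrow> finite I \<and> (\<forall>i\<in>I. c i \<in> G i) \<and> x = (\<Sum>i\<in>I. c i)" for x I c
  have wd: "(\<Sum>i\<in>I. \<phi> i (c i)) = (\<Sum>i\<in>J. \<phi> i (c' i))" if "dec x I c" "dec x J c'" for x I c J c'
  proof -
    have eq: "(if i \<in> I then c i else 0) = (if i \<in> J then c' i else 0)" for i
      using that unfolding dec_def by (intro direct_family_unique[OF G]) auto
    have fin: "finite I" "finite J" using that by (auto simp: dec_def)
    have "(\<Sum>i\<in>I. \<phi> i (c i)) = (\<Sum>i\<in>I \<union> J. \<phi> i (if i \<in> I then c i else 0))"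
      using fin by (intro sum.mono_neutral_cong_left) (auto simp: zero)
    also have "\<dots> = (\<Sum>i\<in>I \<union> J. \<phi> i (if i \<in> J then c' i else 0))" by (simp only: eq)
    also have "\<dots> = (\<Sum>i\<in>J. \<phi> i (c' i))"
      using fin by (intro sum.mono_neutral_cong_right) (auto simp: zero)
    finally show ?thesis .
  qed
  define f where "f x = (THE v. \<exists>I c. dec x I c \<and> v = (\<Sum>i\<in>I. \<phi> i (c i)))" for x
  have f: "f x = (\<Sum>i\<in>I. \<phi> i (c i))" if "dec x I c" for x I c
    unfolding f_def using that wd by (intro the_equality) blast+
  have "f x = \<phi> i x" if "x \<in> G i" for i x
    using f[of x "{i}" "\<lambda>_. x"] that by (simp add: dec_def)
  moreover have "f (x + y) = f x + f y" if x: "x \<in> internal_sum G" and y: "y \<in> internal_sum G" for x y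
  proof -
    from x obtain I c where I: "dec x I c" unfolding dec_def by (blast elim: internal_sumE)
    from y obtain J e where J: "dec y J e" unfolding dec_def by (blast elim: internal_sumE)
    let ?c = "\<lambda>i. if i \<in> I then c i else 0" and ?e = "\<lambda>i. if i \<in> J then e i else 0"
    have fin: "finite I" "finite J" using I J by (auto simp: dec_def)
    have cG: "?c i \<in> G i" and eG: "?e i \<in> G i" for i
      using I J add_subgroup_0[OF sub] by (auto simp: dec_def)
    have x': "dec x (I \<union> J) ?c" using I fin cG unfolding dec_def
      by (auto intro!: sum.mono_neutral_cong_left)
    have y': "dec y (I \<union> J) ?e" using J fin eG unfolding dec_def
      by (auto intro!: sum.mono_neutral_cong_left)
    have xy: "dec (x + y) (I \<union> J) (\<lambda>i. ?c i + ?e i)"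
      using x' y' add_subgroup_add[OF sub cG eG] unfolding dec_def by (simp add: sum.distrib)
    show ?thesis using f[OF x'] f[OF y'] f[OF xy] by (simp add: add[OF cG eG] sum.distrib)
  qed
  ultimately show ?thesis by (rule that)
qed

lemma additive_internal_sum_mem:
  assumes G: "\<And>i. add_subgroup (G i)" and G': "\<And>i. add_subgroup (G' i)"
    and add: "\<And>x y. x \<in> internal_sum G \<Longrightarrow> y \<in> internal_sum G \<Longrightarrow> f (x + y) = f x + f y"
    and f: "\<And>i x. x \<in> G i \<Longrightarrow> f x \<in> G' (h i)" and x: "x \<in> internal_sum G"
  shows "f x \<in> internal_sum G'"
  using x G
proof (induction rule: internal_sum_induct)
  case (hom i x)
  then show ?case using f by (intro internal_sum_homogeneous[of _ _ "h i"])
next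
  case (add x y)
  then show ?case using assms(3) internal_sum_add[of G' "f x" "f y"] G' by simp
qed

section \<open>Projections onto homogeneous components\<close>

definition component :: "('i \<Rightarrow> 'm::ab_group_add set) \<Rightarrow> 'i \<Rightarrow> 'm \<Rightarrow> 'm" where
  "component G r = (SOME f. (\<forall>i. \<forall>x\<in>G i. f x = (if i = r then x else 0)) \<and>
     (\<forall>x\<in>internal_sum G. \<forall>y\<in>internal_sum G. f (x + y) = f x + f y))"

lemma component:
  assumes G: "direct_family G"
  shows component_homogeneous: "x \<in> G i \<Longrightarrow> component G r x = (if i = r then x else 0)"
    and component_add: "x \<in> internal_sum G \<Longrightarrow> y \<in> internal_sum G \<Longrightarrow>
      component G r (x + y) = component G r x + component G r y"
proof -
  obtain f where "\<And>i x. x \<in> G i \<Longrightarrow> f x = (if i = r then x else 0)"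
    "\<And>x y. x \<in> internal_sum G \<Longrightarrow> y \<in> internal_sum G \<Longrightarrow> f (x + y) = f x + f y"
    by (rule direct_family_extend[OF G, of "\<lambda>i x. if i = r then x else 0"]) auto
  then have "\<exists>f. (\<forall>i. \<forall>x\<in>G i. f x = (if i = r then x else 0)) \<and>
     (\<forall>x\<in>internal_sum G. \<forall>y\<in>internal_sum G. f (x + y) = f x + f y)" by (intro exI[of _ f]) simp
  from someI_ex[OF this] have "(\<forall>i. \<forall>x\<in>G i. component G r x = (if i = r then x else 0)) \<and>
     (\<forall>x\<in>internal_sum G. \<forall>y\<in>internal_sum G. component G r (x + y) = component G r x + component G r y)"
    unfolding component_def .
  then show "x \<in> G i \<Longrightarrow> component G r x = (if i = r then x else 0)"
    "x \<in> internal_sum G \<Longrightarrow> y \<in> internal_sum G \<Longrightarrow>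
      component G r (x + y) = component G r x + component G r y" by blast+
qed

lemma component_mem:
  assumes G: "direct_family G" and x: "x \<in> internal_sum G"
  shows "component G r x \<in> G r"
  using x direct_family_add_subgroup[OF G]
proof (induction rule: internal_sum_induct)
  case (hom i x)
  then show ?case
    using component_homogeneous[OF G, of x i r] add_subgroup_0[OF direct_family_add_subgroup[OF G]] by auto
next
  case (add x y)
  then show ?case
    using component_add[OF G] add_subgroup_add[OF direct_family_add_subgroup[OF G]] by metis
qed

text \<open>The map \<open>h\<close> records how \<open>f\<close> changes degrees, for instance the
  shift by \<open>n\<close> under multiplication by a form of degree \<open>n\<close>. Its
  injectivity keeps the other components of \<open>x\<close> out of degree
  \<open>h r\<close>.\<close>

lemma component_commute:
  assumes G: "direct_family G" and G': "direct_family G'" and h: "inj h"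
    and add: "\<And>x y. x \<in> internal_sum G \<Longrightarrow> y \<in> internal_sum G \<Longrightarrow> f (x + y) = f x + f y"
    and f: "\<And>i x. x \<in> G i \<Longrightarrow> f x \<in> G' (h i)" and x: "x \<in> internal_sum G"
  shows "component G' (h r) (f x) = f (component G r x)"
  using x direct_family_add_subgroup[OF G]
proof (induction rule: internal_sum_induct)
  case (hom i x)
  have "f 0 = 0" using add[OF internal_sum_0 internal_sum_0] by simp
  then show ?case
    using component_homogeneous[OF G hom, of r] component_homogeneous[OF G' f[OF hom], of "h r"] injD[OF h, of i r]
    by auto
next
  case (add x y)
  have mem: "f u \<in> internal_sum G'" if "u \<in> internal_sum G" for u
    by (rule additive_internal_sum_mem[where h = h, OF direct_family_add_subgroup[OF G] direct_family_add_subgroup[OF G'] assms(4)])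
      (use f that in auto)
  have cmem: "component G r u \<in> internal_sum G" if "u \<in> internal_sum G" for u
    using component_mem[OF G that] by (rule internal_sum_homogeneous)
  show ?case
    using add component_add[OF G add(1,2), of r] component_add[OF G' mem[OF add(1)] mem[OF add(2)], of "h r"]
      assms(4)[OF add(1,2)] assms(4)[OF cmem[OF add(1)] cmem[OF add(2)]] by simp
qed

lemma graded_module_scale_internal_sum:
  assumes R: "graded_ring Rg" and M: "graded_module Rg sc G" and x: "x \<in> internal_sum G"
  shows "sc a x \<in> internal_sum G"
proof -
  interpret module sc using M by (simp add: graded_module_def)
  have G: "add_subgroup (G r)" for r using M by (simp add: graded_module_def direct_family_def)
  have "a \<in> internal_sum Rg" using R by (simp add: graded_ring_def)
  moreover have "\<And>n. add_subgroup (Rg n)" using R by (simp add: graded_ring_def direct_family_def)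
  ultimately show ?thesis
  proof (induction rule: internal_sum_induct)
    case (hom n a)
    show ?case
      by (rule additive_internal_sum_mem[OF G G, where f = "sc a" and h = "\<lambda>r. int n + r"])
        (use hom x M in \<open>auto simp: scale_right_distrib graded_module_def\<close>)
  next
    case (add a b)
    then show ?case using internal_sum_add[of G] G by (simp add: scale_left_distrib)
  qed
qed

section \<open>Baer's criterion for families of homogeneous components\<close>

locale graded_action = module sc
  for sc :: "'r::comm_ring_1 \<Rightarrow> 'u::ab_group_add \<Rightarrow> 'u" +
  fixes Rg :: "nat \<Rightarrow> 'r set"
  assumes Rg: "graded_ring Rg"
begin

lemma Rg_subgroup: "add_subgroup (Rg n)"
  using Rg by (simp add: graded_ring_def direct_family_def)

lemma Rg_one: "1 \<in> Rg 0"
  using Rg by (simp add: graded_ring_def)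

lemma Rg_mult: "a \<in> Rg m \<Longrightarrow> b \<in> Rg n \<Longrightarrow> a * b \<in> Rg (m + n)"
  using Rg by (simp add: graded_ring_def)

definition graded_sub :: "(int \<Rightarrow> 'u set) \<Rightarrow> bool" where
  "graded_sub F \<longleftrightarrow> (\<forall>r. add_subgroup (F r)) \<and> (\<forall>n r. \<forall>a\<in>Rg n. \<forall>x\<in>F r. sc a x \<in> F (int n + r))"

text \<open>One additive map per degree, with the degree as an argument, so that truncated families
  and choices made separately in each degree can be handled without gluing.\<close>

definition graded_map :: "(int \<Rightarrow> 'u set) \<Rightarrow> (int \<Rightarrow> 'u set) \<Rightarrow> (int \<Rightarrow> 'u \<Rightarrow> 'u) \<Rightarrow> bool" where
  "graded_map F D \<phi> \<longleftrightarrow> (\<forall>r. \<forall>x\<in>F r. \<phi> r x \<in> D r) \<and>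
     (\<forall>r. \<forall>x\<in>F r. \<forall>y\<in>F r. \<phi> r (x + y) = \<phi> r x + \<phi> r y) \<and>
     (\<forall>n r. \<forall>a\<in>Rg n. \<forall>x\<in>F r. \<phi> (int n + r) (sc a x) = sc a (\<phi> r x))"

definition homogeneous_ideal :: "(nat \<Rightarrow> 'r set) \<Rightarrow> bool" where
  "homogeneous_ideal J \<longleftrightarrow> (\<forall>n. J n \<subseteq> Rg n \<and> add_subgroup (J n)) \<and>
     (\<forall>m n. \<forall>a\<in>Rg m. \<forall>b\<in>J n. a * b \<in> J (m + n))"

definition ideal_map :: "(nat \<Rightarrow> 'r set) \<Rightarrow> (int \<Rightarrow> 'u set) \<Rightarrow> int \<Rightarrow> (nat \<Rightarrow> 'r \<Rightarrow> 'u) \<Rightarrow> bool" where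
  "ideal_map J D s \<phi> \<longleftrightarrow> (\<forall>n. \<forall>a\<in>J n. \<phi> n a \<in> D (int n + s)) \<and>
     (\<forall>n. \<forall>a\<in>J n. \<forall>b\<in>J n. \<phi> n (a + b) = \<phi> n a + \<phi> n b) \<and>
     (\<forall>m n. \<forall>a\<in>Rg m. \<forall>b\<in>J n. \<phi> (m + n) (a * b) = sc a (\<phi> n b))"

text \<open>The test objects are homogeneous ideals with degree \<open>n\<close> placed in degree
  \<open>n + s\<close>, that is, submodules of R(-s). An extension to all of R(-s) is multiplication
  by the image \<open>w\<close> of 1, an element of degree \<open>s\<close>.\<close>

definition baer :: "(int \<Rightarrow> 'u set) \<Rightarrow> bool" where
  "baer D \<longleftrightarrow> (\<forall>J s \<phi>. homogeneous_ideal J \<and> ideal_map J D s \<phi> \<longrightarrow>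
     (\<exists>w\<in>D s. \<forall>n. \<forall>a\<in>J n. \<phi> n a = sc a w))"

lemma graded_sub_subgroup: "graded_sub F \<Longrightarrow> add_subgroup (F r)"
  by (simp add: graded_sub_def)

lemma graded_sub_scale: "graded_sub F \<Longrightarrow> a \<in> Rg n \<Longrightarrow> x \<in> F r \<Longrightarrow> sc a x \<in> F (int n + r)"
  by (simp add: graded_sub_def)

lemma graded_map_mem: "graded_map F D \<phi> \<Longrightarrow> x \<in> F r \<Longrightarrow> \<phi> r x \<in> D r"
  by (simp add: graded_map_def)

lemma graded_map_add:
  "graded_map F D \<phi> \<Longrightarrow> x \<in> F r \<Longrightarrow> y \<in> F r \<Longrightarrow> \<phi> r (x + y) = \<phi> r x + \<phi> r y"
  by (simp add: graded_map_def)

lemma graded_map_scale: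
  "graded_map F D \<phi> \<Longrightarrow> a \<in> Rg n \<Longrightarrow> x \<in> F r \<Longrightarrow> \<phi> (int n + r) (sc a x) = sc a (\<phi> r x)"
  by (simp add: graded_map_def)

lemma graded_map_zero: "graded_sub F \<Longrightarrow> graded_map F D \<phi> \<Longrightarrow> \<phi> r 0 = 0"
  using graded_map_add[of F D \<phi> 0 r 0] add_subgroup_0[OF graded_sub_subgroup] by simp

lemma graded_map_minus: "graded_sub F \<Longrightarrow> graded_map F D \<phi> \<Longrightarrow> x \<in> F r \<Longrightarrow> \<phi> r (- x) = - \<phi> r x"
  using graded_map_add[of F D \<phi> x r "- x"] add_subgroup_uminus[OF graded_sub_subgroup, of F x r]
    graded_map_zero[of F D \<phi> r] by (simp add: minus_unique)

lemma graded_map_diff: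
  "graded_sub F \<Longrightarrow> graded_map F D \<phi> \<Longrightarrow> x \<in> F r \<Longrightarrow> y \<in> F r \<Longrightarrow> \<phi> r (x - y) = \<phi> r x - \<phi> r y"
  using graded_map_add[of F D \<phi> x r "- y"] add_subgroup_uminus[OF graded_sub_subgroup, of F y r]
    graded_map_minus[of F D \<phi> y r] by simp

text \<open>Graphs of partially defined graded maps, so that Zorn's lemma can work with inclusions
  and unions. Closure under differences reduces single-valuedness to a trivial fibre over 0.\<close>

definition partial_map_graph :: "(int \<Rightarrow> 'u set) \<Rightarrow> (int \<Rightarrow> 'u set) \<Rightarrow> (int \<times> 'u \<times> 'u) set \<Rightarrow> bool" where
  "partial_map_graph A D g \<longleftrightarrow> (\<forall>r x y. (r, x, y) \<in> g \<longrightarrow> x \<in> A r \<and> y \<in> D r) \<and>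
     (\<forall>r. (r, 0, 0) \<in> g) \<and> (\<forall>r y. (r, 0, y) \<in> g \<longrightarrow> y = 0) \<and>
     (\<forall>r x y x' y'. (r, x, y) \<in> g \<longrightarrow> (r, x', y') \<in> g \<longrightarrow> (r, x - x', y - y') \<in> g) \<and>
     (\<forall>n r x y. \<forall>a\<in>Rg n. (r, x, y) \<in> g \<longrightarrow> (int n + r, sc a x, sc a y) \<in> g)"

lemma partial_map_graph_add:
  assumes "partial_map_graph A D g" "(r, x, y) \<in> g" "(r, x', y') \<in> g"
  shows "(r, x + x', y + y') \<in> g"
proof -
  have g0: "(r, 0, 0) \<in> g" using assms unfolding partial_map_graph_def by blast
  have diff: "(r, u, v) \<in> g \<Longrightarrow> (r, u', v') \<in> g \<Longrightarrow> (r, u - u', v - v') \<in> g" for u v u' v'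
    using assms(1) unfolding partial_map_graph_def by blast
  show ?thesis using diff[OF assms(2) diff[OF g0 assms(3)]] by simp
qed

lemma partial_map_graph_unique:
  assumes "partial_map_graph A D g" "(r, x, y) \<in> g" "(r, x, y') \<in> g"
  shows "y = y'"
proof -
  have "(r, x - x, y - y') \<in> g" using assms unfolding partial_map_graph_def by blast
  moreover have "v = 0" if "(r, 0, v) \<in> g" for v
    using assms(1) that unfolding partial_map_graph_def by blast
  ultimately have "y - y' = 0" by (metis diff_self)
  then show ?thesis by simp
qed

lemma partial_map_graph_Union:
  assumes "subset.chain {g. partial_map_graph A D g} c" "c \<noteq> {}"
  shows "partial_map_graph A D (\<Union>c)"
proof -
  have c: "partial_map_graph A D g" if "g \<in> c" for g using assms that by (auto simp: subset.chain_def)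
  have two: "\<exists>g\<in>c. u \<in> g \<and> v \<in> g" if "u \<in> \<Union>c" "v \<in> \<Union>c" for u v
    using that assms(1) unfolding subset.chain_def by blast
  show ?thesis unfolding partial_map_graph_def
  proof (intro conjI allI impI ballI)
    fix r x y assume "(r, x, y) \<in> \<Union>c"
    then obtain g where "g \<in> c" "(r, x, y) \<in> g" by blast
    then show "x \<in> A r" "y \<in> D r" using c[of g] unfolding partial_map_graph_def by blast+
  next
    fix r show "(r, 0, 0) \<in> \<Union>c" using assms(2) c unfolding partial_map_graph_def by blast
  next
    fix r y assume "(r, 0, y) \<in> \<Union>c"
    then obtain g where "g \<in> c" "(r, 0, y) \<in> g" by blast
    then show "y = 0" using c[of g] unfolding partial_map_graph_def by blast
  next
    fix r x y x' y' assume "(r, x, y) \<in> \<Union>c" "(r, x', y') \<in> \<Union>c"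
    then obtain g where "g \<in> c" "(r, x, y) \<in> g" "(r, x', y') \<in> g" using two by meson
    then show "(r, x - x', y - y') \<in> \<Union>c" using c[of g] unfolding partial_map_graph_def by blast
  next
    fix n r x y a assume "a \<in> Rg n" "(r, x, y) \<in> \<Union>c"
    then obtain g where "g \<in> c" "(r, x, y) \<in> g" by blast
    then show "(int n + r, sc a x, sc a y) \<in> \<Union>c"
      using c[of g] \<open>a \<in> Rg n\<close> unfolding partial_map_graph_def by blast
  qed
qed

text \<open>The classical Baer step: the scalars that bring \<open>x\<close> into the domain form a
  homogeneous ideal, on which \<open>a \<mapsto> g (a x)\<close> has the form
  \<open>a \<mapsto> a w\<close>, and then \<open>x\<close> can be sent to \<open>w\<close>.\<close>

lemma partial_map_graph_extend:
  assumes A: "graded_sub A" and D: "graded_sub D" "baer D" and g: "partial_map_graph A D g"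
    and x: "x \<in> A s"
  obtains g' w where "partial_map_graph A D g'" "g \<subseteq> g'" "(s, x, w) \<in> g'"
proof -
  have gmem: "u \<in> A r" "v \<in> D r" if "(r, u, v) \<in> g" for r u v
    using g that unfolding partial_map_graph_def by blast+
  have g0: "(r, 0, 0) \<in> g" for r using g unfolding partial_map_graph_def by blast
  have gz: "v = 0" if "(r, 0, v) \<in> g" for r v using g that unfolding partial_map_graph_def by blast
  have gdiff: "(r, u - u', v - v') \<in> g" if "(r, u, v) \<in> g" "(r, u', v') \<in> g" for r u v u' v'
    using g that unfolding partial_map_graph_def by blast
  have gsc: "(int n + r, sc a u, sc a v) \<in> g" if "a \<in> Rg n" "(r, u, v) \<in> g" for n r a u v
    using g that unfolding partial_map_graph_def by blast
  note gadd = partial_map_graph_add[OF g] and guniq = partial_map_graph_unique[OF g]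
  define J where "J n = {a \<in> Rg n. \<exists>y. (int n + s, sc a x, y) \<in> g}" for n
  define \<phi> where "\<phi> n a = (THE y. (int n + s, sc a x, y) \<in> g)" for n a
  have \<phi>_eq: "\<phi> n a = y" if "(int n + s, sc a x, y) \<in> g" for n a y
    unfolding \<phi>_def using that guniq by blast
  have \<phi>: "(int n + s, sc a x, \<phi> n a) \<in> g" if "a \<in> J n" for n a
    using that \<phi>_eq unfolding J_def by auto
  have J: "homogeneous_ideal J"
    unfolding homogeneous_ideal_def
  proof (intro conjI allI ballI)
    fix n
    show "J n \<subseteq> Rg n" by (auto simp: J_def)
    have "0 \<in> J n" using g0[of "int n + s"] add_subgroup_0[OF Rg_subgroup] by (auto simp: J_def)
    moreover have "a - b \<in> J n" if "a \<in> J n" "b \<in> J n" for a b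
      using gdiff[OF \<phi>[OF that(1)] \<phi>[OF that(2)]] that add_subgroup_diff[OF Rg_subgroup]
      by (auto simp: J_def scale_left_diff_distrib)
    ultimately show "add_subgroup (J n)" by (simp add: add_subgroup_def)
  next
    fix m n a b assume a: "a \<in> Rg m" and b: "b \<in> J n"
    show "a * b \<in> J (m + n)"
      using gsc[OF a \<phi>[OF b]] Rg_mult[OF a, of b n] b by (auto simp: J_def add.assoc)
  qed
  moreover have "ideal_map J D s \<phi>"
    unfolding ideal_map_def
  proof (intro conjI allI ballI)
    show "\<phi> n a \<in> D (int n + s)" if "a \<in> J n" for n a using gmem(2)[OF \<phi>[OF that]] .
    show "\<phi> n (a + b) = \<phi> n a + \<phi> n b" if "a \<in> J n" "b \<in> J n" for n a b
      using gadd[OF \<phi>[OF that(1)] \<phi>[OF that(2)]] by (intro \<phi>_eq) (simp add: scale_left_distrib)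
    show "\<phi> (m + n) (a * b) = sc a (\<phi> n b)" if "a \<in> Rg m" "b \<in> J n" for m n a b
      using gsc[OF that(1) \<phi>[OF that(2)]] by (intro \<phi>_eq) (simp add: add.assoc)
  qed
  ultimately obtain w where w: "w \<in> D s" "\<And>n a. a \<in> J n \<Longrightarrow> \<phi> n a = sc a w"
    using D(2) unfolding baer_def by blast
  \<comment> \<open>The grading of the ring extended by zero: an element of degree \<open>r\<close>
    in the enlarged domain takes a coefficient of \<open>x\<close> of degree \<open>r - s\<close>,
    which may be negative.\<close>
  define Z where "Z i = (if i \<ge> 0 then Rg (nat i) else {0})" for i :: int
  have Z_sub: "add_subgroup (Z i)" for i using Rg_subgroup by (auto simp: Z_def add_subgroup_def)
  have Z_mult: "a * b \<in> Z (int n + i)" if "a \<in> Rg n" "b \<in> Z i" for a b n i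
    using that Rg_mult[OF that(1), of b "nat i"] add_subgroup_0[OF Rg_subgroup]
    by (auto simp: Z_def nat_add_distrib split: if_splits)
  have Z_scale: "sc a y \<in> F r" if "graded_sub F" "a \<in> Z (r - s)" "y \<in> F s" for a y r F
    using graded_sub_scale[OF that(1), of a "nat (r - s)" y s] that add_subgroup_0[OF graded_sub_subgroup[OF that(1)]]
    by (auto simp: Z_def split: if_splits)
  define g' where "g' = {(r, u + sc a x, v + sc a w) | r u v a. (r, u, v) \<in> g \<and> a \<in> Z (r - s)}"
  have g'I: "(r, p, q) \<in> g'" if "(r, u, v) \<in> g" "a \<in> Z (r - s)" "p = u + sc a x" "q = v + sc a w" for r u v a p q
    using that unfolding g'_def by blast
  \<comment> \<open>Single-valuedness: a relation \<open>u + a x = 0\<close> puts \<open>a\<close>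
    into \<open>J\<close> with value \<open>- v\<close>, so the new contribution \<open>a w\<close>
    cancels \<open>v\<close>. For \<open>r < s\<close> the coefficient is 0 and the claim falls back
    on \<open>g\<close>.\<close>
  have key: "sc a w = - v" if uv: "(r, u, v) \<in> g" and a: "a \<in> Z (r - s)" and z: "u + sc a x = 0" for r u v a
  proof (cases "r - s \<ge> 0")
    case True
    have "(r, sc a x, - v) \<in> g" using gdiff[OF g0 uv] minus_unique[OF z] by simp
    then have 1: "(int (nat (r - s)) + s, sc a x, - v) \<in> g" using True by simp
    have aR: "a \<in> Rg (nat (r - s))" using a True by (simp add: Z_def)
    have "a \<in> J (nat (r - s))" unfolding J_def using aR 1 by blast
    then show ?thesis using \<phi>_eq[OF 1] w(2) by simp
  next
    case False
    then show ?thesis using a z uv gz[of r v] by (simp add: Z_def)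
  qed
  have "partial_map_graph A D g'"
    unfolding partial_map_graph_def
  proof (intro conjI allI impI ballI)
    fix r p q assume "(r, p, q) \<in> g'"
    then obtain u v a where *: "(r, u, v) \<in> g" "a \<in> Z (r - s)" "p = u + sc a x" "q = v + sc a w"
      unfolding g'_def by blast
    show "p \<in> A r" unfolding *(3)
      by (intro add_subgroup_add graded_sub_subgroup A gmem(1)[OF *(1)] Z_scale[OF A *(2) x])
    show "q \<in> D r" unfolding *(4)
      by (intro add_subgroup_add graded_sub_subgroup D gmem(2)[OF *(1)] Z_scale[OF D(1) *(2) w(1)])
  next
    fix r show "(r, 0, 0) \<in> g'" by (rule g'I[OF g0 add_subgroup_0[OF Z_sub]]) simp_all
  next
    fix r q assume "(r, 0, q) \<in> g'"
    then obtain u v a where *: "(r, u, v) \<in> g" "a \<in> Z (r - s)" "u + sc a x = 0" "q = v + sc a w"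
      unfolding g'_def by (smt (verit) Pair_inject mem_Collect_eq)
    show "q = 0" using key[OF *(1-3)] *(4) by simp
  next
    fix r p q p' q' assume "(r, p, q) \<in> g'" "(r, p', q') \<in> g'"
    then obtain u v a u' v' a' where *: "(r, u, v) \<in> g" "a \<in> Z (r - s)" "p = u + sc a x" "q = v + sc a w"
      "(r, u', v') \<in> g" "a' \<in> Z (r - s)" "p' = u' + sc a' x" "q' = v' + sc a' w"
      unfolding g'_def by blast
    show "(r, p - p', q - q') \<in> g'"
      by (rule g'I[OF gdiff[OF *(1,5)] add_subgroup_diff[OF Z_sub *(2,6)]])
        (simp_all add: * scale_left_diff_distrib)
  next
    fix n r p q b assume b: "b \<in> Rg n" "(r, p, q) \<in> g'"
    then obtain u v a where *: "(r, u, v) \<in> g" "a \<in> Z (r - s)" "p = u + sc a x" "q = v + sc a w"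
      unfolding g'_def by blast
    show "(int n + r, sc b p, sc b q) \<in> g'"
      by (rule g'I[OF gsc[OF b(1) *(1)], of "b * a"])
        (use Z_mult[OF b(1) *(2)] in \<open>simp_all add: * scale_right_distrib add_diff_eq\<close>)
  qed
  moreover have "g \<subseteq> g'" using g'I add_subgroup_0[OF Z_sub] by fastforce
  moreover have "(s, x, w) \<in> g'" by (rule g'I[OF g0, of 1]) (use Rg_one in \<open>simp_all add: Z_def\<close>)
  ultimately show ?thesis by (rule that)
qed

theorem baer_criterion:
  assumes A: "graded_sub A" and B: "graded_sub B" and BA: "\<And>r. B r \<subseteq> A r"
    and D: "graded_sub D" "baer D" and f: "graded_map B D f"
  obtains h where "graded_map A D h" "\<And>r x. x \<in> B r \<Longrightarrow> h r x = f r x"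
proof -
  define g0 where "g0 = {(r, x, f r x) | r x. x \<in> B r}"
  have g0: "partial_map_graph A D g0"
    unfolding partial_map_graph_def g0_def
    using BA graded_map_mem[OF f] graded_map_zero[OF B f] add_subgroup_0[OF graded_sub_subgroup[OF B]]
      add_subgroup_diff[OF graded_sub_subgroup[OF B]] graded_map_diff[OF B f]
      graded_sub_scale[OF B] graded_map_scale[OF f]
    by auto
  define S where "S = {g. partial_map_graph A D g \<and> g0 \<subseteq> g}"
  have "\<exists>M\<in>S. \<forall>X\<in>S. M \<subseteq> X \<longrightarrow> X = M"
  proof (rule subset_Zorn_nonempty)
    show "S \<noteq> {}" using g0 by (auto simp: S_def)
    fix c assume c: "c \<noteq> {}" "subset.chain S c"
    then have "subset.chain {g. partial_map_graph A D g} c" by (auto simp: subset.chain_def S_def)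
    then have "partial_map_graph A D (\<Union>c)" using c(1) by (rule partial_map_graph_Union)
    moreover have "c \<subseteq> S" using c(2) by (simp add: subset.chain_def)
    then have "g0 \<subseteq> \<Union>c" using c(1) unfolding S_def by fast
    ultimately show "\<Union>c \<in> S" by (simp add: S_def)
  qed
  then obtain g where gS: "g \<in> S" and max: "\<And>X. X \<in> S \<Longrightarrow> g \<subseteq> X \<Longrightarrow> X = g"
    by metis
  then have g: "partial_map_graph A D g" "g0 \<subseteq> g" by (simp_all add: S_def)
  have total: "\<exists>y. (r, x, y) \<in> g" if xA: "x \<in> A r" for r x
  proof -
    obtain g' w where g': "partial_map_graph A D g'" "g \<subseteq> g'" "(r, x, w) \<in> g'"
      using partial_map_graph_extend[OF A D g(1) xA] .
    then have "g' = g" using g by (intro max) (auto simp: S_def)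
    then show ?thesis using g' by blast
  qed
  define h where "h r x = (THE y. (r, x, y) \<in> g)" for r x
  have h_eq: "h r x = y" if "(r, x, y) \<in> g" for r x y
    unfolding h_def using that partial_map_graph_unique[OF g(1)] by blast
  have h: "(r, x, h r x) \<in> g" if "x \<in> A r" for r x using total[OF that] h_eq by auto
  have "graded_map A D h"
    unfolding graded_map_def
  proof (intro conjI allI ballI)
    show "h r x \<in> D r" if "x \<in> A r" for r x
      using h[OF that] g(1) unfolding partial_map_graph_def by blast
    show "h r (x + y) = h r x + h r y" if "x \<in> A r" "y \<in> A r" for r x y
      by (intro h_eq partial_map_graph_add[OF g(1)] h that)
    show "h (int n + r) (sc a x) = sc a (h r x)" if "a \<in> Rg n" "x \<in> A r" for n r a x
      using h[OF that(2)] that(1) g(1) unfolding partial_map_graph_def by (intro h_eq) blast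
  qed
  moreover have "h r x = f r x" if "x \<in> B r" for r x
    using that g(2) by (intro h_eq) (auto simp: g0_def)
  ultimately show ?thesis by (rule that)
qed

end

section \<open>Complexes of injectives and their torsion subcomplexes\<close>

context graded_action
begin

definition cochain_complex :: "(int \<Rightarrow> int \<Rightarrow> 'u set) \<Rightarrow> (int \<Rightarrow> 'u \<Rightarrow> 'u) \<Rightarrow> bool" where
  "cochain_complex C d \<longleftrightarrow> (\<forall>k. graded_sub (C k)) \<and> (\<forall>k. graded_map (C k) (C (k + 1)) (\<lambda>_. d k)) \<and>
     (\<forall>k r. \<forall>x\<in>C k r. d (k + 1) (d k x) = 0)"

definition injective_complex :: "(int \<Rightarrow> int \<Rightarrow> 'u set) \<Rightarrow> (int \<Rightarrow> 'u \<Rightarrow> 'u) \<Rightarrow> bool" where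
  "injective_complex C d \<longleftrightarrow> cochain_complex C d \<and> (\<forall>k. baer (C k)) \<and> (\<exists>b. \<forall>k<b. \<forall>r. C k r = {0})"

definition exact_from :: "(int \<Rightarrow> int \<Rightarrow> 'u set) \<Rightarrow> (int \<Rightarrow> 'u \<Rightarrow> 'u) \<Rightarrow> int \<Rightarrow> int \<Rightarrow> bool" where
  "exact_from C d c k \<longleftrightarrow> (\<forall>r\<ge>c. \<forall>x\<in>C k r. d k x = 0 \<longrightarrow> x \<in> d (k - 1) ` C (k - 1) r)"

text \<open>Testing on products of homogeneous elements of positive degree is enough, since these generate
  the powers of the irrelevant ideal.\<close>

definition is_torsion :: "'u \<Rightarrow> bool" where
  "is_torsion x \<longleftrightarrow> (\<exists>n. \<forall>as. length as = n \<and> set as \<subseteq> (\<Union>m. Rg (Suc m)) \<longrightarrow> sc (prod_list as) x = 0)"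

definition lc_nonzero :: "(int \<Rightarrow> int \<Rightarrow> 'u set) \<Rightarrow> (int \<Rightarrow> 'u \<Rightarrow> 'u) \<Rightarrow> int \<Rightarrow> int \<Rightarrow> bool" where
  "lc_nonzero C d k r \<longleftrightarrow> (\<exists>x\<in>C k r. is_torsion x \<and> d k x = 0 \<and>
     (\<forall>y\<in>C (k - 1) r. is_torsion y \<longrightarrow> d (k - 1) y \<noteq> x))"

text \<open>The kernel of \<open>z\<close> on H^0(C) in internal degree \<open>r\<close>. When
  H^0(C) is M/Q_i M and \<open>z\<close> is the next element, this is the degree \<open>r\<close>
  part of (Q_i M : z)/Q_i M, the module that filter-regularity and \<open>a_quot\<close> speak
  of.\<close>

definition kernel_nonzero :: "(int \<Rightarrow> int \<Rightarrow> 'u set) \<Rightarrow> (int \<Rightarrow> 'u \<Rightarrow> 'u) \<Rightarrow> 'r \<Rightarrow> int \<Rightarrow> bool" where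
  "kernel_nonzero C d z r \<longleftrightarrow> (\<exists>x\<in>C 0 r. d 0 x = 0 \<and> sc z x \<in> d (- 1) ` C (- 1) (1 + r) \<and>
     x \<notin> d (- 1) ` C (- 1) r)"

lemma cochain_complexD:
  assumes "cochain_complex C d"
  shows complex_graded_sub: "graded_sub (C k)"
    and complex_subgroup: "add_subgroup (C k r)"
    and complex_graded_map: "graded_map (C k) (C (k + 1)) (\<lambda>_. d k)"
    and complex_d_d: "x \<in> C k r \<Longrightarrow> d (k + 1) (d k x) = 0"
    and complex_d_mem: "x \<in> C k r \<Longrightarrow> d k x \<in> C (k + 1) r"
    and complex_d_mem': "x \<in> C (k - 1) r \<Longrightarrow> d (k - 1) x \<in> C k r"
    and complex_d_d': "x \<in> C (k - 1) r \<Longrightarrow> d k (d (k - 1) x) = 0"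
    and complex_d_add: "x \<in> C k r \<Longrightarrow> y \<in> C k r \<Longrightarrow> d k (x + y) = d k x + d k y"
    and complex_d_diff: "x \<in> C k r \<Longrightarrow> y \<in> C k r \<Longrightarrow> d k (x - y) = d k x - d k y"
    and complex_d_minus: "x \<in> C k r \<Longrightarrow> d k (- x) = - d k x"
    and complex_d_zero: "d k 0 = 0"
    and complex_scale_mem: "a \<in> Rg n \<Longrightarrow> x \<in> C k r \<Longrightarrow> sc a x \<in> C k (int n + r)"
    and complex_d_scale: "a \<in> Rg n \<Longrightarrow> x \<in> C k r \<Longrightarrow> d k (sc a x) = sc a (d k x)"
proof -
  show sub: "graded_sub (C k)" for k using assms by (simp add: cochain_complex_def)
  show "add_subgroup (C k r)" by (rule graded_sub_subgroup[OF sub])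
  show map: "graded_map (C k) (C (k + 1)) (\<lambda>_. d k)" for k using assms by (simp add: cochain_complex_def)
  show dd: "x \<in> C k r \<Longrightarrow> d (k + 1) (d k x) = 0" for k using assms by (simp add: cochain_complex_def)
  show "x \<in> C k r \<Longrightarrow> d k x \<in> C (k + 1) r" by (rule graded_map_mem[OF map])
  show "x \<in> C (k - 1) r \<Longrightarrow> d (k - 1) x \<in> C k r" using graded_map_mem[OF map, of x "k - 1" r] by simp
  show "x \<in> C (k - 1) r \<Longrightarrow> d k (d (k - 1) x) = 0" using dd[of "k - 1"] by simp
  show "x \<in> C k r \<Longrightarrow> y \<in> C k r \<Longrightarrow> d k (x + y) = d k x + d k y" by (rule graded_map_add[OF map])
  show "x \<in> C k r \<Longrightarrow> y \<in> C k r \<Longrightarrow> d k (x - y) = d k x - d k y" by (rule graded_map_diff[OF sub map])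
  show "x \<in> C k r \<Longrightarrow> d k (- x) = - d k x" by (rule graded_map_minus[OF sub map])
  show "d k 0 = 0" by (rule graded_map_zero[OF sub map])
  show "a \<in> Rg n \<Longrightarrow> x \<in> C k r \<Longrightarrow> sc a x \<in> C k (int n + r)" by (rule graded_sub_scale[OF sub])
  show "a \<in> Rg n \<Longrightarrow> x \<in> C k r \<Longrightarrow> d k (sc a x) = sc a (d k x)" by (rule graded_map_scale[OF map])
qed

lemma boundary_subgroup:
  assumes C: "cochain_complex C d"
  shows "add_subgroup (d k ` C k r)"
  unfolding add_subgroup_def
proof (intro conjI ballI)
  show "0 \<in> d k ` C k r"
    using add_subgroup_0[OF complex_subgroup[OF C]] complex_d_zero[OF C] by (rule rev_image_eqI[OF _ sym])
  fix x y assume "x \<in> d k ` C k r" "y \<in> d k ` C k r"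
  then obtain u v where "u \<in> C k r" "v \<in> C k r" "x = d k u" "y = d k v" by blast
  then show "x - y \<in> d k ` C k r"
    using complex_d_diff[OF C] add_subgroup_diff[OF complex_subgroup[OF C]] by (metis imageI)
qed

lemma boundary_scale:
  assumes C: "cochain_complex C d" and "a \<in> Rg n" "y \<in> d k ` C k r"
  shows "sc a y \<in> d k ` C k (int n + r)"
  using assms complex_scale_mem[OF C] complex_d_scale[OF C] by (auto intro!: image_eqI[OF sym])

lemma truncation_graded_sub:
  assumes "graded_sub F"
  shows "graded_sub (\<lambda>r. if r \<ge> c then F r else {0})"
  using assms by (auto simp: graded_sub_def add_subgroup_def)

text \<open>In degrees \<open>\<ge> c\<close> the part of the complex below degree \<open>0\<close> is a bounded below exact
  complex of injectives, hence split: if \<open>\<tau>\<close> extends a section \<open>\<sigma>\<close> of the previous differential to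
  all of \<open>C k\<close>, then \<open>d x \<mapsto> x - d (\<tau> x)\<close> is a section of the next one.\<close>

lemma boundary_section:
  assumes C: "cochain_complex C d" and inj: "\<And>k. baer (C k)" and b: "\<And>k r. k < b \<Longrightarrow> C k r = {0}"
    and ex: "\<And>i. i < k \<Longrightarrow> exact_from C d c i" and k: "k = b + int m"
  shows "\<exists>\<sigma>. graded_map (\<lambda>r. if r \<ge> c then d (k - 1) ` C (k - 1) r else {0}) (C (k - 1)) \<sigma> \<and>
          (\<forall>r\<ge>c. \<forall>x\<in>C (k - 1) r. d (k - 1) (\<sigma> r (d (k - 1) x)) = d (k - 1) x)"
  using ex k
proof (induction m arbitrary: k)
  case 0
  have z: "C (k - 1) r = {0}" for r by (rule b) (simp add: 0)
  have "graded_map (\<lambda>r. if r \<ge> c then d (k - 1) ` C (k - 1) r else {0}) (C (k - 1)) (\<lambda>_ _. 0)"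
    by (auto simp: graded_map_def z)
  moreover have "\<forall>r\<ge>c. \<forall>x\<in>C (k - 1) r. d (k - 1) 0 = d (k - 1) x" using z by auto
  ultimately show ?case by blast
next
  case (Suc m)
  define l where "l = k - 1"
  let ?A = "\<lambda>r. if r \<ge> c then C l r else {0}"
  let ?B = "\<lambda>r. if r \<ge> c then d (l - 1) ` C (l - 1) r else {0}"
  have "\<And>i. i < l \<Longrightarrow> exact_from C d c i" "l = b + int m" using Suc.prems by (simp_all add: l_def)
  from Suc.IH[OF this] obtain \<sigma> where \<sigma>: "graded_map ?B (C (l - 1)) \<sigma>"
    "\<And>r x. r \<ge> c \<Longrightarrow> x \<in> C (l - 1) r \<Longrightarrow> d (l - 1) (\<sigma> r (d (l - 1) x)) = d (l - 1) x"
    by blast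
  have A: "graded_sub ?A" by (rule truncation_graded_sub[OF complex_graded_sub[OF C]])
  have "graded_sub (\<lambda>r. d (l - 1) ` C (l - 1) r)"
    unfolding graded_sub_def using boundary_subgroup[OF C] boundary_scale[OF C] by blast
  then have B: "graded_sub ?B" by (rule truncation_graded_sub)
  have BA: "?B r \<subseteq> ?A r" for r using complex_d_mem'[OF C, of _ l r] by auto
  obtain \<tau> where \<tau>: "graded_map ?A (C (l - 1)) \<tau>" "\<And>r x. x \<in> ?B r \<Longrightarrow> \<tau> r x = \<sigma> r x"
    using baer_criterion[OF A B BA complex_graded_sub[OF C] inj \<sigma>(1)] by blast
  have exk: "x \<in> d (l - 1) ` C (l - 1) r" if "r \<ge> c" "x \<in> C l r" "d l x = 0" for r x
    using Suc.prems(1)[of l] that by (simp add: exact_from_def l_def)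
  define \<rho> where "\<rho> r x = x - d (l - 1) (\<tau> r x)" for r x
  have \<tau>_mem: "\<tau> r x \<in> C (l - 1) r" if "r \<ge> c" "x \<in> C l r" for r x
    using graded_map_mem[OF \<tau>(1), of x r] that by simp
  have \<rho>_mem: "\<rho> r x \<in> C l r" if "r \<ge> c" "x \<in> C l r" for r x
    unfolding \<rho>_def using \<tau>_mem[OF that] complex_d_mem'[OF C] that
    by (intro add_subgroup_diff complex_subgroup[OF C]) auto
  have \<rho>_add: "\<rho> r (x + y) = \<rho> r x + \<rho> r y" if "r \<ge> c" "x \<in> C l r" "y \<in> C l r" for r x y
    using graded_map_add[OF \<tau>(1), of x r y] that complex_d_add[OF C \<tau>_mem \<tau>_mem] by (simp add: \<rho>_def)
  have \<rho>_scale: "\<rho> (int n + r) (sc a x) = sc a (\<rho> r x)" if "r \<ge> c" "x \<in> C l r" "a \<in> Rg n" for r x a n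
    using graded_map_scale[OF \<tau>(1), of a n x r] that complex_d_scale[OF C _ \<tau>_mem]
    by (simp add: \<rho>_def scale_right_diff_distrib)
  have \<rho>_zero: "\<rho> r x = 0" if x: "r \<ge> c" "x \<in> C l r" "d l x = 0" for r x
  proof -
    obtain u where u: "u \<in> C (l - 1) r" "x = d (l - 1) u" using exk[OF x] by blast
    then have "\<tau> r x = \<sigma> r x" using x by (intro \<tau>(2)) auto
    then show ?thesis using \<sigma>(2)[OF x(1) u(1)] u by (simp add: \<rho>_def)
  qed
  have \<rho>_wd: "\<rho> r x = \<rho> r y" if x: "r \<ge> c" "x \<in> C l r" "y \<in> C l r" "d l x = d l y" for r x y
  proof -
    have xy: "x - y \<in> C l r" by (rule add_subgroup_diff[OF complex_subgroup[OF C] x(2,3)])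
    have "\<rho> r (x - y) = 0" using x complex_d_diff[OF C x(2,3)] xy by (intro \<rho>_zero) auto
    then show ?thesis using \<rho>_add[OF x(1) xy x(3)] by simp
  qed
  define \<sigma>' where "\<sigma>' r y = (if r \<ge> c then \<rho> r (SOME x. x \<in> C l r \<and> d l x = y) else 0)" for r y
  have \<sigma>': "\<sigma>' r (d l x) = \<rho> r x" if x: "r \<ge> c" "x \<in> C l r" for r x
  proof -
    let ?x = "SOME u. u \<in> C l r \<and> d l u = d l x"
    have "?x \<in> C l r \<and> d l ?x = d l x" by (rule someI[of _ x]) (use x in simp)
    then have "\<rho> r ?x = \<rho> r x" using x by (intro \<rho>_wd) auto
    then show ?thesis using x by (simp add: \<sigma>'_def)
  qed
  let ?B' = "\<lambda>r. if r \<ge> c then d l ` C l r else {0}"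
  have "\<sigma>' r 0 = 0" for r
    using \<sigma>'[of r 0] \<rho>_zero[of r 0] complex_d_zero[OF C, of l] add_subgroup_0[OF complex_subgroup[OF C]]
    by (cases "r \<ge> c") (auto simp: \<sigma>'_def)
  note \<sigma>'0 = this
  have "graded_map ?B' (C l) \<sigma>'"
    unfolding graded_map_def
  proof (intro conjI allI ballI)
    show "\<sigma>' r y \<in> C l r" if "y \<in> ?B' r" for r y
      using that \<sigma>' \<rho>_mem \<sigma>'0 add_subgroup_0[OF complex_subgroup[OF C]] by (auto split: if_splits)
    show "\<sigma>' r (x + y) = \<sigma>' r x + \<sigma>' r y" if xy: "x \<in> ?B' r" "y \<in> ?B' r" for r x y
    proof (cases "r \<ge> c")
      case True
      then obtain u v where u: "u \<in> C l r" "x = d l u" and v: "v \<in> C l r" "y = d l v"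
        using xy by auto
      have uv: "u + v \<in> C l r" by (rule add_subgroup_add[OF complex_subgroup[OF C] u(1) v(1)])
      show ?thesis
        using \<sigma>'[OF True uv] complex_d_add[OF C u(1) v(1)] \<rho>_add[OF True u(1) v(1)]
        by (simp add: u v \<sigma>'[OF True u(1)] \<sigma>'[OF True v(1)])
    qed (simp add: \<sigma>'_def)
    show "\<sigma>' (int n + r) (sc a y) = sc a (\<sigma>' r y)" if a: "a \<in> Rg n" and y: "y \<in> ?B' r" for n r a y
    proof (cases "r \<ge> c")
      case True
      then obtain u where u: "u \<in> C l r" "y = d l u" using y by auto
      show ?thesis
        using \<sigma>'[of "int n + r" "sc a u"] complex_scale_mem[OF C a u(1)] complex_d_scale[OF C a u(1)]
          \<rho>_scale[OF True u(1) a] \<sigma>'[OF True u(1)] True u by simp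
    next
      case False
      then show ?thesis using y \<sigma>'0 by simp
    qed
  qed
  moreover have "d l (\<sigma>' r (d l x)) = d l x" if x: "r \<ge> c" "x \<in> C l r" for r x
    using \<sigma>'[OF x] complex_d_diff[OF C x(2) complex_d_mem'[OF C \<tau>_mem[OF x]]]
      complex_d_d'[OF C \<tau>_mem[OF x]] by (simp add: \<rho>_def)
  ultimately show ?case unfolding l_def[symmetric] by blast
qed

text \<open>On the ideal of those \<open>a\<close> of degree at least \<open>n\<close> for which
  \<open>a x\<close> is a boundary, \<open>a \<mapsto> \<sigma> (a x)\<close> is linear, hence
  multiplication by a single \<open>w\<close>; applying the differential gives
  \<open>a x = a (d w)\<close>. The condition on \<open>n\<close> places every such
  \<open>a x\<close> in the degrees where \<open>\<sigma>\<close> is a section.\<close>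

lemma boundary_correction:
  assumes C: "injective_complex C d" and ex: "\<And>k. k < j \<Longrightarrow> exact_from C d c k"
    and x: "x \<in> C j r" and n: "int n + r \<ge> c"
  obtains w where "w \<in> C (j - 1) r"
    "\<And>m a. m \<ge> n \<Longrightarrow> a \<in> Rg m \<Longrightarrow> sc a x \<in> d (j - 1) ` C (j - 1) (int m + r) \<Longrightarrow>
      sc a (x - d (j - 1) w) = 0"
proof -
  have cc: "cochain_complex C d" and inj: "\<And>k. baer (C k)"
    using C by (auto simp: injective_complex_def)
  obtain b0 where b0: "\<And>k r. k < b0 \<Longrightarrow> C k r = {0}" using C unfolding injective_complex_def by blast
  \<comment> \<open>The minimum makes \<open>j - b\<close> a nonnegative number of steps for
    \<open>boundary_section\<close>.\<close>
  define b where "b = min b0 j"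
  have bj: "b + int (nat (j - b)) = j" by (simp add: b_def)
  let ?B = "\<lambda>r. if r \<ge> c then d (j - 1) ` C (j - 1) r else {0}"
  obtain \<sigma> where \<sigma>: "graded_map ?B (C (j - 1)) \<sigma>"
    "\<And>r x. r \<ge> c \<Longrightarrow> x \<in> C (j - 1) r \<Longrightarrow> d (j - 1) (\<sigma> r (d (j - 1) x)) = d (j - 1) x"
  proof -
    have "\<And>k r. k < b \<Longrightarrow> C k r = {0}" using b0 by (simp add: b_def)
    from boundary_section[OF cc inj this ex bj[symmetric]]
    have "\<exists>\<sigma>. graded_map ?B (C (j - 1)) \<sigma> \<and>
        (\<forall>r\<ge>c. \<forall>x\<in>C (j - 1) r. d (j - 1) (\<sigma> r (d (j - 1) x)) = d (j - 1) x)" by blast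
    then show ?thesis using that by blast
  qed
  define J where "J m = {a \<in> Rg m. a = 0 \<or> m \<ge> n \<and> sc a x \<in> d (j - 1) ` C (j - 1) (int m + r)}" for m
  have z: "0 \<in> d (j - 1) ` C (j - 1) s" for s by (rule add_subgroup_0[OF boundary_subgroup[OF cc]])
  have J_B: "sc a x \<in> ?B (int m + r)" if "a \<in> J m" for a m
    using that n z by (auto simp: J_def)
  have "homogeneous_ideal J"
    unfolding homogeneous_ideal_def
  proof (intro conjI allI ballI)
    fix m
    show "J m \<subseteq> Rg m" by (auto simp: J_def)
    show "add_subgroup (J m)"
      unfolding add_subgroup_def
    proof (intro conjI ballI)
      show "0 \<in> J m" using add_subgroup_0[OF Rg_subgroup] by (simp add: J_def)
      fix a a' assume a: "a \<in> J m" "a' \<in> J m"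
      show "a - a' \<in> J m"
      proof (cases "m \<ge> n")
        case True
        then have "sc a x \<in> d (j - 1) ` C (j - 1) (int m + r)" "sc a' x \<in> d (j - 1) ` C (j - 1) (int m + r)"
          using a z by (auto simp: J_def)
        from add_subgroup_diff[OF boundary_subgroup[OF cc] this] show ?thesis
          using a True add_subgroup_diff[OF Rg_subgroup] by (auto simp: J_def scale_left_diff_distrib)
      next
        case False
        then show ?thesis using a by (auto simp: J_def)
      qed
    qed
  next
    fix m m' a a' assume a: "a \<in> Rg m" and a': "a' \<in> J m'"
    have "sc (a * a') x \<in> d (j - 1) ` C (j - 1) (int (m + m') + r)"
      if "sc a' x \<in> d (j - 1) ` C (j - 1) (int m' + r)"
      using boundary_scale[OF cc a that] by (simp add: add.assoc)
    then show "a * a' \<in> J (m + m')" using a a' Rg_mult[OF a] by (auto simp: J_def)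
  qed
  moreover have "ideal_map J (C (j - 1)) r (\<lambda>m a. \<sigma> (int m + r) (sc a x))"
    unfolding ideal_map_def
  proof (intro conjI allI ballI)
    show "\<sigma> (int m + r) (sc a x) \<in> C (j - 1) (int m + r)" if "a \<in> J m" for m a
      by (rule graded_map_mem[OF \<sigma>(1) J_B[OF that]])
    show "\<sigma> (int m + r) (sc (a + a') x) = \<sigma> (int m + r) (sc a x) + \<sigma> (int m + r) (sc a' x)"
      if "a \<in> J m" "a' \<in> J m" for m a a'
      using graded_map_add[OF \<sigma>(1) J_B[OF that(1)] J_B[OF that(2)]] by (simp add: scale_left_distrib)
    show "\<sigma> (int (m + m') + r) (sc (a * a') x) = sc a (\<sigma> (int m' + r) (sc a' x))"
      if "a \<in> Rg m" "a' \<in> J m'" for m m' a a'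
      using graded_map_scale[OF \<sigma>(1) that(1) J_B[OF that(2)]] by (simp add: add.assoc)
  qed
  ultimately obtain w where w: "w \<in> C (j - 1) r"
    "\<And>m a. a \<in> J m \<Longrightarrow> \<sigma> (int m + r) (sc a x) = sc a w"
    using inj unfolding baer_def by meson
  have "sc a (x - d (j - 1) w) = 0"
    if a: "m \<ge> n" "a \<in> Rg m" "sc a x \<in> d (j - 1) ` C (j - 1) (int m + r)" for m a
  proof -
    obtain u where u: "u \<in> C (j - 1) (int m + r)" "sc a x = d (j - 1) u" using a by blast
    have aJ: "a \<in> J m" using a by (simp add: J_def)
    have "sc a (d (j - 1) w) = d (j - 1) (\<sigma> (int m + r) (sc a x))"
      using complex_d_scale[OF cc a(2) w(1)] w(2)[OF aJ] by simp
    also have "\<dots> = sc a x" using \<sigma>(2)[of "int m + r" u] u n a by simp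
    finally show ?thesis by (simp add: scale_right_diff_distrib)
  qed
  with w(1) show ?thesis by (rule that)
qed

section \<open>Torsion elements and torsion representatives of classes\<close>

lemma prod_list_positive:
  assumes "set as \<subseteq> (\<Union>m. Rg (Suc m))"
  obtains m where "m \<ge> length as" "prod_list as \<in> Rg m"
  using assms
proof (induction as arbitrary: thesis)
  case Nil
  then show ?case using Rg_one by (metis le_refl list.size(3) prod_list.Nil)
next
  case (Cons a as)
  obtain m where m: "m \<ge> length as" "prod_list as \<in> Rg m" using Cons.IH Cons.prems(2) by auto
  obtain l where l: "a \<in> Rg (Suc l)" using Cons.prems(2) by auto
  show ?case using Rg_mult[OF l m(2)] m(1) by (intro Cons.prems(1)[of "Suc l + m"]) auto
qed

lemma torsion_from:
  assumes "is_torsion x"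
  obtains n0 where "\<And>n as. n \<ge> n0 \<Longrightarrow> length as = n \<Longrightarrow> set as \<subseteq> (\<Union>m. Rg (Suc m)) \<Longrightarrow> sc (prod_list as) x = 0"
proof -
  from assms obtain n0 where n0: "\<And>as. length as = n0 \<Longrightarrow> set as \<subseteq> (\<Union>m. Rg (Suc m)) \<Longrightarrow> sc (prod_list as) x = 0"
    unfolding is_torsion_def by blast
  have "sc (prod_list as) x = 0" if "n \<ge> n0" "length as = n" "set as \<subseteq> (\<Union>m. Rg (Suc m))" for n as
  proof -
    have 1: "sc (prod_list (take n0 as)) x = 0" using that set_take_subset[of n0 as] by (intro n0) auto
    have "prod_list as = prod_list (drop n0 as) * prod_list (take n0 as)"
      by (metis append_take_drop_id mult.commute prod_list.append)
    then have "sc (prod_list as) x = sc (prod_list (drop n0 as)) (sc (prod_list (take n0 as)) x)" by simp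
    then show ?thesis using 1 by simp
  qed
  then show ?thesis by (rule that)
qed

lemma torsion_diff:
  assumes "is_torsion x" "is_torsion y"
  shows "is_torsion (x - y)"
proof -
  obtain n where n: "\<And>l as. l \<ge> n \<Longrightarrow> length as = l \<Longrightarrow> set as \<subseteq> (\<Union>m. Rg (Suc m)) \<Longrightarrow> sc (prod_list as) x = 0"
    using torsion_from[OF assms(1)] by blast
  obtain n' where n': "\<And>l as. l \<ge> n' \<Longrightarrow> length as = l \<Longrightarrow> set as \<subseteq> (\<Union>m. Rg (Suc m)) \<Longrightarrow> sc (prod_list as) y = 0"
    using torsion_from[OF assms(2)] by blast
  have "sc (prod_list as) (x - y) = 0" if "length as = max n n'" "set as \<subseteq> (\<Union>m. Rg (Suc m))" for as
    using n[OF _ that] n'[OF _ that] by (simp add: scale_right_diff_distrib)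
  then show ?thesis unfolding is_torsion_def by blast
qed

lemma torsion_zero: "is_torsion 0"
  by (simp add: is_torsion_def)

lemma torsion_uminus: "is_torsion x \<Longrightarrow> is_torsion (- x)"
  using torsion_diff[OF torsion_zero] by fastforce

lemma torsion_add: "is_torsion x \<Longrightarrow> is_torsion y \<Longrightarrow> is_torsion (x + y)"
  using torsion_diff[of x "- y"] torsion_uminus[of y] by simp

lemma torsion_scale: "is_torsion x \<Longrightarrow> is_torsion (sc a x)"
  unfolding is_torsion_def by (metis scale_left_commute scale_zero_right)

lemma torsion_killed_by_power:
  assumes "is_torsion x" "z \<in> Rg 1"
  shows "\<exists>n. sc (z ^ n) x = 0"
proof -
  from assms(1) obtain n where n: "\<And>as. length as = n \<Longrightarrow> set as \<subseteq> (\<Union>m. Rg (Suc m)) \<Longrightarrow> sc (prod_list as) x = 0"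
    unfolding is_torsion_def by blast
  have "sc (prod_list (replicate n z)) x = 0" using assms(2) by (intro n) (auto intro!: exI[of _ 0])
  then show ?thesis by (auto simp: prod_list_replicate)
qed

text \<open>If long products of forms of positive degree carry \<open>x\<close> into the boundaries,
  one \<open>w\<close> corrects all these multiples to 0 at once, which is torsion of
  \<open>x - d w\<close>. By \<open>prod_list_positive\<close> long products have large degree, so
  \<open>boundary_correction\<close> covers them.\<close>

lemma torsion_correction:
  assumes C: "injective_complex C d" and ex: "\<And>k. k < j \<Longrightarrow> exact_from C d c k" and x: "x \<in> C j r"
    and n: "\<And>as m. length as \<ge> n \<Longrightarrow> set as \<subseteq> (\<Union>m. Rg (Suc m)) \<Longrightarrow> m \<ge> n \<Longrightarrow> prod_list as \<in> Rg m \<Longrightarrow>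
      sc (prod_list as) x \<in> d (j - 1) ` C (j - 1) (int m + r)"
  obtains w where "w \<in> C (j - 1) r" "is_torsion (x - d (j - 1) w)"
proof -
  \<comment> \<open>Besides \<open>n\<close>, the length must exceed \<open>c - r\<close>: an
    \<open>n'\<close>-fold product has degree at least \<open>n'\<close> and so moves
    \<open>x\<close> to internal degree at least \<open>c\<close>.\<close>
  define n' where "n' = max n (nat (c - r))"
  have n': "int n' + r \<ge> c" "n' \<ge> n" by (auto simp: n'_def)
  obtain w where w: "w \<in> C (j - 1) r"
    "\<And>m a. m \<ge> n' \<Longrightarrow> a \<in> Rg m \<Longrightarrow> sc a x \<in> d (j - 1) ` C (j - 1) (int m + r) \<Longrightarrow>
      sc a (x - d (j - 1) w) = 0"
    using boundary_correction[OF C ex x n'(1)] by blast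
  have "sc (prod_list as) (x - d (j - 1) w) = 0" if as: "length as = n'" "set as \<subseteq> (\<Union>m. Rg (Suc m))" for as
  proof -
    obtain m where "m \<ge> length as" "prod_list as \<in> Rg m" using prod_list_positive[OF as(2)] .
    then show ?thesis using as n' by (intro w(2)[of m] n) auto
  qed
  then have "is_torsion (x - d (j - 1) w)" unfolding is_torsion_def by blast
  with w(1) show ?thesis by (rule that)
qed

text \<open>Gives injectivity of the map from torsion cohomology to cohomology in degree 0. Long
  products kill \<open>d y\<close>, so they turn \<open>y\<close> into cocycles of degree -1, which
  are boundaries in large internal degrees; the resulting correction of \<open>y\<close> by a
  boundary leaves \<open>d y\<close> unchanged.\<close>

lemma torsion_boundary_lift:
  assumes C: "injective_complex C d" and ex: "\<And>k. k < 0 \<Longrightarrow> exact_from C d c k"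
    and y: "y \<in> C (- 1) r" "is_torsion (d (- 1) y)"
  obtains y' where "y' \<in> C (- 1) r" "is_torsion y'" "d (- 1) y' = d (- 1) y"
proof -
  have cc: "cochain_complex C d" using C by (simp add: injective_complex_def)
  obtain n0 where n0: "\<And>n as. n \<ge> n0 \<Longrightarrow> length as = n \<Longrightarrow> set as \<subseteq> (\<Union>m. Rg (Suc m)) \<Longrightarrow>
      sc (prod_list as) (d (- 1) y) = 0"
    using torsion_from[OF y(2)] by blast
  define n where "n = max n0 (nat (c - r))"
  have B: "sc (prod_list as) y \<in> d (- 1 - 1) ` C (- 1 - 1) (int m + r)"
    if as: "length as \<ge> n" "set as \<subseteq> (\<Union>m. Rg (Suc m))" "m \<ge> n" "prod_list as \<in> Rg m" for as m
  proof -
    have "d (- 1) (sc (prod_list as) y) = 0"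
      using complex_d_scale[OF cc as(4) y(1)] n0[OF _ refl as(2)] as(1) by (simp add: n_def)
    moreover have "int m + r \<ge> c" using as(3) by (simp add: n_def nat_le_iff)
    ultimately show ?thesis
      using ex[of "- 1"] complex_scale_mem[OF cc as(4) y(1)] unfolding exact_from_def by simp
  qed
  have "\<And>k. k < - 1 \<Longrightarrow> exact_from C d c k" using ex by simp
  from torsion_correction[OF C this y(1) B]
  obtain w where w: "w \<in> C (- 1 - 1) r" "is_torsion (y - d (- 1 - 1) w)" by blast
  show ?thesis
  proof (rule that)
    show "y - d (- 1 - 1) w \<in> C (- 1) r"
      by (rule add_subgroup_diff[OF complex_subgroup[OF cc] y(1) complex_d_mem'[OF cc w(1)]])
    show "d (- 1) (y - d (- 1 - 1) w) = d (- 1) y"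
      using complex_d_diff[OF cc y(1) complex_d_mem'[OF cc w(1)]] complex_d_d'[OF cc w(1)] by simp
  qed (rule w(2))
qed

text \<open>Multiples of a class killed by \<open>z\<close> are again killed by \<open>z\<close>,
  and no such nonzero class exists in degrees \<open>\<ge> c'\<close>. So forms of large degree
  carry \<open>x\<close> into the boundaries and \<open>torsion_correction\<close> applies.\<close>

lemma kernel_torsion_representative:
  assumes C: "injective_complex C d" and ex: "\<And>k. k < 0 \<Longrightarrow> exact_from C d c k"
    and z: "z \<in> Rg 1" and fr: "\<And>s. s \<ge> c' \<Longrightarrow> \<not> kernel_nonzero C d z s"
    and x: "x \<in> C 0 r" "d 0 x = 0" "sc z x \<in> d (- 1) ` C (- 1) (1 + r)"
  obtains w where "w \<in> C (- 1) r" "is_torsion (x - d (- 1) w)"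
proof -
  have cc: "cochain_complex C d" using C by (simp add: injective_complex_def)
  have B: "sc a x \<in> d (0 - 1) ` C (0 - 1) (int m + r)" if m: "m \<ge> nat (c' - r)" and a: "a \<in> Rg m" for a m
  proof (rule ccontr)
    assume neg: "\<not> ?thesis"
    have "sc a (sc z x) \<in> d (- 1) ` C (- 1) (int m + (1 + r))" by (rule boundary_scale[OF cc a x(3)])
    moreover have "sc a (sc z x) = sc z (sc a x)" by (rule scale_left_commute)
    moreover have "int m + (1 + r) = 1 + (int m + r)" by simp
    ultimately have "sc z (sc a x) \<in> d (- 1) ` C (- 1) (1 + (int m + r))" by simp
    moreover have "d 0 (sc a x) = 0" using complex_d_scale[OF cc a x(1)] x(2) by simp
    ultimately have "kernel_nonzero C d z (int m + r)"
      unfolding kernel_nonzero_def using neg complex_scale_mem[OF cc a x(1)] by auto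
    then show False using fr[of "int m + r"] m by simp
  qed
  obtain w where "w \<in> C (0 - 1) r" "is_torsion (x - d (0 - 1) w)"
    using torsion_correction[OF C ex x(1) B] by blast
  then show ?thesis using that by simp
qed

lemma power_mem: "z \<in> Rg 1 \<Longrightarrow> z ^ k \<in> Rg k"
proof (induction k)
  case (Suc k)
  then show ?case using Rg_mult[of z 1 "z ^ k" k] by simp
qed (simp add: Rg_one)

lemma kernel_nonzero_imp_lc_nonzero:
  assumes C: "injective_complex C d" and ex: "\<And>k. k < 0 \<Longrightarrow> exact_from C d c k"
    and z: "z \<in> Rg 1" and fr: "\<And>s. s \<ge> c' \<Longrightarrow> \<not> kernel_nonzero C d z s"
    and nz: "kernel_nonzero C d z r"
  shows "lc_nonzero C d 0 r"
proof -
  have cc: "cochain_complex C d" using C by (simp add: injective_complex_def)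
  from nz obtain x where x: "x \<in> C 0 r" "d 0 x = 0" "sc z x \<in> d (- 1) ` C (- 1) (1 + r)"
    "x \<notin> d (- 1) ` C (- 1) r" unfolding kernel_nonzero_def by blast
  obtain w where w: "w \<in> C (- 1) r" "is_torsion (x - d (- 1) w)"
    using kernel_torsion_representative[OF C ex z fr x(1-3)] by blast
  have dw: "d (- 1) w \<in> C 0 r" "d 0 (d (- 1) w) = 0"
    using complex_d_mem'[OF cc, of w 0] complex_d_d'[OF cc, of w 0] w(1) by auto
  have "d (- 1) y \<noteq> x - d (- 1) w" if "y \<in> C (- 1) r" for y
  proof
    assume "d (- 1) y = x - d (- 1) w"
    then have "x = d (- 1) (y + w)" using complex_d_add[OF cc that w(1)] by simp
    then show False using x(4) add_subgroup_add[OF complex_subgroup[OF cc] that w(1)] by blast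
  qed
  then show ?thesis
    unfolding lc_nonzero_def
    using w(2) complex_d_diff[OF cc x(1) dw(1)] dw x(2) add_subgroup_diff[OF complex_subgroup[OF cc] x(1) dw(1)]
    by (intro bexI[of _ "x - d (- 1) w"]) auto
qed

text \<open>A power of \<open>z\<close> kills a torsion element, so its multiples enter the
  submodule at some first exponent; the multiple just before is a nonzero class killed by
  \<open>z\<close>. The set \<open>B\<close> depends on the exponent since each factor
  \<open>z\<close> raises the internal degree by one.\<close>

lemma last_power_outside:
  fixes B :: "nat \<Rightarrow> 'u set"
  assumes "is_torsion x" "z \<in> Rg 1" "x \<notin> B 0" "\<And>n. 0 \<in> B n"
  obtains k where "sc (z ^ k) x \<notin> B k" "sc (z ^ Suc k) x \<in> B (Suc k)"
proof -
  obtain n where n: "sc (z ^ n) x = 0" using torsion_killed_by_power[OF assms(1,2)] by blast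
  then have "\<exists>n. sc (z ^ n) x \<in> B n" using assms(4) by metis
  then obtain m where m: "sc (z ^ m) x \<in> B m" "\<And>k. k < m \<Longrightarrow> sc (z ^ k) x \<notin> B k"
    using exists_least_iff[of "\<lambda>n. sc (z ^ n) x \<in> B n"] by blast
  have "m \<noteq> 0" using m(1) assms(3) by (metis power_0 scale_one)
  then obtain k where "m = Suc k" using not0_implies_Suc by blast
  then show ?thesis using m that by blast
qed

lemma lc_nonzero_imp_kernel_nonzero:
  assumes C: "injective_complex C d" and ex: "\<And>k. k < 0 \<Longrightarrow> exact_from C d c k"
    and z: "z \<in> Rg 1" and nz: "lc_nonzero C d 0 r"
  obtains k :: nat where "kernel_nonzero C d z (r + int k)"
proof -
  have cc: "cochain_complex C d" using C by (simp add: injective_complex_def)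
  from nz obtain x where x: "x \<in> C 0 r" "is_torsion x" "d 0 x = 0"
    "\<And>y. y \<in> C (- 1) r \<Longrightarrow> is_torsion y \<Longrightarrow> d (- 1) y \<noteq> x" unfolding lc_nonzero_def by auto
  let ?B = "\<lambda>k::nat. d (- 1) ` C (- 1) (r + int k)"
  \<comment> \<open>So far \<open>x\<close> is only known not to be the boundary of a torsion
    element; by \<open>torsion_boundary_lift\<close> it is no boundary at all.\<close>
  have "x \<notin> ?B 0"
  proof
    assume "x \<in> ?B 0"
    then obtain y where y: "y \<in> C (- 1) r" "x = d (- 1) y" by auto
    obtain y' where "y' \<in> C (- 1) r" "is_torsion y'" "d (- 1) y' = d (- 1) y"
      using torsion_boundary_lift[OF C ex y(1)] x(2) y(2) by blast
    then show False using x(4) y(2) by metis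
  qed
  moreover have "0 \<in> ?B n" for n by (rule add_subgroup_0[OF boundary_subgroup[OF cc]])
  ultimately obtain k where k: "sc (z ^ k) x \<notin> ?B k" "sc (z ^ Suc k) x \<in> ?B (Suc k)"
    using last_power_outside[OF x(2) z, of ?B] by blast
  have "sc (z ^ k) x \<in> C 0 (r + int k)"
    using complex_scale_mem[OF cc power_mem[OF z] x(1), of k] by (simp add: add.commute)
  moreover have "d 0 (sc (z ^ k) x) = 0" using complex_d_scale[OF cc power_mem[OF z] x(1)] x(3) by simp
  moreover have "sc z (sc (z ^ k) x) \<in> d (- 1) ` C (- 1) (1 + (r + int k))"
    using k(2) by (simp add: add.commute add.left_commute)
  ultimately have "kernel_nonzero C d z (r + int k)"
    unfolding kernel_nonzero_def using k(1) by blast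
  then show ?thesis by (rule that)
qed

end

section \<open>Iterated mapping cones\<close>

text \<open>A pairing of the ambient module with itself lets all iterated cones live in one type.\<close>

locale paired_action = graded_action sc Rg
  for sc :: "'r::comm_ring_1 \<Rightarrow> 'u::ab_group_add \<Rightarrow> 'u" and Rg :: "nat \<Rightarrow> 'r set" +
  fixes pr1 pr2 :: "'u \<Rightarrow> 'u" and pair :: "'u \<Rightarrow> 'u \<Rightarrow> 'u"
  assumes pr1_pair [simp]: "pr1 (pair x y) = x" and pr2_pair [simp]: "pr2 (pair x y) = y"
    and pair_pr [simp]: "pair (pr1 u) (pr2 u) = u"
    and pr1_add: "pr1 (u + v) = pr1 u + pr1 v" and pr2_add: "pr2 (u + v) = pr2 u + pr2 v"
    and pr1_scale: "pr1 (sc a u) = sc a (pr1 u)" and pr2_scale: "pr2 (sc a u) = sc a (pr2 u)"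
begin

lemma pair_eqI: "pr1 u = pr1 v \<Longrightarrow> pr2 u = pr2 v \<Longrightarrow> u = v"
  by (metis pair_pr)

lemma pr1_zero [simp]: "pr1 0 = 0" and pr2_zero [simp]: "pr2 0 = 0"
  using pr1_scale[of 0 0] pr2_scale[of 0 0] by simp_all

lemma pr1_minus: "pr1 (- u) = - pr1 u" and pr2_minus: "pr2 (- u) = - pr2 u"
  using pr1_add[of u "- u"] pr2_add[of u "- u"] by (simp_all add: minus_unique)

lemma pr1_diff: "pr1 (u - v) = pr1 u - pr1 v" and pr2_diff: "pr2 (u - v) = pr2 u - pr2 v"
  using pr1_add[of u "- v"] pr2_add[of u "- v"] by (simp_all add: pr1_minus pr2_minus)

lemmas pr_linear = pr1_add pr2_add pr1_scale pr2_scale pr1_minus pr2_minus pr1_diff pr2_diff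

text \<open>The cone of \<open>z\<close>, viewed as a map of degree 0 from the twist C(-1) to C; the
  degree \<open>r - 1\<close> in the first coordinate is this twist.\<close>

definition cone :: "(int \<Rightarrow> int \<Rightarrow> 'u set) \<Rightarrow> int \<Rightarrow> int \<Rightarrow> 'u set" where
  "cone C k r = {u. pr1 u \<in> C (k + 1) (r - 1) \<and> pr2 u \<in> C k r}"

definition cone_diff :: "'r \<Rightarrow> (int \<Rightarrow> 'u \<Rightarrow> 'u) \<Rightarrow> int \<Rightarrow> 'u \<Rightarrow> 'u" where
  "cone_diff z d k u = pair (- d (k + 1) (pr1 u)) (sc z (pr1 u) + d k (pr2 u))"

lemma cone_pr:
  assumes "u \<in> cone C k r"
  shows "pr1 u \<in> C (k + 1) (r - 1)" "pr2 u \<in> C k r"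
  using assms by (simp_all add: cone_def)

lemma cone_pairI: "x \<in> C (k + 1) (r - 1) \<Longrightarrow> y \<in> C k r \<Longrightarrow> pair x y \<in> cone C k r"
  by (simp add: cone_def)

lemma complex_scale1_mem:
  assumes "cochain_complex C d" "z \<in> Rg 1" "x \<in> C k (r - 1)"
  shows "sc z x \<in> C k r"
  using complex_scale_mem[OF assms] by simp

lemma cone_complex:
  assumes C: "cochain_complex C d" and z: "z \<in> Rg 1"
  shows "cochain_complex (cone C) (cone_diff z d)"
  unfolding cochain_complex_def
proof (intro conjI allI ballI)
  show "graded_sub (cone C k)" for k
    unfolding graded_sub_def
  proof (intro conjI allI ballI)
    show "add_subgroup (cone C k r)" for r
      using add_subgroup_0[OF complex_subgroup[OF C]] add_subgroup_diff[OF complex_subgroup[OF C]]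
      by (auto simp: add_subgroup_def cone_def pr_linear)
    show "sc a x \<in> cone C k (int n + r)" if "a \<in> Rg n" "x \<in> cone C k r" for n r a x
      using complex_scale_mem[OF C that(1) cone_pr(1)[OF that(2)]] complex_scale_mem[OF C that(1) cone_pr(2)[OF that(2)]]
      by (simp add: cone_def pr_linear add_diff_eq)
  qed
  show "graded_map (cone C k) (cone C (k + 1)) (\<lambda>_. cone_diff z d k)" for k
    unfolding graded_map_def
  proof (intro conjI allI ballI)
    fix r x assume x: "x \<in> cone C k r"
    show "cone_diff z d k x \<in> cone C (k + 1) r"
      unfolding cone_diff_def
      by (intro cone_pairI add_subgroup_uminus add_subgroup_add complex_subgroup[OF C]
          complex_d_mem[OF C] cone_pr[OF x] complex_scale1_mem[OF C z])
    fix y assume y: "y \<in> cone C k r"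
    show "cone_diff z d k (x + y) = cone_diff z d k x + cone_diff z d k y"
      using complex_d_add[OF C cone_pr(1)[OF x] cone_pr(1)[OF y]] complex_d_add[OF C cone_pr(2)[OF x] cone_pr(2)[OF y]]
      by - (rule pair_eqI, simp_all add: cone_diff_def pr_linear scale_right_distrib)
  next
    fix n r a x assume a: "a \<in> Rg n" and x: "x \<in> cone C k r"
    show "cone_diff z d k (sc a x) = sc a (cone_diff z d k x)"
      using complex_d_scale[OF C a cone_pr(1)[OF x]] complex_d_scale[OF C a cone_pr(2)[OF x]]
      by - (rule pair_eqI, simp_all add: cone_diff_def pr_linear scale_right_distrib mult.commute)
  qed
  fix k r x assume x: "x \<in> cone C k r"
  let ?p = "pr1 x" and ?q = "pr2 x"
  note p = cone_pr(1)[OF x] and q = cone_pr(2)[OF x]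
  have "d (k + 1) (sc z ?p + d k ?q) = sc z (d (k + 1) ?p) + d (k + 1) (d k ?q)"
    using complex_d_add[OF C complex_scale1_mem[OF C z p] complex_d_mem[OF C q]] complex_d_scale[OF C z p] by simp
  then show "cone_diff z d (k + 1) (cone_diff z d k x) = 0"
    using complex_d_d[OF C p] complex_d_d[OF C q] complex_d_minus[OF C complex_d_mem[OF C p]]
    by - (rule pair_eqI, simp_all add: cone_diff_def)
qed

text \<open>A map from an ideal into the cone is a pair of maps with shifts \<open>s - 1\<close> and
  \<open>s\<close>, and the two elements given by Baer's criterion pair up. The lower bound drops by
  one because of the term \<open>C (k + 1)\<close>.\<close>

lemma cone_injective:
  assumes C: "injective_complex C d" and z: "z \<in> Rg 1"
  shows "injective_complex (cone C) (cone_diff z d)"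
  unfolding injective_complex_def
proof (intro conjI allI)
  have cc: "cochain_complex C d" using C by (simp add: injective_complex_def)
  show "cochain_complex (cone C) (cone_diff z d)" by (rule cone_complex[OF cc z])
  show "baer (cone C k)" for k
    unfolding baer_def
  proof (intro allI impI)
    fix J s \<phi> assume J: "homogeneous_ideal J \<and> ideal_map J (cone C k) s \<phi>"
    have "ideal_map J (C (k + 1)) (s - 1) (\<lambda>n a. pr1 (\<phi> n a))" "ideal_map J (C k) s (\<lambda>n a. pr2 (\<phi> n a))"
      using J by (auto simp: ideal_map_def pr_linear cone_def add_diff_eq)
    moreover have "baer (C (k + 1))" "baer (C k)" using C by (auto simp: injective_complex_def)
    ultimately obtain w1 w2 where w: "w1 \<in> C (k + 1) (s - 1)" "\<And>n a. a \<in> J n \<Longrightarrow> pr1 (\<phi> n a) = sc a w1"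
      "w2 \<in> C k s" "\<And>n a. a \<in> J n \<Longrightarrow> pr2 (\<phi> n a) = sc a w2"
      using J unfolding baer_def by meson
    have "\<phi> n a = sc a (pair w1 w2)" if "a \<in> J n" for n a
      by - (rule pair_eqI, simp_all add: pr_linear w that)
    then show "\<exists>w\<in>cone C k s. \<forall>n. \<forall>a\<in>J n. \<phi> n a = sc a w"
      using cone_pairI[of w1 C k s w2, OF w(1,3)] by blast
  qed
  obtain b where b: "\<And>k r. k < b \<Longrightarrow> C k r = {0}" using C unfolding injective_complex_def by blast
  have "cone C k r = {0}" if "k < b - 1" for k r
  proof -
    have "u = 0" if "pr1 u = 0" "pr2 u = 0" for u using that by (intro pair_eqI[of u 0]) simp_all
    then show ?thesis using that by (auto simp: cone_def b)
  qed
  then show "\<exists>b. \<forall>k<b. \<forall>r. cone C k r = {0}" by blast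
qed

lemma torsion_pr1: "is_torsion u \<Longrightarrow> is_torsion (pr1 u)"
  unfolding is_torsion_def by (metis pr1_scale pr1_zero)

lemma torsion_pr2: "is_torsion u \<Longrightarrow> is_torsion (pr2 u)"
  unfolding is_torsion_def by (metis pr2_scale pr2_zero)

lemma torsion_pair:
  assumes "is_torsion x" "is_torsion y"
  shows "is_torsion (pair x y)"
proof -
  have 0: "pair 0 0 = 0" by (rule pair_eqI) simp_all
  have "sc a (pair x 0) = pair (sc a x) 0" for a by - (rule pair_eqI, simp_all add: pr_linear)
  then have "is_torsion (pair x 0)" using assms(1) 0 unfolding is_torsion_def by metis
  moreover have "sc a (pair 0 y) = pair 0 (sc a y)" for a by - (rule pair_eqI, simp_all add: pr_linear)
  then have "is_torsion (pair 0 y)" using assms(2) 0 unfolding is_torsion_def by metis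
  moreover have "pair x y = pair x 0 + pair 0 y" by - (rule pair_eqI, simp_all add: pr_linear)
  ultimately show ?thesis using torsion_add by metis
qed

lemma cone_cocycle:
  assumes C: "cochain_complex C d" and u: "u \<in> cone C k r" "cone_diff z d k u = 0"
  shows "d (k + 1) (pr1 u) = 0" "sc z (pr1 u) + d k (pr2 u) = 0"
proof -
  have "- d (k + 1) (pr1 u) = pr1 0" "sc z (pr1 u) + d k (pr2 u) = pr2 0"
    unfolding u(2)[symmetric] by (simp_all add: cone_diff_def)
  then show "d (k + 1) (pr1 u) = 0" "sc z (pr1 u) + d k (pr2 u) = 0" by simp_all
qed

text \<open>Subtracting the boundary of \<open>pair (- u') 0\<close> from \<open>u\<close> leaves
  first coordinate 0 and second coordinate \<open>pr2 u + sc z u'\<close>: the step from the cone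
  back to \<open>C\<close> in the long exact sequence.\<close>

lemma cone_cocycle_shift:
  assumes C: "cochain_complex C d" and z: "z \<in> Rg 1" and u: "u \<in> cone C k r" "cone_diff z d k u = 0"
    and u': "u' \<in> C k (r - 1)" "pr1 u = d k u'"
  shows "pr2 u + sc z u' \<in> C k r" "d k (pr2 u + sc z u') = 0"
proof -
  note p = complex_scale1_mem[OF C z u'(1)] and q = cone_pr(2)[OF u(1)]
  show "pr2 u + sc z u' \<in> C k r" by (rule add_subgroup_add[OF complex_subgroup[OF C] q p])
  show "d k (pr2 u + sc z u') = 0"
    using complex_d_add[OF C q p] complex_d_scale[OF C z u'(1)] cone_cocycle(2)[OF C u] u'(2)
    by (simp add: add.commute)
qed

lemma cone_boundary:
  assumes C: "cochain_complex C d"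
    and u': "u' \<in> C k (r - 1)" "pr1 u = d k u'"
    and w: "w \<in> C (k - 1) r" "pr2 u + sc z u' = d (k - 1) w"
  shows "pair (- u') w \<in> cone C (k - 1) r" "cone_diff z d (k - 1) (pair (- u') w) = u"
proof -
  show "pair (- u') w \<in> cone C (k - 1) r"
    using u'(1) w(1) add_subgroup_uminus[OF complex_subgroup[OF C] u'(1)] by (intro cone_pairI) simp_all
  show "cone_diff z d (k - 1) (pair (- u') w) = u"
    using complex_d_minus[OF C u'(1)] u'(2) w(2)[symmetric]
    by - (rule pair_eqI, simp_all add: cone_diff_def scale_minus_right)
qed

text \<open>In H^k(C)_r -> H^k(cone)_r -> H^(k+1)(C)_(r-1) the middle term vanishes if the left one
  does and \<open>z\<close> is injective on the right one. Assumption \<open>1\<close> is this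
  injectivity, with \<open>r\<close> counted in the cone.\<close>

lemma cone_exact:
  assumes C: "cochain_complex C d" and z: "z \<in> Rg 1" and ex: "exact_from C d c k"
    and 1: "\<And>r x. r \<ge> c' \<Longrightarrow> x \<in> C (k + 1) (r - 1) \<Longrightarrow> d (k + 1) x = 0 \<Longrightarrow> sc z x \<in> d k ` C k r \<Longrightarrow> x \<in> d k ` C k (r - 1)"
  shows "exact_from (cone C) (cone_diff z d) (max c c') k"
  unfolding exact_from_def
proof (intro allI impI ballI)
  fix r u assume r: "r \<ge> max c c'" and u: "u \<in> cone C k r" "cone_diff z d k u = 0"
  have "sc z (pr1 u) = d k (- pr2 u)"
    using cone_cocycle(2)[OF C u] complex_d_minus[OF C cone_pr(2)[OF u(1)]] by (metis eq_neg_iff_add_eq_0)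
  then have "sc z (pr1 u) \<in> d k ` C k r"
    using add_subgroup_uminus[OF complex_subgroup[OF C] cone_pr(2)[OF u(1)]] by blast
  then obtain u' where u': "u' \<in> C k (r - 1)" "pr1 u = d k u'"
    using 1[of r "pr1 u"] cone_pr(1)[OF u(1)] cone_cocycle(1)[OF C u] r by auto
  obtain w where "w \<in> C (k - 1) r" "pr2 u + sc z u' = d (k - 1) w"
    using ex r cone_cocycle_shift[OF C z u u'] unfolding exact_from_def by fastforce
  from cone_boundary[OF C u' this] show "u \<in> cone_diff z d (k - 1) ` cone C (k - 1) r"
    by (metis imageI)
qed

text \<open>The same diagram chase within the torsion subcomplexes: every element chosen on the way
  is torsion, since torsion passes to coordinates, sums and multiples.\<close>

lemma lc_nonzero_cone:
  assumes C: "cochain_complex C d" and z: "z \<in> Rg 1" and nz: "lc_nonzero (cone C) (cone_diff z d) k r"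
  shows "lc_nonzero C d k r \<or> lc_nonzero C d (k + 1) (r - 1)"
proof (rule ccontr)
  assume neg: "\<not> ?thesis"
  from nz obtain u where u: "u \<in> cone C k r" "cone_diff z d k u = 0" and tor: "is_torsion (pr1 u)" "is_torsion (pr2 u)"
    and nb: "\<And>y. y \<in> cone C (k - 1) r \<Longrightarrow> is_torsion y \<Longrightarrow> cone_diff z d (k - 1) y \<noteq> u"
    unfolding lc_nonzero_def using torsion_pr1 torsion_pr2 by blast
  obtain u' where u': "u' \<in> C k (r - 1)" "is_torsion u'" "pr1 u = d k u'"
    using neg cone_pr(1)[OF u(1)] cone_cocycle(1)[OF C u] tor unfolding lc_nonzero_def by fastforce
  have "is_torsion (pr2 u + sc z u')" using tor u' by (intro torsion_add torsion_scale)
  then obtain w where w: "w \<in> C (k - 1) r" "is_torsion w" "pr2 u + sc z u' = d (k - 1) w"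
    using neg cone_cocycle_shift[OF C z u u'(1,3)] unfolding lc_nonzero_def by metis
  have "is_torsion (pair (- u') w)" using u' w by (intro torsion_pair torsion_uminus)
  then show False using nb cone_boundary[OF C u'(1,3) w(1,3)] by blast
qed

text \<open>Multiplying a torsion class by \<open>z\<close> until just before it dies gives a class
  in the kernel of \<open>z\<close>, which lifts to the cone by the long exact sequence.
  \<open>m\<close> counts the factors, and the extra 1 is the twist of the first coordinate.\<close>

lemma lc_nonzero_imp_cone:
  assumes C: "cochain_complex C d" and z: "z \<in> Rg 1" and nz: "lc_nonzero C d (k + 1) r"
  obtains m :: nat where "lc_nonzero (cone C) (cone_diff z d) k (r + int m + 1)"
proof -
  from nz obtain x where x: "x \<in> C (k + 1) r" "is_torsion x" "d (k + 1) x = 0"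
    "\<And>y. y \<in> C k r \<Longrightarrow> is_torsion y \<Longrightarrow> d k y \<noteq> x" unfolding lc_nonzero_def by auto
  let ?B = "\<lambda>m::nat. d k ` {y \<in> C k (r + int m). is_torsion y}"
  have "x \<notin> ?B 0" using x(4) by auto
  moreover have "0 \<in> ?B n" for n
    using add_subgroup_0[OF complex_subgroup[OF C]] complex_d_zero[OF C] torsion_zero
    by (intro image_eqI[of _ _ 0]) auto
  ultimately obtain m where m: "sc (z ^ m) x \<notin> ?B m" "sc (z ^ Suc m) x \<in> ?B (Suc m)"
    using last_power_outside[OF x(2) z, of ?B] by blast
  let ?x = "sc (z ^ m) x" and ?r = "r + int m + 1"
  obtain w where w: "w \<in> C k ?r" "is_torsion w" "sc z ?x = d k w"
  proof -
    have "r + int (Suc m) = ?r" "sc (z ^ Suc m) x = sc z ?x" by simp_all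
    then show ?thesis using m(2) that by (smt (verit) imageE mem_Collect_eq)
  qed
  have xm: "?x \<in> C (k + 1) (?r - 1)"
    using complex_scale_mem[OF C power_mem[OF z] x(1), of m] by (simp add: add.commute)
  have "pair ?x (- w) \<in> cone C k ?r"
    using xm add_subgroup_uminus[OF complex_subgroup[OF C] w(1)] by (rule cone_pairI)
  moreover have "is_torsion (pair ?x (- w))"
    using x(2) w(2) by (intro torsion_pair torsion_uminus torsion_scale)
  moreover have "cone_diff z d k (pair ?x (- w)) = 0"
    using complex_d_scale[OF C power_mem[OF z] x(1), of m] x(3) w(3) complex_d_minus[OF C w(1)]
    by - (rule pair_eqI, simp_all add: cone_diff_def)
  \<comment> \<open>The first coordinate of a cone boundary is, up to sign, the boundary of a
    torsion element, which the choice of \<open>m\<close> excludes.\<close>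
  moreover have "cone_diff z d (k - 1) y \<noteq> pair ?x (- w)" if y: "y \<in> cone C (k - 1) ?r" "is_torsion y" for y
  proof
    assume "cone_diff z d (k - 1) y = pair ?x (- w)"
    then have "pr1 (cone_diff z d (k - 1) y) = ?x" by simp
    then have "?x = - d k (pr1 y)" by (simp add: cone_diff_def)
    moreover have py: "pr1 y \<in> C k (r + int m)" using cone_pr(1)[OF y(1)] by simp
    ultimately have "?x = d k (- pr1 y)" using complex_d_minus[OF C py] by simp
    moreover have "is_torsion (- pr1 y)" by (rule torsion_uminus[OF torsion_pr1[OF y(2)]])
    ultimately show False using m(1) add_subgroup_uminus[OF complex_subgroup[OF C] py] by blast
  qed
  ultimately have "lc_nonzero (cone C) (cone_diff z d) k ?r" unfolding lc_nonzero_def by blast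
  then show ?thesis by (rule that)
qed

end

section \<open>The cones for the successive linear forms\<close>

locale cone_sequence = paired_action sc Rg pr1 pr2 pair
  for sc :: "'r::comm_ring_1 \<Rightarrow> 'u::ab_group_add \<Rightarrow> 'u" and Rg pr1 pr2 pair +
  fixes C :: "nat \<Rightarrow> int \<Rightarrow> int \<Rightarrow> 'u set" and d :: "nat \<Rightarrow> int \<Rightarrow> 'u \<Rightarrow> 'u" and z :: "nat \<Rightarrow> 'r" and t :: nat
  assumes C_Suc: "C (Suc i) = cone (C i)" and d_Suc: "d (Suc i) = cone_diff (z i) (d i)"
    and z: "i \<le> t \<Longrightarrow> z i \<in> Rg 1" and C_0: "injective_complex (C 0) (d 0)"
    and exact_0: "k \<noteq> 0 \<Longrightarrow> exact_from (C 0) (d 0) c k"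
begin

lemma C_injective: "i \<le> Suc t \<Longrightarrow> injective_complex (C i) (d i)"
proof (induction i)
  case (Suc i)
  then show ?case unfolding C_Suc d_Suc by (intro cone_injective z) auto
qed (rule C_0)

lemma C_complex: "i \<le> Suc t \<Longrightarrow> cochain_complex (C i) (d i)"
  using C_injective by (simp add: injective_complex_def)

lemma exact_positive:
  assumes "i \<le> Suc t" "k > 0"
  shows "exact_from (C i) (d i) c k"
  using assms
proof (induction i arbitrary: k c)
  case 0
  then show ?case using exact_0 by simp
next
  case (Suc i)
  have C: "cochain_complex (C i) (d i)" and zi: "z i \<in> Rg 1" using Suc.prems C_complex[of i] z[of i] by auto
  \<comment> \<open>The first coordinate lies one internal degree lower, hence \<open>c - 1\<close>.
    Since H^(k+1) is zero from there on, injectivity of \<open>z\<close> on it is automatic.\<close>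
  have ex: "exact_from (C i) (d i) c k" "exact_from (C i) (d i) (c - 1) (k + 1)"
    using Suc.IH Suc.prems by auto
  have "exact_from (cone (C i)) (cone_diff (z i) (d i)) (max c c) k"
    by (rule cone_exact[OF C zi ex(1)]) (use ex(2) in \<open>auto simp: exact_from_def\<close>)
  then show ?case by (simp add: C_Suc d_Suc)
qed

end

text \<open>Kept apart from \<open>cone_sequence\<close>: the new assumption is derived from
  filter-regularity on \<open>M\<close> by means of \<open>presents_iterate\<close>, which is proved
  for the bare sequence of cones.\<close>

locale filter_regular_cone_sequence = cone_sequence +
  assumes filter_regular: "i \<le> t \<Longrightarrow> \<exists>c. \<forall>s\<ge>c. \<not> kernel_nonzero (C i) (d i) (z i) s"
begin

text \<open>One bound serves all \<open>k < 0\<close>, as \<open>boundary_section\<close> requires.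
  Only \<open>k = - 1\<close> meets the possibly nonzero H^0, where injectivity of \<open>z\<close>
  in large degrees is filter-regularity; for smaller \<open>k\<close> the cohomology in degree
  \<open>k + 1\<close> already vanishes in large degrees.\<close>

lemma exact_negative:
  assumes "i \<le> Suc t"
  shows "\<exists>c. \<forall>k<0. exact_from (C i) (d i) c k"
  using assms
proof (induction i)
  case 0
  then show ?case using exact_0 by auto
next
  case (Suc i)
  have C: "cochain_complex (C i) (d i)" and zi: "z i \<in> Rg 1" using Suc.prems C_complex[of i] z[of i] by auto
  obtain c where c: "\<And>k. k < 0 \<Longrightarrow> exact_from (C i) (d i) c k" using Suc by auto
  obtain c' where c': "\<And>s. s \<ge> c' \<Longrightarrow> \<not> kernel_nonzero (C i) (d i) (z i) s"
    using filter_regular[of i] Suc.prems by auto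
  \<comment> \<open>Both bounds are raised by 1 since the classes of \<open>C i\<close> in question
    sit in internal degree \<open>r - 1\<close>.\<close>
  define c'' where "c'' = max (c + 1) (c' + 1)"
  have "exact_from (cone (C i)) (cone_diff (z i) (d i)) (max c c'') k" if k: "k < 0" for k
  proof (rule cone_exact[OF C zi c[OF k]])
    fix r x assume r: "r \<ge> c''" and x: "x \<in> C i (k + 1) (r - 1)" "d i (k + 1) x = 0" "sc (z i) x \<in> d i k ` C i k r"
    show "x \<in> d i k ` C i k (r - 1)"
    proof (cases "k = - 1")
      case True
      then show ?thesis using c'[of "r - 1"] r x unfolding kernel_nonzero_def by (auto simp: c''_def)
    next
      case False
      then show ?thesis using c[of "k + 1"] r x k unfolding exact_from_def by (auto simp: c''_def)
    qed
  qed
  then show ?case by (auto simp: C_Suc d_Suc)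
qed

text \<open>Each cone lowers the cohomological degree by one and raises the internal degree by at
  least one. After \<open>j\<close> cones the class is in cohomological degree 0, where a power of
  the next form takes it into the kernel.\<close>

lemma lc_nonzero_imp_kernel:
  assumes "i + j \<le> t" "lc_nonzero (C i) (d i) (int j) r"
  shows "\<exists>r'\<ge>r + int j. kernel_nonzero (C (i + j)) (d (i + j)) (z (i + j)) r'"
  using assms
proof (induction j arbitrary: i r)
  case 0
  then have i: "i \<le> Suc t" "i \<le> t" and nz: "lc_nonzero (C i) (d i) 0 r" by auto
  obtain c where c: "\<And>k. k < 0 \<Longrightarrow> exact_from (C i) (d i) c k" using exact_negative[OF i(1)] by blast
  obtain m :: nat where "kernel_nonzero (C i) (d i) (z i) (r + int m)"
    using lc_nonzero_imp_kernel_nonzero[OF C_injective[OF i(1)] c z[OF i(2)] nz] by blast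
  then show ?case by (intro exI[of _ "r + int m"]) simp
next
  case (Suc j)
  have nz: "lc_nonzero (C i) (d i) (int j + 1) r" using Suc.prems(2) by (simp add: add.commute)
  obtain m :: nat where "lc_nonzero (C (Suc i)) (d (Suc i)) (int j) (r + int m + 1)"
    using lc_nonzero_imp_cone[OF C_complex[of i] z[of i] nz] Suc.prems(1) unfolding C_Suc d_Suc by auto
  from Suc.IH[OF _ this] Suc.prems(1) obtain r' where
    "r' \<ge> r + int m + 1 + int j" "kernel_nonzero (C (Suc i + j)) (d (Suc i + j)) (z (Suc i + j)) r'" by auto
  then show ?case by (intro exI[of _ r']) simp
qed

text \<open>Undoing one cone keeps \<open>(j, r')\<close> or replaces it by
  \<open>(j + 1, r' - 1)\<close>, so the sum of the degrees is preserved and at most one internal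
  degree is lost per cone. The first inequality serves \<open>partial_reg\<close>, the second
  \<open>partial_a_star\<close>.\<close>

lemma kernel_imp_lc_nonzero:
  assumes "i + m \<le> t" "kernel_nonzero (C (i + m)) (d (i + m)) (z (i + m)) r"
  shows "\<exists>j\<le>m. \<exists>r'. lc_nonzero (C i) (d i) (int j) r' \<and> r \<le> r' + int j \<and> r - int m \<le> r'"
  using assms
proof (induction m arbitrary: i)
  case 0
  then have i: "i \<le> Suc t" "i \<le> t" and nz: "kernel_nonzero (C i) (d i) (z i) r" by auto
  obtain c where c: "\<And>k. k < 0 \<Longrightarrow> exact_from (C i) (d i) c k" using exact_negative[OF i(1)] by blast
  obtain c' where c': "\<And>s. s \<ge> c' \<Longrightarrow> \<not> kernel_nonzero (C i) (d i) (z i) s"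
    using filter_regular[OF i(2)] by blast
  have "lc_nonzero (C i) (d i) 0 r"
    by (rule kernel_nonzero_imp_lc_nonzero[OF C_injective[OF i(1)] c z[OF i(2)] c' nz])
  then show ?case by auto
next
  case (Suc m)
  from Suc.IH[of "Suc i"] Suc.prems obtain j r' where j: "j \<le> m"
    "lc_nonzero (C (Suc i)) (d (Suc i)) (int j) r'" "r \<le> r' + int j" "r - int m \<le> r'" by auto
  have "lc_nonzero (C i) (d i) (int j) r' \<or> lc_nonzero (C i) (d i) (int j + 1) (r' - 1)"
    using lc_nonzero_cone[OF C_complex[of i] z[of i]] j(2) Suc.prems(1) unfolding C_Suc d_Suc by auto
  then show ?case
  proof
    assume "lc_nonzero (C i) (d i) (int j) r'"
    then show ?thesis using j by (intro exI[of _ j] conjI exI[of _ r']) auto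
  next
    assume "lc_nonzero (C i) (d i) (int j + 1) (r' - 1)"
    then show ?thesis using j by (intro exI[of _ "Suc j"] conjI exI[of _ "r' - 1"]) (auto simp: add.commute)
  qed
qed

end

subsection \<open>Cohomology of the cones in degree zero\<close>

context paired_action
begin

text \<open>\<open>e\<close> induces an isomorphism from \<open>M / N\<close> to the cohomology of \<open>C\<close> in degree \<open>0\<close>.\<close>

definition presents :: "('r \<Rightarrow> 'm \<Rightarrow> 'm::ab_group_add) \<Rightarrow> (int \<Rightarrow> 'm set) \<Rightarrow> (int \<Rightarrow> int \<Rightarrow> 'u set) \<Rightarrow>
    (int \<Rightarrow> 'u \<Rightarrow> 'u) \<Rightarrow> ('m \<Rightarrow> 'u) \<Rightarrow> (int \<Rightarrow> 'm set) \<Rightarrow> bool" where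
  "presents sM Mg C d e N \<longleftrightarrow> (\<forall>r. \<forall>x\<in>Mg r. e x \<in> C 0 r \<and> d 0 (e x) = 0) \<and>
     (\<forall>r. \<forall>x\<in>Mg r. \<forall>y\<in>Mg r. e (x + y) = e x + e y) \<and>
     (\<forall>n r. \<forall>a\<in>Rg n. \<forall>x\<in>Mg r. e (sM a x) = sc a (e x)) \<and>
     (\<forall>r. \<forall>y\<in>C 0 r. d 0 y = 0 \<longrightarrow> (\<exists>x\<in>Mg r. y - e x \<in> d (- 1) ` C (- 1) r)) \<and>
     (\<forall>r. \<forall>x\<in>Mg r. e x \<in> d (- 1) ` C (- 1) r \<longleftrightarrow> x \<in> N r)"

lemma presentsD:
  assumes "presents sM Mg C d e N"
  shows presents_mem: "x \<in> Mg r \<Longrightarrow> e x \<in> C 0 r"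
    and presents_cocycle: "x \<in> Mg r \<Longrightarrow> d 0 (e x) = 0"
    and presents_add: "x \<in> Mg r \<Longrightarrow> y \<in> Mg r \<Longrightarrow> e (x + y) = e x + e y"
    and presents_scale: "a \<in> Rg n \<Longrightarrow> x \<in> Mg r \<Longrightarrow> e (sM a x) = sc a (e x)"
    and presents_surj: "v \<in> C 0 r \<Longrightarrow> d 0 v = 0 \<Longrightarrow> \<exists>x\<in>Mg r. v - e x \<in> d (- 1) ` C (- 1) r"
    and presents_kernel: "x \<in> Mg r \<Longrightarrow> e x \<in> d (- 1) ` C (- 1) r \<longleftrightarrow> x \<in> N r"
  using assms unfolding presents_def by blast+

lemma presents_kernel_nonzero:
  assumes C: "cochain_complex C d" and z: "z \<in> Rg 1" and M: "graded_module Rg sM Mg"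
    and P: "presents sM Mg C d e N"
  shows "kernel_nonzero C d z r \<longleftrightarrow> (\<exists>x\<in>Mg r. sM z x \<in> N (1 + r) \<and> x \<notin> N r)"
proof
  have zM: "sM z x \<in> Mg (1 + r)" if "x \<in> Mg r" for x
    using M z that unfolding graded_module_def by (metis of_nat_1)
  note B = boundary_subgroup[OF C, of "- 1"]
  {
    assume "kernel_nonzero C d z r"
    then obtain y where y: "y \<in> C 0 r" "d 0 y = 0" "sc z y \<in> d (- 1) ` C (- 1) (1 + r)"
      "y \<notin> d (- 1) ` C (- 1) r" unfolding kernel_nonzero_def by blast
    obtain x where x: "x \<in> Mg r" "y - e x \<in> d (- 1) ` C (- 1) r" using presents_surj[OF P y(1,2)] by blast
    have "sc z (y - e x) \<in> d (- 1) ` C (- 1) (1 + r)" using boundary_scale[OF C z x(2)] by simp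
    from add_subgroup_diff[OF B y(3) this] have "e (sM z x) \<in> d (- 1) ` C (- 1) (1 + r)"
      using presents_scale[OF P z x(1)] by (simp add: scale_right_diff_distrib)
    then have "sM z x \<in> N (1 + r)" using presents_kernel[OF P zM[OF x(1)]] by blast
    moreover have "x \<notin> N r"
    proof
      assume "x \<in> N r"
      then have "e x \<in> d (- 1) ` C (- 1) r" using presents_kernel[OF P x(1)] by blast
      from add_subgroup_add[OF B x(2) this] show False using y(4) by simp
    qed
    ultimately show "\<exists>x\<in>Mg r. sM z x \<in> N (1 + r) \<and> x \<notin> N r" using x(1) by blast
  next
    assume "\<exists>x\<in>Mg r. sM z x \<in> N (1 + r) \<and> x \<notin> N r"
    then obtain x where x: "x \<in> Mg r" "sM z x \<in> N (1 + r)" "x \<notin> N r" by blast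
    have "sc z (e x) \<in> d (- 1) ` C (- 1) (1 + r)"
      using presents_kernel[OF P zM[OF x(1)]] x(2) presents_scale[OF P z x(1)] by simp
    moreover have "e x \<notin> d (- 1) ` C (- 1) r" using presents_kernel[OF P x(1)] x(3) by simp
    ultimately show "kernel_nonzero C d z r"
      unfolding kernel_nonzero_def using presents_mem[OF P x(1)] presents_cocycle[OF P x(1)] by blast
  }
qed

text \<open>The end of the long exact sequence: as H^1(C) vanishes in every internal degree, H^0 of
  the cone is the cokernel of \<open>z\<close> on H^0(C), which enters through the second
  coordinate. The new family is the degree \<open>r\<close> part of N + zM.\<close>

lemma presents_cone:
  assumes C: "cochain_complex C d" and z: "z \<in> Rg 1" and M: "graded_module Rg sM Mg"
    and ex: "\<And>c. exact_from C d c 1" and P: "presents sM Mg C d e N"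
  shows "presents sM Mg (cone C) (cone_diff z d) (\<lambda>x. pair 0 (e x))
    (\<lambda>r. {x \<in> Mg r. \<exists>m\<in>Mg (r - 1). x - sM z m \<in> N r})"
  unfolding presents_def
proof (intro conjI allI ballI impI)
  have Msub: "add_subgroup (Mg r)" for r using M by (simp add: graded_module_def direct_family_def)
  have zM: "sM z m \<in> Mg r" if "m \<in> Mg (r - 1)" for m r
    using M z that unfolding graded_module_def by (metis add.commute diff_add_cancel of_nat_1)
  have e_diff: "e (x - y) = e x - e y" if "x \<in> Mg r" "y \<in> Mg r" for x y r
    using presents_add[OF P add_subgroup_diff[OF Msub that] that(2)] by simp
  have zero: "0 \<in> C k r" for k r by (rule add_subgroup_0[OF complex_subgroup[OF C]])
  note B = boundary_subgroup[OF C, of "- 1"]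
  fix r
  show "pair 0 (e x) \<in> cone C 0 r" if "x \<in> Mg r" for x
    using presents_mem[OF P that] zero by (intro cone_pairI)
  show "cone_diff z d 0 (pair 0 (e x)) = 0" if "x \<in> Mg r" for x
    using presents_cocycle[OF P that] complex_d_zero[OF C]
    by - (rule pair_eqI, simp_all add: cone_diff_def)
  show "pair 0 (e (x + y)) = pair 0 (e x) + pair 0 (e y)" if "x \<in> Mg r" "y \<in> Mg r" for x y
    using presents_add[OF P that] by - (rule pair_eqI, simp_all add: pr_linear)
  show "pair 0 (e (sM a x)) = sc a (pair 0 (e x))" if "a \<in> Rg n" "x \<in> Mg r" for n a x
    using presents_scale[OF P that] by - (rule pair_eqI, simp_all add: pr_linear)
  show "\<exists>x\<in>Mg r. y - pair 0 (e x) \<in> cone_diff z d (- 1) ` cone C (- 1) r"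
    if y: "y \<in> cone C 0 r" "cone_diff z d 0 y = 0" for y
  proof -
    obtain u' where u': "u' \<in> C 0 (r - 1)" "pr1 y = d 0 u'"
      using ex[of "r - 1"] cone_pr(1)[OF y(1)] cone_cocycle(1)[OF C y] unfolding exact_from_def by auto
    obtain x where x: "x \<in> Mg r" "pr2 y + sc z u' - e x \<in> d (- 1) ` C (- 1) r"
      using presents_surj[OF P cone_cocycle_shift[OF C z y u']] by blast
    then obtain w where w: "w \<in> C (0 - 1) r" "pr2 y + sc z u' - e x = d (0 - 1) w" by auto
    have "pr1 (y - pair 0 (e x)) = d 0 u'" "pr2 (y - pair 0 (e x)) + sc z u' = d (0 - 1) w"
      using u'(2) w(2) by (simp_all add: pr_linear diff_add_eq)
    from cone_boundary[OF C u'(1) this(1) w(1) this(2)]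
    have "y - pair 0 (e x) \<in> cone_diff z d (0 - 1) ` cone C (0 - 1) r" by (metis imageI)
    then show ?thesis using x(1) by auto
  qed
  fix x assume x: "x \<in> Mg r"
  show "pair 0 (e x) \<in> cone_diff z d (- 1) ` cone C (- 1) r \<longleftrightarrow>
      x \<in> {x \<in> Mg r. \<exists>m\<in>Mg (r - 1). x - sM z m \<in> N r}"
  proof
    assume "pair 0 (e x) \<in> cone_diff z d (- 1) ` cone C (- 1) r"
    then obtain v where v: "v \<in> cone C (- 1) r" "cone_diff z d (- 1) v = pair 0 (e x)" by auto
    have "pr1 (cone_diff z d (- 1) v) = 0" "pr2 (cone_diff z d (- 1) v) = e x" unfolding v(2) by simp_all
    then have p: "d 0 (pr1 v) = 0" and q: "sc z (pr1 v) + d (- 1) (pr2 v) = e x" by (simp_all add: cone_diff_def)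
    have pv: "pr1 v \<in> C 0 (r - 1)" "pr2 v \<in> C (- 1) r" using cone_pr[OF v(1)] by simp_all
    \<comment> \<open>\<open>pr1 v\<close> is a cocycle, so modulo boundaries it comes from
      \<open>M\<close>; this is the \<open>m\<close> whose multiple by \<open>z\<close> accounts for
      \<open>x\<close> modulo \<open>N\<close>.\<close>
    obtain m where m: "m \<in> Mg (r - 1)" "pr1 v - e m \<in> d (- 1) ` C (- 1) (r - 1)"
      using presents_surj[OF P pv(1) p] by blast
    have "sc z (pr1 v - e m) \<in> d (- 1) ` C (- 1) r" using boundary_scale[OF C z m(2)] by simp
    from add_subgroup_add[OF B this imageI[OF pv(2)]]
    have "sc z (pr1 v - e m) + d (- 1) (pr2 v) \<in> d (- 1) ` C (- 1) r" .
    moreover have "e (x - sM z m) = sc z (pr1 v - e m) + d (- 1) (pr2 v)"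
      using e_diff[OF x zM[OF m(1)]] presents_scale[OF P z m(1)]
      by (simp add: scale_right_diff_distrib flip: q)
    ultimately have "x - sM z m \<in> N r"
      using presents_kernel[OF P add_subgroup_diff[OF Msub x zM[OF m(1)]]] by simp
    then show "x \<in> {x \<in> Mg r. \<exists>m\<in>Mg (r - 1). x - sM z m \<in> N r}" using x m(1) by blast
  next
    assume "x \<in> {x \<in> Mg r. \<exists>m\<in>Mg (r - 1). x - sM z m \<in> N r}"
    then obtain m where m: "m \<in> Mg (r - 1)" "x - sM z m \<in> N r" by blast
    then have "e (x - sM z m) \<in> d (- 1) ` C (- 1) r"
      using presents_kernel[OF P add_subgroup_diff[OF Msub x zM[OF m(1)]]] by simp
    then obtain w where w: "w \<in> C (- 1) r" "e x - sc z (e m) = d (- 1) w"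
      using e_diff[OF x zM[OF m(1)]] presents_scale[OF P z m(1)] by auto
    have "pair (e m) w \<in> cone C (- 1) r" using presents_mem[OF P m(1)] w(1) by (intro cone_pairI) simp_all
    moreover have "cone_diff z d (- 1) (pair (e m) w) = pair 0 (e x)"
      using presents_cocycle[OF P m(1)] by - (rule pair_eqI, simp_all add: cone_diff_def flip: w(2))
    ultimately show "pair 0 (e x) \<in> cone_diff z d (- 1) ` cone C (- 1) r" by (metis imageI)
  qed
qed

end

lemma (in cone_sequence) presents_iterate:
  assumes M: "graded_module Rg sM Mg" and 0: "presents sM Mg (C 0) (d 0) e (N 0)"
    and N: "\<And>i r. i \<le> t \<Longrightarrow> N (Suc i) r = {x \<in> Mg r. \<exists>m\<in>Mg (r - 1). x - sM (z i) m \<in> N i r}"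
    and i: "i \<le> Suc t"
  shows "\<exists>e. presents sM Mg (C i) (d i) e (N i)"
  using i
proof (induction i)
  case 0
  then show ?case using assms(2) by blast
next
  case (Suc i)
  then obtain e where e: "presents sM Mg (C i) (d i) e (N i)" by auto
  have i: "i \<le> Suc t" "i \<le> t" using Suc.prems by auto
  have "N (Suc i) = (\<lambda>r. {x \<in> Mg r. \<exists>m\<in>Mg (r - 1). x - sM (z i) m \<in> N i r})"
    using N[OF i(2)] by blast
  then show ?case
    using presents_cone[OF C_complex[OF i(1)] z[OF i(2)] M exact_positive[OF i(1)] e]
    unfolding C_Suc d_Suc by auto
qed

subsection \<open>The submodules generated by initial segments of the sequence\<close>

lemma module_times: "module ((*) :: 'r::comm_ring_1 \<Rightarrow> 'r \<Rightarrow> 'r)"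
  by unfold_locales (simp_all add: algebra_simps)

lemma ideal_times_Q_0:
  assumes "module sM"
  shows "ideal_times sM (Q_ideal zs 0) = {0}"
proof -
  interpret module sM by fact
  interpret R: module "(*) :: 'a \<Rightarrow> 'a \<Rightarrow> 'a" by (rule module_times)
  have "{sM a x | a x. a \<in> R.span {}} = {0}" by auto
  then show ?thesis unfolding ideal_times_def Q_ideal_def by simp
qed

lemma ideal_times_Q_Suc:
  assumes "module sM" and i: "i < length zs"
  shows "x \<in> ideal_times sM (Q_ideal zs (Suc i)) \<longleftrightarrow> (\<exists>m. x - sM (zs ! i) m \<in> ideal_times sM (Q_ideal zs i))"
proof -
  interpret module sM by fact
  interpret R: module "(*) :: 'a \<Rightarrow> 'a \<Rightarrow> 'a" by (rule module_times)
  let ?z = "zs ! i" and ?Q = "Q_ideal zs i" and ?Q' = "Q_ideal zs (Suc i)"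
  have Q': "a \<in> ?Q' \<longleftrightarrow> (\<exists>k. a - k * ?z \<in> ?Q)" for a
    unfolding Q_ideal_def using i by (simp add: take_Suc_conv_app_nth R.span_breakdown_eq)
  have "0 \<in> ?Q" unfolding Q_ideal_def by (rule R.span_zero)
  then have z: "?z \<in> ?Q'" unfolding Q' by (intro exI[of _ 1]) simp
  have QQ: "?Q \<subseteq> ?Q'" unfolding Q_ideal_def by (intro R.span_mono set_take_subset_set_take) simp
  let ?S = "{x. \<exists>m. x - sM ?z m \<in> ideal_times sM ?Q}"
  have "ideal_times sM ?Q' \<subseteq> ?S"
    unfolding ideal_times_def[of sM ?Q']
  proof (rule span_minimal)
    show "{sM a x | a x. a \<in> ?Q'} \<subseteq> ?S"
    proof clarify
      fix a x assume "a \<in> ?Q'"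
      then obtain k where k: "a - k * ?z \<in> ?Q" using Q' by blast
      have "sM a x - sM ?z (sM k x) = sM (a - k * ?z) x" by (simp add: scale_left_diff_distrib mult.commute)
      also have "\<dots> \<in> ideal_times sM ?Q" unfolding ideal_times_def using k by (intro span_base) blast
      finally show "\<exists>m. sM a x - sM ?z m \<in> ideal_times sM ?Q" by blast
    qed
    show "subspace ?S"
    proof (rule subspaceI)
      show "0 \<in> ?S" by (auto simp: ideal_times_def intro!: exI[of _ 0] span_zero)
      fix x y assume "x \<in> ?S" "y \<in> ?S"
      then obtain m n where mn: "x - sM ?z m \<in> ideal_times sM ?Q" "y - sM ?z n \<in> ideal_times sM ?Q" by blast
      have "x + y - sM ?z (m + n) = (x - sM ?z m) + (y - sM ?z n)" by (simp add: scale_right_distrib)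
      also have "\<dots> \<in> ideal_times sM ?Q" using mn unfolding ideal_times_def by (rule span_add)
      finally show "x + y \<in> ?S" by blast
    next
      fix c x assume "x \<in> ?S"
      then obtain m where m: "x - sM ?z m \<in> ideal_times sM ?Q" by blast
      have "sM c x - sM ?z (sM c m) = sM c (x - sM ?z m)"
        by (simp add: scale_right_diff_distrib mult.commute)
      also have "\<dots> \<in> ideal_times sM ?Q" using m unfolding ideal_times_def by (rule span_scale)
      finally show "sM c x \<in> ?S" by blast
    qed
  qed
  moreover have "x \<in> ideal_times sM ?Q'" if "x - sM ?z m \<in> ideal_times sM ?Q" for x m
  proof -
    have "ideal_times sM ?Q \<subseteq> ideal_times sM ?Q'"
      unfolding ideal_times_def by (rule span_mono) (use QQ in blast)
    moreover have "sM ?z m \<in> ideal_times sM ?Q'" unfolding ideal_times_def using z by (intro span_base) blast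
    ultimately have "(x - sM ?z m) + sM ?z m \<in> ideal_times sM ?Q'"
      using that unfolding ideal_times_def by (intro span_add) auto
    then show ?thesis by simp
  qed
  ultimately show ?thesis by blast
qed

lemma component_scale:
  assumes M: "graded_module Rg sM Mg" and a: "a \<in> Rg n" and x: "x \<in> internal_sum Mg"
  shows "component Mg (int n + r) (sM a x) = sM a (component Mg r x)"
proof -
  interpret module sM using M by (simp add: graded_module_def)
  have "direct_family Mg" using M by (simp add: graded_module_def)
  then show ?thesis
    using component_commute[of Mg Mg "\<lambda>r. int n + r" "sM a" x r] M a x
    by (auto simp: scale_right_distrib graded_module_def inj_def)
qed

text \<open>The submodule is graded because the forms generating it are homogeneous: a decomposition
  \<open>x = y + z m\<close> passes to components, that of \<open>m\<close> being taken one degree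
  lower.\<close>

lemma component_ideal_times_Q:
  assumes M: "graded_module Rg sM Mg" and total: "internal_sum Mg = UNIV" and zs: "set zs \<subseteq> Rg 1"
    and "i \<le> length zs" "x \<in> ideal_times sM (Q_ideal zs i)"
  shows "component Mg r x \<in> ideal_times sM (Q_ideal zs i)"
  using assms(4,5)
proof (induction i arbitrary: x r)
  have D: "direct_family Mg" and mod: "module sM" using M by (simp_all add: graded_module_def)
  interpret module sM by (rule mod)
  {
    case 0
    have "component Mg r 0 = 0" using component_add[OF D, of 0 0 r] total by simp
    then show ?case using 0 ideal_times_Q_0[OF mod, of zs] by simp
  next
    case (Suc i)
    then have i: "i < length zs" by simp
    then have z: "zs ! i \<in> Rg 1" using zs nth_mem by blast
    from Suc.prems obtain m where m: "x - sM (zs ! i) m \<in> ideal_times sM (Q_ideal zs i)"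
      using ideal_times_Q_Suc[OF mod i] by blast
    have "component Mg r x = component Mg r (x - sM (zs ! i) m) + component Mg r (sM (zs ! i) m)"
      using component_add[OF D, of "x - sM (zs ! i) m" "sM (zs ! i) m" r] total by simp
    moreover have "component Mg r (sM (zs ! i) m) = sM (zs ! i) (component Mg (r - 1) m)"
      using component_scale[OF M z, of m "r - 1"] total by simp
    ultimately have "component Mg r x - sM (zs ! i) (component Mg (r - 1) m) \<in> ideal_times sM (Q_ideal zs i)"
      using Suc.IH[OF _ m] i by simp
    then show ?case using ideal_times_Q_Suc[OF mod i] by blast
  }
qed

text \<open>Brings the submodules into the recursive shape produced by \<open>presents_cone\<close>;
  the homogeneous \<open>m\<close> is the component of degree \<open>r - 1\<close> of an arbitrary
  one.\<close>

lemma homogeneous_ideal_times_Q_Suc: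
  assumes M: "graded_module Rg sM Mg" and total: "internal_sum Mg = UNIV" and zs: "set zs \<subseteq> Rg 1"
    and i: "i < length zs"
  shows "ideal_times sM (Q_ideal zs (Suc i)) \<inter> Mg r =
    {x \<in> Mg r. \<exists>m\<in>Mg (r - 1). x - sM (zs ! i) m \<in> ideal_times sM (Q_ideal zs i) \<inter> Mg r}"
proof -
  have D: "direct_family Mg" and mod: "module sM" using M by (simp_all add: graded_module_def)
  interpret module sM by (rule mod)
  have z: "zs ! i \<in> Rg 1" using zs i nth_mem by blast
  have "\<exists>m\<in>Mg (r - 1). x - sM (zs ! i) m \<in> ideal_times sM (Q_ideal zs i) \<inter> Mg r"
    if x: "x \<in> Mg r" "x \<in> ideal_times sM (Q_ideal zs (Suc i))" for x
  proof -
    obtain m where m: "x - sM (zs ! i) m \<in> ideal_times sM (Q_ideal zs i)"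
      using ideal_times_Q_Suc[OF mod i] x(2) by blast
    let ?m = "component Mg (r - 1) m"
    have "component Mg r x = component Mg r (x - sM (zs ! i) m) + component Mg r (sM (zs ! i) m)"
      using component_add[OF D, of "x - sM (zs ! i) m" "sM (zs ! i) m" r] total by simp
    moreover have "component Mg r (sM (zs ! i) m) = sM (zs ! i) ?m"
      using component_scale[OF M z, of m "r - 1"] total by simp
    moreover have "component Mg r x = x" using component_homogeneous[OF D x(1), of r] by simp
    ultimately have "x - sM (zs ! i) ?m = component Mg r (x - sM (zs ! i) m)" by (simp add: diff_eq_eq)
    moreover have "component Mg r (x - sM (zs ! i) m) \<in> ideal_times sM (Q_ideal zs i) \<inter> Mg r"
      using component_ideal_times_Q[OF M total zs _ m] component_mem[OF D] i total by auto
    moreover have "?m \<in> Mg (r - 1)" using component_mem[OF D] total by auto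
    ultimately show ?thesis by (intro bexI[of _ ?m]) simp_all
  qed
  then show ?thesis using ideal_times_Q_Suc[OF mod i] by blast
qed

section \<open>Graded injective resolutions as complexes of homogeneous families\<close>

lemma direct_family_subfamily:
  assumes "direct_family A" "\<And>i. B i \<subseteq> A i" "\<And>i. add_subgroup (B i)"
  shows "direct_family B"
  unfolding direct_family_def
proof (intro conjI allI impI)
  fix I f assume *: "finite I \<and> (\<forall>i\<in>I. f i \<in> B i) \<and> (\<Sum>i\<in>I. f i) = 0"
  show "\<forall>i\<in>I. f i = 0"
  proof
    fix i assume "i \<in> I"
    then show "f i = 0" by (rule direct_familyD[OF assms(1), rotated 3]) (use * assms(2) in auto)
  qed
qed (rule assms(3))

lemma module_smult: "module (smult :: 'r::comm_ring_1 \<Rightarrow> 'r poly \<Rightarrow> 'r poly)"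
  by unfold_locales (simp_all add: smult_add_right smult_add_left)

context graded_action
begin

text \<open>A copy of J(-s) made of constant polynomials, since \<open>graded_injective\<close> is
  tested on graded modules inside \<open>'r poly\<close>.\<close>

definition shifted :: "int \<Rightarrow> (nat \<Rightarrow> 'r set) \<Rightarrow> int \<Rightarrow> 'r poly set" where
  "shifted s J r = (\<lambda>a. [:a:]) ` (if r \<ge> s then J (nat (r - s)) else {0})"

lemma shifted_mem: "r \<ge> s \<Longrightarrow> a \<in> J (nat (r - s)) \<Longrightarrow> [:a:] \<in> shifted s J r"
  by (simp add: shifted_def)

lemma shifted_cases:
  assumes "p \<in> shifted s J r"
  obtains a where "p = [:a:]" "r \<ge> s" "a \<in> J (nat (r - s))" | "p = 0" "r < s"
  using assms by (auto simp: shifted_def split: if_splits)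

lemma shifted_graded_module:
  assumes J: "homogeneous_ideal J"
  shows "graded_module Rg smult (shifted s J)"
proof -
  have sub: "add_subgroup (shifted s K r)" if "\<And>n. add_subgroup (K n)" for K r
    using that by (auto simp: add_subgroup_def shifted_def)
  have RgD: "direct_family Rg" using Rg by (simp add: graded_ring_def)
  have "direct_family (shifted s Rg)"
    unfolding direct_family_def
  proof (intro conjI allI impI)
    show "add_subgroup (shifted s Rg r)" for r using sub Rg_subgroup by blast
    fix I f assume *: "finite I \<and> (\<forall>i\<in>I. f i \<in> shifted s Rg i) \<and> (\<Sum>i\<in>I. f i) = 0"
    define g where "g i = coeff (f i) 0" for i
    have f: "f i = [:g i:]" "i \<ge> s \<Longrightarrow> g i \<in> Rg (nat (i - s))" "\<not> i \<ge> s \<Longrightarrow> g i = 0" if "i \<in> I" for i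
      using * that by (auto simp: g_def elim!: shifted_cases)
    let ?I = "{i \<in> I. i \<ge> s}"
    have inj: "inj_on (\<lambda>i. nat (i - s)) ?I" by (auto simp: inj_on_def)
    have "(\<Sum>i\<in>I. g i) = coeff (\<Sum>i\<in>I. f i) 0" by (simp add: g_def coeff_sum)
    then have "(\<Sum>i\<in>I. g i) = 0" using * by simp
    moreover have "(\<Sum>i\<in>I. g i) = (\<Sum>i\<in>?I. g i)"
      using * f(3) by (intro sum.mono_neutral_right) blast+
    moreover have "(\<Sum>i\<in>?I. g i) = (\<Sum>n\<in>(\<lambda>i. nat (i - s)) ` ?I. g (int n + s))"
      using inj by (simp add: sum.reindex)
    ultimately have sum0: "(\<Sum>n\<in>(\<lambda>i. nat (i - s)) ` ?I. g (int n + s)) = 0" by simp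
    have g0: "g i = 0" if i: "i \<in> ?I" for i
    proof -
      have "g (int (nat (i - s)) + s) = 0"
        by (rule direct_familyD[OF RgD _ _ sum0]) (use * f(2) i in auto)
      then show ?thesis using i by simp
    qed
    show "\<forall>i\<in>I. f i = 0"
    proof
      fix i assume "i \<in> I"
      then show "f i = 0" using f g0[of i] by (cases "i \<ge> s") auto
    qed
  qed
  moreover have "shifted s J r \<subseteq> shifted s Rg r" for r
    using J by (auto simp: shifted_def homogeneous_ideal_def)
  moreover have "add_subgroup (shifted s J r)" for r
    using J by (intro sub) (simp add: homogeneous_ideal_def)
  ultimately have "direct_family (shifted s J)" by (rule direct_family_subfamily)
  moreover have "smult a p \<in> shifted s J (int n + r)" if a: "a \<in> Rg n" and p: "p \<in> shifted s J r" for n r a p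
    using p
  proof (cases rule: shifted_cases)
    case (1 b)
    have "nat (int n + r - s) = n + nat (r - s)" using 1 by linarith
    then show ?thesis using 1 a J by (auto simp: homogeneous_ideal_def intro!: shifted_mem)
  next
    case 2
    then show ?thesis using add_subgroup_0[OF \<open>add_subgroup (shifted s J (int n + r))\<close>] by simp
  qed
  ultimately show ?thesis using module_smult by (simp add: graded_module_def)
qed

text \<open>The ideal map becomes a homomorphism on \<open>shifted s J\<close>; injectivity extends
  it to \<open>shifted s Rg\<close>, and the value at the constant polynomial 1 is the required
  \<open>w\<close>.\<close>

lemma baer_of_graded_injective:
  assumes inj: "graded_injective TYPE('r poly) Rg sc D"
  shows "baer D"
  unfolding baer_def
proof (intro allI impI)
  fix J s \<phi> assume "homogeneous_ideal J \<and> ideal_map J D s \<phi>"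
  then have J: "homogeneous_ideal J" and \<phi>: "ideal_map J D s \<phi>" by auto
  have Rid: "homogeneous_ideal Rg" by (simp add: homogeneous_ideal_def Rg_subgroup Rg_mult)
  have Dm: "graded_module Rg sc D" using inj by (simp add: graded_injective_def)
  have D0: "0 \<in> D r" for r
    using Dm by (simp add: graded_module_def direct_family_def add_subgroup_0)
  note A = shifted_graded_module[OF Rid, of s] and B = shifted_graded_module[OF J, of s]
  have Bd: "direct_family (shifted s J)" using B by (simp add: graded_module_def)
  have BA: "\<forall>r. shifted s J r \<subseteq> shifted s Rg r" using J by (auto simp: shifted_def homogeneous_ideal_def)
  have \<phi>_add: "\<phi> n (a + b) = \<phi> n a + \<phi> n b" if "a \<in> J n" "b \<in> J n" for n a b
    using \<phi> that by (simp add: ideal_map_def)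
  have "0 \<in> J 0" using J by (simp add: homogeneous_ideal_def add_subgroup_0)
  then have \<phi>0: "\<phi> 0 0 = 0" using \<phi>_add[of 0 0 0] by simp
  have \<phi>'_add: "\<phi> (nat (r - s)) (coeff (p + q) 0) = \<phi> (nat (r - s)) (coeff p 0) + \<phi> (nat (r - s)) (coeff q 0)"
    if "p \<in> shifted s J r" "q \<in> shifted s J r" for p q r
    using that by (elim shifted_cases) (simp_all add: \<phi>_add \<phi>0)
  obtain f where f: "\<And>r p. p \<in> shifted s J r \<Longrightarrow> f p = \<phi> (nat (r - s)) (coeff p 0)"
    "\<And>p q. p \<in> internal_sum (shifted s J) \<Longrightarrow> q \<in> internal_sum (shifted s J) \<Longrightarrow> f (p + q) = f p + f q"
    by (rule direct_family_extend[OF Bd, of "\<lambda>r p. \<phi> (nat (r - s)) (coeff p 0)", OF \<phi>'_add]) blast+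
  have f0: "f 0 = 0" using f(2)[OF internal_sum_0 internal_sum_0] by simp
  have "graded_hom smult (shifted s J) sc D f"
    unfolding graded_hom_def
  proof (intro conjI ballI allI)
    show "f (p + q) = f p + f q" if "p \<in> internal_sum (shifted s J)" "q \<in> internal_sum (shifted s J)" for p q
      using f(2) that .
    show "f ` shifted s J r \<subseteq> D r" for r
    proof
      fix y assume "y \<in> f ` shifted s J r"
      then obtain p where p: "p \<in> shifted s J r" "y = f p" by blast
      from p(1) show "y \<in> D r"
      proof (cases rule: shifted_cases)
        case (1 a)
        then have "\<phi> (nat (r - s)) a \<in> D (int (nat (r - s)) + s)" using \<phi> unfolding ideal_map_def by blast
        then show ?thesis using 1 f(1)[OF p(1)] p(2) by simp
      qed (simp add: p(2) f0 D0)
    qed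
    fix a p assume p: "p \<in> internal_sum (shifted s J)"
    have scl: "smult b q \<in> internal_sum (shifted s J)" if "q \<in> internal_sum (shifted s J)" for b q
      by (rule graded_module_scale_internal_sum[OF Rg B that])
    have "a \<in> internal_sum Rg" using Rg by (simp add: graded_ring_def)
    then show "f (smult a p) = sc a (f p)" using Rg_subgroup
    proof (induction rule: internal_sum_induct)
      case (hom n a)
      show ?case using p direct_family_add_subgroup[OF Bd]
      proof (induction rule: internal_sum_induct)
        case h: (hom r p)
        from h show ?case
        proof (cases rule: shifted_cases)
          case (1 b)
          have "smult a p \<in> shifted s J (int n + r)" using B hom h by (simp add: graded_module_def)
          then have "f (smult a p) = \<phi> (nat (int n + r - s)) (a * b)" using f(1) 1 by simp
          also have "nat (int n + r - s) = n + nat (r - s)" using 1 by linarith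
          also have "\<phi> (n + nat (r - s)) (a * b) = sc a (\<phi> (nat (r - s)) b)"
            using \<phi> hom 1 unfolding ideal_map_def by blast
          finally show ?thesis using f(1)[OF h] 1 by simp
        qed (simp add: f0)
      next
        case (add p q)
        then show ?case using f(2) scl by (simp add: smult_add_right scale_right_distrib)
      qed
    next
      case (add a b)
      then show ?case using f(2)[OF scl[OF p] scl[OF p], of a b] by (simp add: smult_add_left scale_left_distrib)
    qed
  qed
  with A B BA inj obtain g where g: "graded_hom smult (shifted s Rg) sc D g"
    "\<forall>p\<in>internal_sum (shifted s J). g p = f p"
    unfolding graded_injective_def by blast
  have one: "[:1:] \<in> shifted s Rg s" using Rg_one by (intro shifted_mem) simp_all
  have "\<phi> n a = sc a (g [:1:])" if a: "a \<in> J n" for n a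
  proof -
    have aB: "[:a:] \<in> shifted s J (int n + s)" using a by (intro shifted_mem) simp_all
    have "\<phi> n a = f [:a:]" using f(1)[OF aB] by simp
    also have "\<dots> = g (smult a [:1:])" using g(2) internal_sum_homogeneous[of _ "shifted s J", OF aB] by simp
    also have "\<dots> = sc a (g [:1:])"
      using g(1) internal_sum_homogeneous[of _ "shifted s Rg", OF one] unfolding graded_hom_def by blast
    finally show ?thesis .
  qed
  moreover have "g [:1:] \<in> D s" using g(1) one unfolding graded_hom_def by blast
  ultimately show "\<exists>w\<in>D s. \<forall>n. \<forall>a\<in>J n. \<phi> n a = sc a w" by blast
qed

text \<open>Each factor is a sum of homogeneous elements and products are multilinear. The first
  factor is expanded and absorbed into the module element, so the induction runs over all
  \<open>x\<close>.\<close>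

lemma torsion_annihilates_irrelevant:
  assumes "\<And>as. length as = n \<Longrightarrow> set as \<subseteq> (\<Union>m. Rg (Suc m)) \<Longrightarrow> sc (prod_list as) x = 0"
    and "length as = n" "set as \<subseteq> irrelevant_ideal Rg"
  shows "sc (prod_list as) x = 0"
  using assms
proof (induction n arbitrary: x as)
  case 0
  then show ?case by auto
next
  case (Suc n)
  then obtain a as' where as: "as = a # as'" "length as' = n" by (metis length_Suc_conv)
  have "a \<in> internal_sum (\<lambda>n. Rg (Suc n))" using Suc.prems(3) as by (simp add: irrelevant_ideal_def)
  then have kill: "sc (prod_list bs) (sc a x) = 0" if "length bs = n" "set bs \<subseteq> (\<Union>m. Rg (Suc m))" for bs
    using Rg_subgroup
  proof (induction rule: internal_sum_induct)
    case (hom m a)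
    then have "sc (prod_list (a # bs)) x = 0" using that by (intro Suc.prems(1)) auto
    then show ?case by (simp add: mult.commute)
  next
    case (add a b)
    then show ?case by (simp add: scale_left_distrib scale_right_distrib del: scale_scale)
  qed
  have "set as' \<subseteq> irrelevant_ideal Rg" using as Suc.prems(3) by simp
  from Suc.IH[OF kill as(2) this] have "sc (prod_list as') (sc a x) = 0" by blast
  then show ?case using as by (simp add: mult.commute)
qed

lemma torsion_iff:
  "x \<in> torsion Rg sc G \<longleftrightarrow> x \<in> internal_sum G \<and> is_torsion x"
proof -
  have sub: "(\<Union>m. Rg (Suc m)) \<subseteq> irrelevant_ideal Rg"
    unfolding irrelevant_ideal_def using internal_sum_homogeneous[of _ "\<lambda>n. Rg (Suc n)"] by blast
  have "(\<forall>as. length as = n \<and> set as \<subseteq> irrelevant_ideal Rg \<longrightarrow> sc (prod_list as) x = 0) \<longleftrightarrow>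
      (\<forall>as. length as = n \<and> set as \<subseteq> (\<Union>m. Rg (Suc m)) \<longrightarrow> sc (prod_list as) x = 0)" for n
  proof (intro iffI allI impI; elim conjE)
    fix as assume *: "\<forall>as. length as = n \<and> set as \<subseteq> irrelevant_ideal Rg \<longrightarrow> sc (prod_list as) x = 0"
      "length as = n" "set as \<subseteq> (\<Union>m. Rg (Suc m))"
    have "set as \<subseteq> irrelevant_ideal Rg" using *(3) sub by (rule subset_trans)
    then show "sc (prod_list as) x = 0" using *(1,2) by blast
  next
    fix as assume *: "\<forall>as. length as = n \<and> set as \<subseteq> (\<Union>m. Rg (Suc m)) \<longrightarrow> sc (prod_list as) x = 0"
      "length as = n" "set as \<subseteq> irrelevant_ideal Rg"
    show "sc (prod_list as) x = 0"
      by (rule torsion_annihilates_irrelevant[OF _ *(2,3)]) (use *(1) in blast)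
  qed
  then show ?thesis unfolding torsion_def is_torsion_def by simp
qed

lemma torsion_component:
  assumes G: "graded_module Rg sc G" and x: "x \<in> internal_sum G" "is_torsion x"
  shows "is_torsion (component G r x)"
proof -
  have D: "direct_family G" using G by (simp add: graded_module_def)
  have 0: "component G s 0 = 0" for s using component_add[OF D internal_sum_0 internal_sum_0, of s] by simp
  obtain n where n: "\<And>as. length as = n \<Longrightarrow> set as \<subseteq> (\<Union>m. Rg (Suc m)) \<Longrightarrow> sc (prod_list as) x = 0"
    using x(2) unfolding is_torsion_def by blast
  have "sc (prod_list as) (component G r x) = 0" if as: "length as = n" "set as \<subseteq> (\<Union>m. Rg (Suc m))" for as
  proof -
    obtain m where "prod_list as \<in> Rg m" using prod_list_positive[OF as(2)] .
    from component_scale[OF G this x(1), of r] show ?thesis using n[OF as] 0 by simp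
  qed
  then show ?thesis unfolding is_torsion_def by blast
qed

end

lemma graded_hom_component:
  assumes f: "graded_hom sc G sc' G' f" and G: "direct_family G" and G': "direct_family G'"
    and x: "x \<in> internal_sum G"
  shows "component G' r (f x) = f (component G r x)"
proof (rule component_commute[where h = "\<lambda>r. r", OF G G'])
  show "inj (\<lambda>r::int. r)" by simp
qed (use f x in \<open>auto simp: graded_hom_def image_subset_iff\<close>)

text \<open>Sequences in \<open>'e\<close> form a module isomorphic to its own square, by separating
  even and odd entries. It is the ambient module in which all cones of \<open>E\<close>
  live.\<close>

definition seq_scale :: "('r \<Rightarrow> 'e \<Rightarrow> 'e) \<Rightarrow> 'r \<Rightarrow> (nat \<Rightarrow> 'e) \<Rightarrow> nat \<Rightarrow> 'e" where
  "seq_scale s a f = (\<lambda>n. s a (f n))"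

definition seq_fst :: "(nat \<Rightarrow> 'e) \<Rightarrow> nat \<Rightarrow> 'e" where
  "seq_fst f = (\<lambda>n. f (2 * n))"

definition seq_snd :: "(nat \<Rightarrow> 'e) \<Rightarrow> nat \<Rightarrow> 'e" where
  "seq_snd f = (\<lambda>n. f (2 * n + 1))"

definition seq_pair :: "(nat \<Rightarrow> 'e) \<Rightarrow> (nat \<Rightarrow> 'e) \<Rightarrow> nat \<Rightarrow> 'e" where
  "seq_pair f g = (\<lambda>n. if even n then f (n div 2) else g (n div 2))"

definition seq_single :: "'e::zero \<Rightarrow> nat \<Rightarrow> 'e" where
  "seq_single x = (\<lambda>n. if n = 0 then x else 0)"

lemma paired_action_seq:
  fixes sE :: "'r::comm_ring_1 \<Rightarrow> 'e::ab_group_add \<Rightarrow> 'e"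
  assumes "module sE" "graded_ring Rg"
  shows "paired_action (seq_scale sE) Rg seq_fst seq_snd seq_pair"
proof -
  interpret module sE by fact
  have "module (seq_scale sE)"
    by unfold_locales (simp_all add: seq_scale_def fun_eq_iff scale_right_distrib scale_left_distrib)
  then interpret U: module "seq_scale sE" .
  show ?thesis
    by unfold_locales
      (auto simp: assms(2) seq_scale_def seq_fst_def seq_snd_def seq_pair_def fun_eq_iff odd_two_times_div_two_succ)
qed

lemma seq_single_simps [simp]: "seq_single x 0 = x" "seq_single 0 = 0"
  "seq_single x = seq_single y \<longleftrightarrow> x = y" "seq_single x = 0 \<longleftrightarrow> x = 0"
  by (auto simp: seq_single_def fun_eq_iff)

lemma seq_single_add: "seq_single (x + y) = seq_single x + seq_single (y :: 'e::ab_group_add)"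
  by (simp add: seq_single_def fun_eq_iff)

lemma seq_single_diff: "seq_single (x - y) = seq_single x - seq_single (y :: 'e::ab_group_add)"
  by (simp add: seq_single_def fun_eq_iff)

lemma seq_single_scale:
  assumes "module sE"
  shows "seq_single (sE a x) = seq_scale sE a (seq_single x)"
  using module.scale_zero_right[OF assms] by (simp add: seq_single_def seq_scale_def fun_eq_iff)

section \<open>The resolution as a complex inside the sequence module\<close>

locale graded_resolution =
  fixes Rg :: "nat \<Rightarrow> 'r::comm_ring_1 set"
    and sM :: "'r \<Rightarrow> 'm \<Rightarrow> 'm::ab_group_add" and Mg :: "int \<Rightarrow> 'm set"
    and sE :: "'r \<Rightarrow> 'e \<Rightarrow> 'e::ab_group_add" and E :: "nat \<Rightarrow> int \<Rightarrow> 'e set"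
    and \<epsilon> :: "'m \<Rightarrow> 'e" and d :: "nat \<Rightarrow> 'e \<Rightarrow> 'e"
  assumes graded_R: "graded_ring Rg" and graded_M: "graded_module Rg sM Mg"
    and resolution: "graded_injective_resolution Rg sM Mg sE E \<epsilon> d"
begin

lemma E_graded_module: "graded_module Rg sE (E j)"
  using resolution by (simp add: graded_injective_resolution_def graded_injective_def)

lemma sE_module: "module sE"
  using E_graded_module by (simp add: graded_module_def)

sublocale EA: graded_action sE Rg
  using sE_module graded_R by (simp add: graded_action_def graded_action_axioms_def)

sublocale U: paired_action "seq_scale sE" Rg seq_fst seq_snd seq_pair
  by (rule paired_action_seq[OF sE_module graded_R])

lemma E_direct: "direct_family (E j)"
  using E_graded_module[of j] by (simp add: graded_module_def)

lemma E_subgroup: "add_subgroup (E j r)"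
  by (rule direct_family_add_subgroup[OF E_direct])

lemma E_scale: "a \<in> Rg n \<Longrightarrow> x \<in> E j r \<Longrightarrow> sE a x \<in> E j (int n + r)"
  using E_graded_module[of j] by (simp add: graded_module_def)

lemma E_internal: "x \<in> E j r \<Longrightarrow> x \<in> internal_sum (E j)"
  by (rule internal_sum_homogeneous[of _ "E j"])

lemma d_hom: "graded_hom sE (E j) sE (E (Suc j)) (d j)"
  using resolution by (simp add: graded_injective_resolution_def)

lemma d_mem: "x \<in> E j r \<Longrightarrow> d j x \<in> E (Suc j) r"
  using d_hom[of j] by (auto simp: graded_hom_def image_subset_iff)

lemma d_add: "x \<in> E j r \<Longrightarrow> y \<in> E j r \<Longrightarrow> d j (x + y) = d j x + d j y"
  using d_hom[of j] E_internal by (simp add: graded_hom_def)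

lemma d_scale: "x \<in> E j r \<Longrightarrow> d j (sE a x) = sE a (d j x)"
  using d_hom[of j] E_internal by (simp add: graded_hom_def)

lemma d_0: "d j 0 = 0"
  using d_add[of 0 j 0 0] add_subgroup_0[OF E_subgroup] by simp

lemma d_kernel: "{x \<in> internal_sum (E (Suc j)). d (Suc j) x = 0} = d j ` internal_sum (E j)"
  using resolution by (simp add: graded_injective_resolution_def)

lemma d_d: "x \<in> internal_sum (E j) \<Longrightarrow> d (Suc j) (d j x) = 0"
  using d_kernel[of j] by blast

lemma d_component: "x \<in> internal_sum (E j) \<Longrightarrow> d j x \<in> E (Suc j) r \<Longrightarrow> d j (component (E j) r x) = d j x"
  using graded_hom_component[OF d_hom[of j] E_direct E_direct, of x r]
    component_homogeneous[OF E_direct[of "Suc j"], of "d j x" r r] by simp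

text \<open>Exactness is given on whole sums; since \<open>d\<close> preserves degrees, the degree
  \<open>r\<close> component of any preimage is a homogeneous preimage.\<close>

lemma d_exact:
  assumes x: "x \<in> E (Suc j) r" "d (Suc j) x = 0"
  obtains y where "y \<in> E j r" "d j y = x"
proof -
  obtain y where y: "y \<in> internal_sum (E j)" "x = d j y" using d_kernel[of j] x E_internal by blast
  show ?thesis
  proof (rule that)
    show "component (E j) r y \<in> E j r" by (rule component_mem[OF E_direct y(1)])
    show "d j (component (E j) r y) = x" using d_component[OF y(1)] x(1) y(2) by simp
  qed
qed

text \<open>The resolution sits in entry 0 of the sequences and is continued by 0 to negative
  degrees, which the cones will occupy.\<close>

definition terms :: "int \<Rightarrow> int \<Rightarrow> (nat \<Rightarrow> 'e) set" where
  "terms k r = (if k < 0 then {0} else seq_single ` E (nat k) r)"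

definition diff :: "int \<Rightarrow> (nat \<Rightarrow> 'e) \<Rightarrow> nat \<Rightarrow> 'e" where
  "diff k f = (if k < 0 then 0 else seq_single (d (nat k) (f 0)))"

lemma terms_complex: "U.cochain_complex terms diff"
  unfolding U.cochain_complex_def
proof (intro conjI allI ballI)
  note single = seq_single_scale[OF sE_module, symmetric] seq_single_add[symmetric] seq_single_diff[symmetric]
  show "U.graded_sub (terms k)" for k
    unfolding U.graded_sub_def terms_def add_subgroup_def
    using add_subgroup_0[OF E_subgroup, of "nat k"] add_subgroup_diff[OF E_subgroup, of _ "nat k"] E_scale[of _ _ _ "nat k"]
    by (auto simp: single image_iff)
  show "U.graded_map (terms k) (terms (k + 1)) (\<lambda>_. diff k)" for k
  proof (cases "k < 0")
    case True
    then show ?thesis using add_subgroup_0[OF E_subgroup]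
      by (auto simp: U.graded_map_def terms_def diff_def image_iff)
  next
    case False
    then have "nat (k + 1) = Suc (nat k)" by simp
    then show ?thesis
      using False d_mem[of _ "nat k"] d_add[of _ "nat k"] d_scale[of _ "nat k"]
      by (auto simp: U.graded_map_def terms_def diff_def single)
  qed
  show "diff (k + 1) (diff k x) = 0" if "x \<in> terms k r" for k r x
  proof (cases "k < 0")
    case True
    then show ?thesis by (simp add: diff_def d_0)
  next
    case False
    then have "nat (k + 1) = Suc (nat k)" by simp
    then show ?thesis using False that d_d[of _ "nat k"] E_internal by (auto simp: terms_def diff_def)
  qed
qed

lemma terms_injective: "U.injective_complex terms diff"
  unfolding U.injective_complex_def
proof (intro conjI allI)
  show "U.cochain_complex terms diff" by (rule terms_complex)
  show "U.baer (terms k)" for k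
    unfolding U.baer_def
  proof (intro allI impI)
    fix J s \<phi> assume J: "U.homogeneous_ideal J \<and> U.ideal_map J (terms k) s \<phi>"
    show "\<exists>w\<in>terms k s. \<forall>n. \<forall>a\<in>J n. \<phi> n a = seq_scale sE a w"
    proof (cases "k < 0")
      case True
      then show ?thesis using J by (auto simp: U.ideal_map_def terms_def)
    next
      case False
      have \<phi>: "\<phi> n a = seq_single (\<phi> n a 0)" "\<phi> n a 0 \<in> E (nat k) (int n + s)" if "a \<in> J n" for n a
      proof -
        have "\<phi> n a \<in> seq_single ` E (nat k) (int n + s)"
          using J that False by (simp add: U.ideal_map_def terms_def)
        then show "\<phi> n a = seq_single (\<phi> n a 0)" "\<phi> n a 0 \<in> E (nat k) (int n + s)" by auto
      qed
      have "EA.ideal_map J (E (nat k)) s (\<lambda>n a. \<phi> n a 0)"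
        using J \<phi>(2) by (simp add: U.ideal_map_def EA.ideal_map_def seq_scale_def)
      moreover have "EA.baer (E (nat k))"
        using resolution by (intro EA.baer_of_graded_injective) (simp add: graded_injective_resolution_def)
      moreover have "EA.homogeneous_ideal J" using J by simp
      ultimately obtain w where w: "w \<in> E (nat k) s" "\<And>n a. a \<in> J n \<Longrightarrow> \<phi> n a 0 = sE a w"
        unfolding EA.baer_def by meson
      have "\<phi> n a = seq_scale sE a (seq_single w)" if "a \<in> J n" for n a
        using \<phi>(1)[OF that] w(2)[OF that] seq_single_scale[OF sE_module, of a w] by simp
      then show ?thesis using w(1) False by (auto simp: terms_def)
    qed
  qed
  show "\<exists>b. \<forall>k<b. \<forall>r. terms k r = {0}" by (intro exI[of _ 0]) (simp add: terms_def)
qed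

lemma terms_exact:
  assumes "k \<noteq> 0"
  shows "U.exact_from terms diff c k"
  unfolding U.exact_from_def
proof (intro allI ballI impI)
  fix r x assume x: "x \<in> terms k r" "diff k x = 0"
  show "x \<in> diff (k - 1) ` terms (k - 1) r"
  proof (cases "k < 0")
    case True
    then show ?thesis using x by (auto simp: terms_def diff_def)
  next
    case False
    define j where "j = nat (k - 1)"
    have k: "nat k = Suc j" using False assms by (simp add: j_def)
    obtain u where u: "u \<in> E (Suc j) r" "x = seq_single u" using x(1) False by (auto simp: terms_def k)
    then have "d (Suc j) u = 0" using x(2) False by (simp add: diff_def k)
    then obtain y where y: "y \<in> E j r" "d j y = u" using d_exact[OF u(1)] by blast
    have "k - 1 = int j" using False assms by (simp add: j_def)
    moreover have "seq_single y \<in> terms (int j) r" using y(1) by (simp add: terms_def)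
    moreover have "diff (int j) (seq_single y) = x" using y(2) u(2) by (simp add: diff_def)
    ultimately show ?thesis by (metis imageI)
  qed
qed

lemma torsion_single: "U.is_torsion (seq_single x) \<longleftrightarrow> EA.is_torsion x"
  unfolding U.is_torsion_def EA.is_torsion_def by (simp flip: seq_single_scale[OF sE_module])

text \<open>A coboundary of degree \<open>r\<close> may come from an inhomogeneous torsion element;
  the degree \<open>r\<close> component of that element is torsion as well and has the same
  image.\<close>

lemma coboundary_iff:
  assumes x: "x \<in> E i r"
  shows "x \<in> lc_coboundaries Rg sE E d i \<longleftrightarrow>
    (\<exists>y\<in>terms (int i - 1) r. U.is_torsion y \<and> diff (int i - 1) y = seq_single x)"
proof (cases i)
  case 0
  then show ?thesis by (auto simp: lc_coboundaries_def terms_def diff_def U.torsion_zero)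
next
  case (Suc j)
  have eq: "int i - 1 = int j" using Suc by simp
  show ?thesis
  proof
    assume "x \<in> lc_coboundaries Rg sE E d i"
    then obtain y where y: "y \<in> internal_sum (E j)" "EA.is_torsion y" "x = d j y"
      by (auto simp: lc_coboundaries_def Suc EA.torsion_iff)
    let ?y = "component (E j) r y"
    have "?y \<in> E j r" by (rule component_mem[OF E_direct y(1)])
    moreover have "EA.is_torsion ?y" by (rule EA.torsion_component[OF E_graded_module y(1,2)])
    moreover have "d j ?y = x" using d_component[OF y(1)] x y(3) by (simp add: Suc)
    ultimately show "\<exists>y\<in>terms (int i - 1) r. U.is_torsion y \<and> diff (int i - 1) y = seq_single x"
      unfolding eq by (intro bexI[of _ "seq_single ?y"]) (simp_all add: torsion_single terms_def diff_def)
  next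
    assume "\<exists>y\<in>terms (int i - 1) r. U.is_torsion y \<and> diff (int i - 1) y = seq_single x"
    then obtain y where "y \<in> E j r" "EA.is_torsion y" "d j y = x"
      unfolding eq by (auto simp: torsion_single terms_def diff_def)
    then show "x \<in> lc_coboundaries Rg sE E d i"
      using E_internal by (auto simp: lc_coboundaries_def Suc EA.torsion_iff)
  qed
qed

lemma lc_nonzero_iff:
  "U.lc_nonzero terms diff (int i) r \<longleftrightarrow> lc_cocycles Rg sE E d i \<inter> E i r \<noteq> lc_coboundaries Rg sE E d i \<inter> E i r"
proof -
  \<comment> \<open>Once coboundaries are known to be cocycles, two different components mean a
    cocycle that is no coboundary.\<close>
  have "lc_coboundaries Rg sE E d i \<inter> E i r \<subseteq> lc_cocycles Rg sE E d i"
  proof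
    fix x assume x: "x \<in> lc_coboundaries Rg sE E d i \<inter> E i r"
    then have xE: "x \<in> internal_sum (E i)" using E_internal by blast
    show "x \<in> lc_cocycles Rg sE E d i"
    proof (cases i)
      case 0
      then show ?thesis using x xE d_0
        by (simp add: lc_coboundaries_def lc_cocycles_def EA.torsion_iff EA.torsion_zero)
    next
      case (Suc j)
      then obtain y where y: "y \<in> internal_sum (E j)" "EA.is_torsion y" "x = d j y"
        using x by (auto simp: lc_coboundaries_def EA.torsion_iff)
      have sc: "d j (sE a y) = sE a (d j y)" for a using d_hom[of j] y(1) by (simp add: graded_hom_def)
      have "EA.is_torsion x"
        using y(2) unfolding EA.is_torsion_def y(3) sc[symmetric] by (metis d_0)
      then show ?thesis using d_d[OF y(1)] xE y(3) by (simp add: lc_cocycles_def EA.torsion_iff Suc)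
    qed
  qed
  then have "lc_cocycles Rg sE E d i \<inter> E i r \<noteq> lc_coboundaries Rg sE E d i \<inter> E i r \<longleftrightarrow>
      (\<exists>x\<in>E i r. x \<in> lc_cocycles Rg sE E d i \<and> x \<notin> lc_coboundaries Rg sE E d i)" by blast
  also have "\<dots> \<longleftrightarrow> (\<exists>x\<in>E i r. U.is_torsion (seq_single x) \<and> diff (int i) (seq_single x) = 0 \<and>
      (\<forall>y\<in>terms (int i - 1) r. U.is_torsion y \<longrightarrow> diff (int i - 1) y \<noteq> seq_single x))"
    using coboundary_iff[of _ i r] E_internal[of _ i r]
    by (auto simp: lc_cocycles_def EA.torsion_iff torsion_single diff_def[of "int i"])
  also have "\<dots> \<longleftrightarrow> U.lc_nonzero terms diff (int i) r"
    by (simp add: U.lc_nonzero_def terms_def[of "int i"])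
  finally show ?thesis by simp
qed

lemma terms_presents:
  assumes "internal_sum Mg = UNIV"
  shows "U.presents sM Mg terms diff (\<lambda>x. seq_single (\<epsilon> x)) (\<lambda>r. {0} \<inter> Mg r)"
  unfolding U.presents_def
proof (intro conjI allI ballI impI)
  have \<epsilon>: "graded_hom sM Mg sE (E 0) \<epsilon>" and inj: "inj_on \<epsilon> (internal_sum Mg)"
    and ker: "{x \<in> internal_sum (E 0). d 0 x = 0} = \<epsilon> ` internal_sum Mg"
    using resolution by (simp_all add: graded_injective_resolution_def)
  have M: "direct_family Mg" using graded_M by (simp add: graded_module_def)
  have add: "\<epsilon> (x + y) = \<epsilon> x + \<epsilon> y" for x y using \<epsilon> assms by (simp add: graded_hom_def)
  have mem: "\<epsilon> x \<in> E 0 r" if "x \<in> Mg r" for x r using \<epsilon> that by (auto simp: graded_hom_def image_subset_iff)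
  have \<epsilon>0: "\<epsilon> 0 = 0" using add[of 0 0] by simp
  fix r
  show "seq_single (\<epsilon> x) \<in> terms 0 r" if "x \<in> Mg r" for x using mem[OF that] by (simp add: terms_def)
  show "diff 0 (seq_single (\<epsilon> x)) = 0" for x using ker assms by (auto simp: diff_def)
  show "seq_single (\<epsilon> (x + y)) = seq_single (\<epsilon> x) + seq_single (\<epsilon> y)" for x y
    by (simp add: add seq_single_add)
  show "seq_single (\<epsilon> (sM a x)) = seq_scale sE a (seq_single (\<epsilon> x))" for a x
    using \<epsilon> assms seq_single_scale[OF sE_module] by (simp add: graded_hom_def)
  show "\<exists>x\<in>Mg r. y - seq_single (\<epsilon> x) \<in> diff (- 1) ` terms (- 1) r" if y: "y \<in> terms 0 r" "diff 0 y = 0" for y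
  proof -
    obtain v where v: "v \<in> E 0 r" "y = seq_single v" using y(1) by (auto simp: terms_def)
    then have "d 0 v = 0" using y(2) by (simp add: diff_def)
    then obtain x where x: "v = \<epsilon> x" using ker E_internal[OF v(1)] by blast
    have "\<epsilon> (component Mg r x) = component (E 0) r (\<epsilon> x)"
      using graded_hom_component[OF \<epsilon> M E_direct, of x r] assms by simp
    also have "\<dots> = v" using component_homogeneous[OF E_direct v(1), of r] x by simp
    finally have "y - seq_single (\<epsilon> (component Mg r x)) = 0" using v(2) by simp
    moreover have "component Mg r x \<in> Mg r" using component_mem[OF M] assms by auto
    ultimately show ?thesis by (intro bexI[of _ "component Mg r x"]) (simp_all add: diff_def terms_def)
  qed
  show "seq_single (\<epsilon> x) \<in> diff (- 1) ` terms (- 1) r \<longleftrightarrow> x \<in> {0} \<inter> Mg r" if "x \<in> Mg r" for x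
    using inj_onD[OF inj, of x 0] assms \<epsilon>0 that by (auto simp: diff_def terms_def)
qed

end

section \<open>Comparison of end degrees\<close>

lemma end_degree_le_iff:
  "end_degree G Z B \<le> u \<longleftrightarrow> (\<forall>r. Z \<inter> G r \<noteq> B \<inter> G r \<longrightarrow> ereal (real_of_int r) \<le> u)"
  unfolding end_degree_def by (auto simp: Sup_le_iff)

theorem theorem5p6:
  fixes Rg :: "nat \<Rightarrow> 'r::comm_ring_1 set"
    and sM :: "'r \<Rightarrow> 'm \<Rightarrow> 'm::ab_group_add" and Mg :: "int \<Rightarrow> 'm set"
    and sE :: "'r \<Rightarrow> 'e \<Rightarrow> 'e::ab_group_add" and E :: "nat \<Rightarrow> int \<Rightarrow> 'e set"
    and \<epsilon> :: "'m \<Rightarrow> 'e" and d :: "nat \<Rightarrow> 'e \<Rightarrow> 'e"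
    and t :: nat and zs :: "'r list"
  assumes "standard_graded Rg"
    and "noetherian_subring (Rg 0)"
    and "finitely_generated_algebra (Rg 0)"
    and "graded_module Rg sM Mg" and "internal_sum Mg = UNIV"
    and "finitely_generated_module sM"
    and "graded_injective_resolution Rg sM Mg sE E \<epsilon> d"
    and "length zs = t + 1" and "set zs \<subseteq> Rg 1"
    and "filter_regular_seq Rg sM Mg zs"
  shows "partial_reg Rg sE E d t = a_seq sM Mg zs \<and>
    partial_a_star Rg sE E d t = s_seq sM Mg zs"
proof -
  have R: "graded_ring Rg" using assms(1) by (simp add: standard_graded_def)
  note M = assms(4) and total = assms(5) and len = assms(8) and zs = assms(9)
  have mod: "module sM" using M by (simp add: graded_module_def)
  interpret graded_resolution Rg sM Mg sE E \<epsilon> d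
    by (rule graded_resolution.intro[OF R M assms(7)])
  define C where "C = rec_nat terms (\<lambda>_. U.cone)"
  define D where "D = rec_nat diff (\<lambda>i. U.cone_diff (zs ! i))"
  define N where "N i r = ideal_times sM (Q_ideal zs i) \<inter> Mg r" for i r
  have z: "zs ! i \<in> Rg 1" if "i \<le> t" for i using zs len that nth_mem[of i zs] by auto
  interpret K: cone_sequence "seq_scale sE" Rg seq_fst seq_snd seq_pair C D "\<lambda>i. zs ! i" t
    by unfold_locales (use z terms_injective terms_exact in \<open>simp_all add: C_def D_def\<close>)
  have N0: "U.presents sM Mg (C 0) (D 0) (\<lambda>x. seq_single (\<epsilon> x)) (N 0)"
  proof -
    have "N 0 = (\<lambda>r. {0} \<inter> Mg r)" by (simp add: fun_eq_iff N_def ideal_times_Q_0[OF mod])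
    then show ?thesis using terms_presents[OF total] by (simp add: C_def D_def)
  qed
  have N_Suc: "N (Suc i) r = {x \<in> Mg r. \<exists>m\<in>Mg (r - 1). x - sM (zs ! i) m \<in> N i r}" if "i \<le> t" for i r
    unfolding N_def using homogeneous_ideal_times_Q_Suc[OF M total zs] that len by simp
  have kernel: "U.kernel_nonzero (C i) (D i) (zs ! i) r \<longleftrightarrow>
      colon sM (ideal_times sM (Q_ideal zs i)) (zs ! i) \<inter> Mg r \<noteq> ideal_times sM (Q_ideal zs i) \<inter> Mg r"
    if i: "i \<le> t" for i r
  proof -
    let ?Q = "ideal_times sM (Q_ideal zs i)"
    have i': "i \<le> Suc t" using i by simp
    obtain e where e: "U.presents sM Mg (C i) (D i) e (N i)"
      using K.presents_iterate[OF M N0 N_Suc i'] by blast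
    have zM: "sM (zs ! i) x \<in> Mg (1 + r)" if "x \<in> Mg r" for x
      using M z[OF i] that unfolding graded_module_def by (metis of_nat_1)
    interpret module sM by (rule mod)
    have "?Q \<inter> Mg r \<subseteq> colon sM ?Q (zs ! i)"
      by (auto simp: colon_def ideal_times_def intro: span_scale)
    then have "colon sM ?Q (zs ! i) \<inter> Mg r \<noteq> ?Q \<inter> Mg r \<longleftrightarrow> (\<exists>x\<in>Mg r. sM (zs ! i) x \<in> ?Q \<and> x \<notin> ?Q)"
      by (auto simp: colon_def)
    also have "\<dots> \<longleftrightarrow> (\<exists>x\<in>Mg r. sM (zs ! i) x \<in> N i (1 + r) \<and> x \<notin> N i r)"
      using zM by (auto simp: N_def)
    finally show ?thesis using U.presents_kernel_nonzero[OF K.C_complex[OF i'] z[OF i] M e] by simp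
  qed
  interpret K: filter_regular_cone_sequence "seq_scale sE" Rg seq_fst seq_snd seq_pair C D "\<lambda>i. zs ! i" t
  proof unfold_locales
    fix i assume i: "i \<le> t"
    then have "filter_regular_mod sM Mg (ideal_times sM (Q_ideal zs i)) (zs ! i)"
      using assms(10) len by (simp add: filter_regular_seq_def)
    then show "\<exists>c. \<forall>s\<ge>c. \<not> U.kernel_nonzero (C i) (D i) (zs ! i) s"
      unfolding filter_regular_mod_def kernel[OF i] by simp
  qed
  \<comment> \<open>Suprema are compared through their upper bounds \<open>u\<close>, which covers
    infinite end degrees as well.\<close>
  have a_lc_le: "a_lc Rg sE E d j \<le> u \<longleftrightarrow>
      (\<forall>r. U.lc_nonzero (C 0) (D 0) (int j) r \<longrightarrow> ereal (real_of_int r) \<le> u)" for j u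
    unfolding a_lc_def end_degree_le_iff by (simp add: C_def D_def lc_nonzero_iff)
  have a_quot_le: "a_quot sM Mg zs i \<le> u \<longleftrightarrow>
      (\<forall>r. U.kernel_nonzero (C i) (D i) (zs ! i) r \<longrightarrow> ereal (real_of_int r) \<le> u)" if "i \<le> t" for i u
    unfolding a_quot_def end_degree_le_iff kernel[OF that] ..
  have lc_to_kernel: "\<exists>r'\<ge>r + int j. U.kernel_nonzero (C j) (D j) (zs ! j) r'"
    if "j \<le> t" "U.lc_nonzero (C 0) (D 0) (int j) r" for j r
    using K.lc_nonzero_imp_kernel[of 0 j r] that by simp
  have kernel_to_lc: "\<exists>j\<le>i. \<exists>r'. U.lc_nonzero (C 0) (D 0) (int j) r' \<and> r \<le> r' + int j \<and> r - int i \<le> r'"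
    if "i \<le> t" "U.kernel_nonzero (C i) (D i) (zs ! i) r" for i r
    using K.kernel_imp_lc_nonzero[of 0 i r] that by simp
  have lens: "{..<length zs} = {..t}" using len by auto
  have shift: "x + ereal (real n) \<le> u \<longleftrightarrow> x \<le> u - ereal (real n)" for x u :: ereal and n
    by (simp add: ereal_le_minus)
  have shift': "x - ereal (real n) \<le> u \<longleftrightarrow> x \<le> u + ereal (real n)" for x u :: ereal and n
    by (simp add: ereal_minus_le)
  have lc_upper: "ereal (real_of_int r) \<le> a_lc Rg sE E d j" if "U.lc_nonzero (C 0) (D 0) (int j) r" for j r
    using a_lc_le[of j "a_lc Rg sE E d j"] that by simp
  have quot_upper: "ereal (real_of_int r) \<le> a_quot sM Mg zs i" if "i \<le> t" "U.kernel_nonzero (C i) (D i) (zs ! i) r" for i r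
    using a_quot_le[OF that(1), of "a_quot sM Mg zs i"] that(2) by simp
  \<comment> \<open>Valid for each index separately, this gives one inequality in both (a) and (b).
    The converse is obtained only for the maxima, as a kernel class at stage \<open>i\<close> may
    stem from any \<open>j \<le> i\<close>.\<close>
  have lc_bound: "a_lc Rg sE E d j + ereal (real j) \<le> a_quot sM Mg zs j" if j: "j \<le> t" for j
    unfolding shift a_lc_le
  proof (intro allI impI)
    fix r assume "U.lc_nonzero (C 0) (D 0) (int j) r"
    then obtain r' where r': "r' \<ge> r + int j" "U.kernel_nonzero (C j) (D j) (zs ! j) r'"
      using lc_to_kernel[OF j] by blast
    have "ereal (real_of_int r) + ereal (real j) \<le> ereal (real_of_int r')" using r'(1) by simp
    also have "\<dots> \<le> a_quot sM Mg zs j" by (rule quot_upper[OF j r'(2)])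
    finally show "ereal (real_of_int r) \<le> a_quot sM Mg zs j - ereal (real j)" unfolding shift .
  qed
  have "partial_reg Rg sE E d t = a_seq sM Mg zs"
  proof (rule antisym)
    show "partial_reg Rg sE E d t \<le> a_seq sM Mg zs"
      unfolding partial_reg_def a_seq_def lens
    proof (rule Max.boundedI)
      fix v assume "v \<in> (\<lambda>i. a_lc Rg sE E d i + ereal (real i)) ` {..t}"
      then obtain j where j: "j \<le> t" "v = a_lc Rg sE E d j + ereal (real j)" by auto
      have "v \<le> a_quot sM Mg zs j" unfolding j(2) by (rule lc_bound[OF j(1)])
      also have "\<dots> \<le> Max (a_quot sM Mg zs ` {..t})" using j(1) by (intro Max_ge) auto
      finally show "v \<le> Max (a_quot sM Mg zs ` {..t})" .
    qed auto
    show "a_seq sM Mg zs \<le> partial_reg Rg sE E d t"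
      unfolding a_seq_def lens
    proof (rule Max.boundedI)
      fix v assume "v \<in> a_quot sM Mg zs ` {..t}"
      then obtain i where i: "i \<le> t" "v = a_quot sM Mg zs i" by auto
      show "v \<le> partial_reg Rg sE E d t"
        unfolding i(2) a_quot_le[OF i(1)]
      proof (intro allI impI)
        fix r assume "U.kernel_nonzero (C i) (D i) (zs ! i) r"
        then obtain j r' where j: "j \<le> i" "U.lc_nonzero (C 0) (D 0) (int j) r'" "r \<le> r' + int j"
          using kernel_to_lc[OF i(1)] by blast
        have "ereal (real_of_int r) \<le> ereal (real_of_int r') + ereal (real j)" using j(3) by simp
        also have "\<dots> \<le> a_lc Rg sE E d j + ereal (real j)" by (intro add_right_mono lc_upper j(2))
        also have "\<dots> \<le> partial_reg Rg sE E d t"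
          unfolding partial_reg_def using i(1) j(1) by (intro Max_ge) auto
        finally show "ereal (real_of_int r) \<le> partial_reg Rg sE E d t" .
      qed
    qed auto
  qed
  moreover have "partial_a_star Rg sE E d t = s_seq sM Mg zs"
  proof (rule antisym)
    show "partial_a_star Rg sE E d t \<le> s_seq sM Mg zs"
      unfolding partial_a_star_def s_seq_def lens
    proof (rule Max.boundedI)
      fix v assume "v \<in> a_lc Rg sE E d ` {..t}"
      then obtain j where j: "j \<le> t" "v = a_lc Rg sE E d j" by auto
      have "v \<le> a_quot sM Mg zs j - ereal (real j)" using lc_bound[OF j(1)] unfolding shift j(2) .
      also have "\<dots> \<le> Max ((\<lambda>i. a_quot sM Mg zs i - ereal (real i)) ` {..t})" using j(1) by (intro Max_ge) auto
      finally show "v \<le> Max ((\<lambda>i. a_quot sM Mg zs i - ereal (real i)) ` {..t})" .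
    qed auto
    show "s_seq sM Mg zs \<le> partial_a_star Rg sE E d t"
      unfolding s_seq_def lens
    proof (rule Max.boundedI)
      fix v assume "v \<in> (\<lambda>i. a_quot sM Mg zs i - ereal (real i)) ` {..t}"
      then obtain i where i: "i \<le> t" "v = a_quot sM Mg zs i - ereal (real i)" by auto
      show "v \<le> partial_a_star Rg sE E d t"
        unfolding i(2) shift' a_quot_le[OF i(1)]
      proof (intro allI impI)
        fix r assume "U.kernel_nonzero (C i) (D i) (zs ! i) r"
        then obtain j r' where j: "j \<le> i" "U.lc_nonzero (C 0) (D 0) (int j) r'" "r - int i \<le> r'"
          using kernel_to_lc[OF i(1)] by blast
        \<comment> \<open>Here the loss of internal degree is bounded by the stage \<open>i\<close>,
          the number subtracted in \<open>s_seq\<close>, instead of \<open>j\<close>.\<close>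
        have "ereal (real_of_int r) \<le> ereal (real_of_int r') + ereal (real i)" using j(3) by simp
        also have "\<dots> \<le> a_lc Rg sE E d j + ereal (real i)" by (intro add_right_mono lc_upper j(2))
        also have "\<dots> \<le> partial_a_star Rg sE E d t + ereal (real i)"
          unfolding partial_a_star_def using i(1) j(1) by (intro add_right_mono Max_ge) auto
        finally show "ereal (real_of_int r) \<le> partial_a_star Rg sE E d t + ereal (real i)" .
      qed
    qed auto
  qed
  ultimately show ?thesis ..
qed

end
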